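(* Let $\boldsymbol{\nu}\in\mathcal{F}_1$ be a multi-index of finite support and let $k\in\{0,1,\ldots,|\boldsymbol{\nu}|\}$. Then, for every $f\in V^*$ and every $\boldsymbol{y}\in U$, the weak solution $u(\cdot,\boldsymbol{y})$ satisfies $$\sum_{\substack{\boldsymbol{\omega}\le\boldsymbol{\nu}\\ |\boldsymbol{\omega}|=k}} \boldsymbol{b}^{-2\boldsymbol{\omega}}\,\|\partial^{\boldsymbol{\omega}}u(\cdot,\boldsymbol{y})\|_V^2 \;\le\; \left(\left(\frac{2\,\widetilde{\kappa}(\boldsymbol{\nu})}{1-\overline{\kappa}}\right)^{k}\frac{\|f\|_{V^*}}{(1-\overline{\kappa})\,a_{0,\min}}\right)^2 .$$ Moreover, for $k=|\boldsymbol{\nu}|$, $$\|\partial^{\boldsymbol{\nu}}u(\cdot,\boldsymbol{y})\|_V \;\le\; \boldsymbol{b}^{\boldsymbol{\nu}}\left(\frac{2\,\widetilde{\kappa}(\boldsymbol{\nu})}{1-\overline{\kappa}}\right)^{|\boldsymbol{\nu}|}\frac{\|f\|_{V^*}}{(1-\overline{\kappa})\,a_{0,\min}} .$$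
   Context: Let $D\subset\mathbb{R}^d$, $d\in\{1,2,3\}$, be a bounded convex Lipschitz polyhedral domain, $V=H_0^1(D)$ with norm $\|v\|_V=\|\nabla v\|_{L^2(D)}$, $V^*=H^{-1}(D)$ its dual (pivot space $L^2(D)$), and $U=[-\frac12,\frac12]^{\mathbb{N}}$. The diffusion coefficient is $a(\boldsymbol{x},\boldsymbol{y})=a_0(\boldsymbol{x})+\sum_{j\ge1}y_j\psi_j(\boldsymbol{x})$ for $\boldsymbol{x}\in D$, $\boldsymbol{y}=(y_j)_{j\ge1}\in U$, with functions $\psi_j$ on $D$ and $a_0\in L^\infty(D)$ such that $0<a_{0,\min}\le a_0(\boldsymbol{x})\le a_{0,\max}<\infty$ a.e. on $D$ for constants $a_{0,\min},a_{0,\max}$. For $f\in V^*$ and $\boldsymbol{y}\in U$, $u(\cdot,\boldsymbol{y})\in V$ is the unique weak solution of $-\nabla\cdot(a(\cdot,\boldsymbol{y})\nabla u)=f$ in $D$, $u=0$ on $\partial D$: $\int_D a(\boldsymbol{x},\boldsymbol{y})\nabla u(\boldsymbol{x},\boldsymbol{y})\cdot\nabla v(\boldsymbol{x})\,d\boldsymbol{x}=\langle f,v\rangle_{V^*\times V}$ for all $v\in V$. Assumptions: there is $\overline{\kappa}\in(0,1)$ with $\big\|\sum_{j\ge1}\frac{|\psi_j|}{2a_0}\big\|_{L^\infty(D)}\le\overline{\kappa}$, and there is a real sequence $\boldsymbol{b}=(b_j)_{j\ge1}$ with $0<b_j\le1$ for all $j$ such that $\kappa:=\big\|\sum_{j\ge1}\frac{|\psi_j|/b_j}{2a_0}\big\|_{L^\infty(D)}<1$;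 here $0<\overline{\kappa}\le\kappa<1$. Multi-indices: $\mathbb{N}_0=\{0,1,2,\ldots\}$; for $\boldsymbol{\nu}=(\nu_j)_{j\ge1}$, $|\boldsymbol{\nu}|=\sum_j\nu_j$, $\mathrm{supp}(\boldsymbol{\nu})=\{j\ge1:\nu_j>0\}$; $\mathcal{F}_1$ is the set of $\boldsymbol{\nu}\in\{0,1\}^{\mathbb{N}}$ with finite support. $\boldsymbol{\omega}\le\boldsymbol{\nu}$ means $\omega_j\le\nu_j$ for all $j$. $\boldsymbol{b}^{\boldsymbol{\nu}}=\prod_{j}b_j^{\nu_j}$. $\partial^{\boldsymbol{\nu}}$ is the mixed partial derivative of order $\nu_j$ in each parameter $y_j$ (of the map $\boldsymbol{y}\mapsto u(\cdot,\boldsymbol{y})\in V$). For $\boldsymbol{\nu}\in\mathcal{F}_1$, $$\widetilde{\kappa}(\boldsymbol{\nu})=\Big\|\sum_{j\in\mathrm{supp}(\boldsymbol{\nu})}\frac{|\psi_j|/b_j}{2a_0}\Big\|_{L^\infty(D)}.$$ Convention: $0^0=1$. *)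

theory Defs
  imports "HOL-Analysis.Analysis" "HOL-Probability.Essential_Supremum"
begin

section \<open>Domains\<close>

text \<open>Near each boundary point, \<open>D\<close> is the strict epigraph of a Lipschitz function over the
  hyperplane orthogonal to some unit vector \<open>e\<close>.\<close>

definition Lipschitz_boundary :: "(real^'d) set \<Rightarrow> bool" where
  "Lipschitz_boundary D \<longleftrightarrow>
    (\<forall>x\<in>frontier D. \<exists>r>0. \<exists>e. \<exists>g :: real^'d \<Rightarrow> real. \<exists>L.
       norm e = 1 \<and> L-lipschitz_on {z. z \<bullet> e = 0} g \<and>
       D \<inter> ball x r = {z \<in> ball x r. g (z - (z \<bullet> e) *\<^sub>R e) < z \<bullet> e})"

definition bounded_convex_Lipschitz_polyhedral_domain :: "(real^'d) set \<Rightarrow> bool" where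
  "bounded_convex_Lipschitz_polyhedral_domain D \<longleftrightarrow>
    D \<noteq> {} \<and> open D \<and> bounded D \<and> convex D \<and> polyhedron (closure D) \<and> Lipschitz_boundary D"

section \<open>Test functions and Sobolev spaces\<close>

text \<open>Functions on \<open>D\<close> are represented by total functions, of which only the values on \<open>D\<close>
  matter. Elements of \<open>L\<^sup>2(D)\<close> and of the Sobolev spaces are represented by functions rather than
  by equivalence classes, so that equality in these spaces is vanishing of the norm of the
  difference.\<close>

definition pd :: "'d \<Rightarrow> (real^'d \<Rightarrow> real) \<Rightarrow> real^'d \<Rightarrow> real" where
  "pd i \<phi> x = frechet_derivative \<phi> (at x) (axis i 1)"

primrec Ck :: "nat \<Rightarrow> (real^'d \<Rightarrow> real) \<Rightarrow> bool" where
  "Ck 0 \<phi> \<longleftrightarrow> continuous_on UNIV \<phi>"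
| "Ck (Suc k) \<phi> \<longleftrightarrow> (\<forall>x. \<phi> differentiable (at x)) \<and> (\<forall>i. Ck k (pd i \<phi>))"

definition test_functions :: "(real^'d) set \<Rightarrow> (real^'d \<Rightarrow> real) set" where
  "test_functions D =
    {\<phi>. (\<forall>k. Ck k \<phi>) \<and> compact (closure {x. \<phi> x \<noteq> 0}) \<and> closure {x. \<phi> x \<noteq> 0} \<subseteq> D}"

definition L2 :: "(real^'d) set \<Rightarrow> (real^'d \<Rightarrow> 'b::euclidean_space) set" where
  "L2 D = {g. g \<in> borel_measurable (lebesgue_on D) \<and> integrable (lebesgue_on D) (\<lambda>x. (norm (g x))\<^sup>2)}"

definition L2_norm :: "(real^'d) set \<Rightarrow> (real^'d \<Rightarrow> 'b::euclidean_space) \<Rightarrow> real" where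
  "L2_norm D g = sqrt (LINT x|lebesgue_on D. (norm (g x))\<^sup>2)"

definition has_weak_gradient ::
  "(real^'d) set \<Rightarrow> (real^'d \<Rightarrow> real) \<Rightarrow> (real^'d \<Rightarrow> real^'d) \<Rightarrow> bool" where
  "has_weak_gradient D v g \<longleftrightarrow>
    (\<forall>\<phi>\<in>test_functions D. \<forall>i.
       (LINT x|lebesgue_on D. v x * pd i \<phi> x) = - (LINT x|lebesgue_on D. (g x $ i) * \<phi> x))"

definition H1 :: "(real^'d) set \<Rightarrow> (real^'d \<Rightarrow> real) set" where
  "H1 D = {v \<in> L2 D. \<exists>g\<in>L2 D. has_weak_gradient D v g}"

text \<open>The weak gradient is unique up to null sets; one representative is chosen.\<close>

definition weak_grad :: "(real^'d) set \<Rightarrow> (real^'d \<Rightarrow> real) \<Rightarrow> real^'d \<Rightarrow> real^'d" where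
  "weak_grad D v = (SOME g. g \<in> L2 D \<and> has_weak_gradient D v g)"

definition H1_norm :: "(real^'d) set \<Rightarrow> (real^'d \<Rightarrow> real) \<Rightarrow> real" where
  "H1_norm D v = sqrt ((L2_norm D v)\<^sup>2 + (L2_norm D (weak_grad D v))\<^sup>2)"

definition H10 :: "(real^'d) set \<Rightarrow> (real^'d \<Rightarrow> real) set" where
  "H10 D = {v \<in> H1 D. \<exists>\<phi> :: nat \<Rightarrow> real^'d \<Rightarrow> real. (\<forall>n. \<phi> n \<in> test_functions D) \<and>
                (\<lambda>n. H1_norm D (\<lambda>x. \<phi> n x - v x)) \<longlonglongrightarrow> 0}"

definition V_norm :: "(real^'d) set \<Rightarrow> (real^'d \<Rightarrow> real) \<Rightarrow> real" where
  "V_norm D v = L2_norm D (weak_grad D v)"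

text \<open>The dual \<open>H\<^sup>-\<^sup>1(D)\<close>. Boundedness makes a functional independent of the chosen
  representative.\<close>

definition V_dual :: "(real^'d) set \<Rightarrow> ((real^'d \<Rightarrow> real) \<Rightarrow> real) set" where
  "V_dual D = {f.
     (\<forall>v\<in>H10 D. \<forall>w\<in>H10 D. f (\<lambda>x. v x + w x) = f v + f w) \<and>
     (\<forall>c. \<forall>v\<in>H10 D. f (\<lambda>x. c * v x) = c * f v) \<and>
     (\<exists>C. \<forall>v\<in>H10 D. \<bar>f v\<bar> \<le> C * V_norm D v)}"

definition dual_norm :: "(real^'d) set \<Rightarrow> ((real^'d \<Rightarrow> real) \<Rightarrow> real) \<Rightarrow> real" where
  "dual_norm D f = Sup {\<bar>f v\<bar> | v. v \<in> H10 D \<and> V_norm D v \<le> 1}"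

section \<open>The parametric diffusion problem\<close>

text \<open>Parameter sequences and multi-indices are indexed by \<open>nat\<close>, starting from \<open>0\<close>.\<close>

definition param_U :: "(nat \<Rightarrow> real) set" where
  "param_U = {y. \<forall>j. y j \<in> {- 1/2 .. 1/2}}"

definition diffusion ::
  "(real^'d \<Rightarrow> real) \<Rightarrow> (nat \<Rightarrow> real^'d \<Rightarrow> real) \<Rightarrow> (nat \<Rightarrow> real) \<Rightarrow> real^'d \<Rightarrow> real" where
  "diffusion a0 \<psi> y x = a0 x + (\<Sum>j. y j * \<psi> j x)"

definition weak_solution ::
  "(real^'d) set \<Rightarrow> (real^'d \<Rightarrow> real) \<Rightarrow> ((real^'d \<Rightarrow> real) \<Rightarrow> real) \<Rightarrow> (real^'d \<Rightarrow> real) \<Rightarrow> bool" where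
  "weak_solution D a f u \<longleftrightarrow> u \<in> H10 D \<and>
    (\<forall>v\<in>H10 D. (LINT x|lebesgue_on D. a x * (weak_grad D u x \<bullet> weak_grad D v x)) = f v)"

text \<open>The \<open>L\<^sup>\<infinity>(D)\<close>-norms of nonnegative functions and series are taken in \<open>ennreal\<close>: a divergent
  series has the value \<open>\<infinity>\<close> (not \<open>0\<close>).\<close>

definition Linf_norm :: "(real^'d) set \<Rightarrow> (real^'d \<Rightarrow> ennreal) \<Rightarrow> ennreal" where
  "Linf_norm D g = esssup (lebesgue_on D) g"

section \<open>Multi-indices\<close>

definition supp :: "(nat \<Rightarrow> nat) \<Rightarrow> nat set" where
  "supp \<nu> = {j. \<nu> j > 0}"

definition F1 :: "(nat \<Rightarrow> nat) set" where
  "F1 = {\<nu>. (\<forall>j. \<nu> j \<in> {0, 1}) \<and> finite (supp \<nu>)}"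

definition mi_abs :: "(nat \<Rightarrow> nat) \<Rightarrow> nat" where
  "mi_abs \<nu> = (\<Sum>j\<in>supp \<nu>. \<nu> j)"

definition mi_pow :: "(nat \<Rightarrow> real) \<Rightarrow> (nat \<Rightarrow> nat) \<Rightarrow> real" where
  "mi_pow b \<nu> = (\<Prod>j\<in>supp \<nu>. b j ^ \<nu> j)"

text \<open>Converting to \<open>real\<close> maps \<open>\<infinity>\<close> to \<open>0\<close>; the norm is finite whenever the corresponding norm
  of the series over all \<open>j\<close> is.\<close>

definition kappa_tilde ::
  "(real^'d) set \<Rightarrow> (real^'d \<Rightarrow> real) \<Rightarrow> (nat \<Rightarrow> real^'d \<Rightarrow> real) \<Rightarrow> (nat \<Rightarrow> real) \<Rightarrow> (nat \<Rightarrow> nat) \<Rightarrow> real"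
  where
  "kappa_tilde D a0 \<psi> b \<nu> =
    enn2real (Linf_norm D (\<lambda>x. \<Sum>j\<in>supp \<nu>. ennreal (\<bar>\<psi> j x\<bar> / b j / (2 * a0 x))))"

section \<open>Parametric derivatives of V-valued maps\<close>

text \<open>\<open>w\<close> is the derivative at \<open>y\<close>, with respect to the norm of \<open>V\<close>, of \<open>F\<close> in the parameter
  \<open>y\<^sub>j\<close>. The increments stay in the parameter set, so the derivative is one-sided where \<open>y\<^sub>j\<close> is an
  endpoint of its interval.\<close>

definition has_param_deriv ::
  "(real^'d) set \<Rightarrow> ((nat \<Rightarrow> real) \<Rightarrow> real^'d \<Rightarrow> real) \<Rightarrow> nat \<Rightarrow> (nat \<Rightarrow> real) \<Rightarrow> (real^'d \<Rightarrow> real) \<Rightarrow> bool"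
  where
  "has_param_deriv D F j y w \<longleftrightarrow> w \<in> H10 D \<and>
    ((\<lambda>t. V_norm D (\<lambda>x. (F (y(j := y j + t)) x - F y x) / t - w x)) \<longlongrightarrow> 0)
      (at 0 within {t. y(j := y j + t) \<in> param_U})"

text \<open>Iterated derivatives on the whole parameter set; the head of the list is the parameter
  differentiated last.\<close>

primrec has_iterated_deriv ::
  "(real^'d) set \<Rightarrow> ((nat \<Rightarrow> real) \<Rightarrow> real^'d \<Rightarrow> real) \<Rightarrow> nat list \<Rightarrow>
    ((nat \<Rightarrow> real) \<Rightarrow> real^'d \<Rightarrow> real) \<Rightarrow> bool" where
  "has_iterated_deriv D F [] G \<longleftrightarrow> (\<forall>y\<in>param_U. F y \<in> H10 D \<and> G y = F y)"
| "has_iterated_deriv D F (j # js) G \<longleftrightarrow>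
    (\<exists>H. has_iterated_deriv D F js H \<and> (\<forall>y\<in>param_U. has_param_deriv D H j y (G y)))"

text \<open>\<open>G\<close> is the mixed derivative of order \<open>\<nu>\<close>: differentiation in any order leads to \<open>G\<close>.\<close>

definition has_mixed_deriv ::
  "(real^'d) set \<Rightarrow> ((nat \<Rightarrow> real) \<Rightarrow> real^'d \<Rightarrow> real) \<Rightarrow> (nat \<Rightarrow> nat) \<Rightarrow>
    ((nat \<Rightarrow> real) \<Rightarrow> real^'d \<Rightarrow> real) \<Rightarrow> bool" where
  "has_mixed_deriv D F \<nu> G \<longleftrightarrow> finite (supp \<nu>) \<and>
    (\<forall>js. (\<forall>j. count_list js j = \<nu> j) \<longrightarrow> has_iterated_deriv D F js G)"

definition mixed_deriv ::
  "(real^'d) set \<Rightarrow> (nat \<Rightarrow> nat) \<Rightarrow> ((nat \<Rightarrow> real) \<Rightarrow> real^'d \<Rightarrow> real) \<Rightarrow>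
    (nat \<Rightarrow> real) \<Rightarrow> real^'d \<Rightarrow> real" where
  "mixed_deriv D \<nu> F = (SOME G. has_mixed_deriv D F \<nu> G)"

end

theory Submission
  imports Defs
begin

text \<open>
  Write \<open>A\<^sub>y(v, w)\<close> for the form \<open>\<integral> a(y) \<nabla>v \<bullet> \<nabla>w\<close> on \<open>V\<close> and \<open>B\<^sub>j(v, w)\<close> for \<open>\<integral> \<psi>\<^sub>j \<nabla>v \<bullet> \<nabla>w\<close>. The bound
  \<open>\<bar>a(y) - a\<^sub>0\<bar> \<le> \<kappa>bar a\<^sub>0\<close> makes \<open>A\<^sub>y\<close> coercive, and \<open>A\<^sub>y\<close> is affine in each parameter, with slope \<open>B\<^sub>j\<close> in
  \<open>y\<^sub>j\<close>. Formal differentiation of \<open>A\<^sub>y(u, v) = f(v)\<close> shows that the derivative \<open>u\<^sub>T\<close> in the parameters of a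
  finite set \<open>T \<noteq> \<emptyset>\<close> has to satisfy \<open>A\<^sub>y(u\<^sub>T, v) = - \<Sum>\<^bsub>j\<in>T\<^esub> B\<^sub>j(u\<^bsub>T-{j}\<^esub>, v)\<close>.

  \<^bold>\<open>Existence of the derivatives.\<close> The recursion is taken as the definition of \<open>u\<^sub>T\<close>, by
  \<open>Lax_Milgram\<close>. Since both the equation and its coefficients are explicit, subtracting the equations at
  two parameters gives, by induction on \<open>T\<close>, first \<open>\<parallel>u\<^sub>T(y + t e\<^sub>i) - u\<^sub>T(y)\<parallel> = O(t)\<close> (\<open>du_Lipschitz\<close>) and
  then that the difference quotient of \<open>u\<^sub>T\<close> in \<open>y\<^sub>i\<close> is within \<open>O(t)\<close> of \<open>u\<^bsub>T\<union>{i}\<^esub>\<close>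
  (\<open>du_difference_quotient\<close>). As \<open>u\<^sub>T\<close> depends on the set \<open>T\<close> only, the order of differentiation does
  not matter. Derivatives are unique up to \<open>V\<close>-norm zero (\<open>iterated_deriv_unique\<close>), so every choice
  of the mixed derivative has the norm of \<open>u\<^sub>T\<close>.

  \<^bold>\<open>The estimate.\<close> Let \<open>S\<close> be the support of \<open>\<nu>\<close>. Bounding the \<open>u\<^sub>T\<close> one at a time would produce a
  factorial; instead all sets of one size are treated together, through
  \<open>X\<^sub>k = \<Sum> b\<^bsup>-2T\<^esup> \<integral> a\<^sub>0 \<bar>\<nabla>u\<^sub>T\<bar>\<^sup>2\<close>, summed over \<open>T \<subseteq> S\<close> with \<open>k\<close> elements. Test the equation of \<open>u\<^sub>T\<close> with
  \<open>u\<^sub>T\<close> and split each product \<open>\<bar>\<psi>\<^sub>j\<bar> \<bar>\<nabla>u\<^bsub>T-{j}\<^esub>\<bar> \<bar>\<nabla>u\<^sub>T\<bar>\<close> by Young's inequality. In the sum over \<open>T\<close> and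
  \<open>j \<in> T\<close>, each \<open>T\<close> occurs with the weights \<open>\<bar>\<psi>\<^sub>j\<bar>/b\<^sub>j\<close>, \<open>j \<in> T\<close>, and each set \<open>T'\<close> of size \<open>k - 1\<close> with the
  weights for \<open>j \<in> S - T'\<close>. Both times these add up to at most \<open>2 \<kappa>\<^sub>\<nu> a\<^sub>0\<close>, where \<open>\<kappa>\<^sub>\<nu>\<close> is the value of
  \<open>kappa_tilde\<close> at \<open>\<nu>\<close>. Hence
  \<open>(1 - \<kappa>bar) X\<^sub>k \<le> \<kappa>\<^sub>\<nu> (s X\<^bsub>k-1\<^esub> + X\<^sub>k / s)\<close> for every \<open>s > 0\<close>, and the best \<open>s\<close> gives
  \<open>X\<^sub>k \<le> (2 \<kappa>\<^sub>\<nu> / (1 - \<kappa>bar))\<^sup>2 X\<^bsub>k-1\<^esub>\<close>; the energy \<open>X\<^sub>0\<close> of \<open>u\<close> is controlled by the data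
  (\<open>weighted_level_estimate\<close>). For \<open>k = \<bar>\<nu>\<bar>\<close> the sum has a single term, which is the second bound.

  \<^bold>\<open>The space.\<close> This needs \<open>V\<close> to be a Hilbert space. Its elements are plain functions, and \<open>weak_grad\<close> is
  an arbitrary choice, so even linearity of the gradient rests on uniqueness of weak gradients, that
  is on the fundamental lemma of the calculus of variations
  (\<open>AE_eq_0_if_orthogonal_to_test_functions\<close>). Test functions lie in \<open>H\<^sup>1\<close> by integration by parts, and
  completeness in the gradient seminorm follows from completeness of \<open>L\<^sup>2\<close> and the inequality
  \<open>Poincare\<close>.
\<close>

section \<open>Positive semidefinite forms on sets of functions\<close>

text \<open>Spaces such as \<open>L\<^sup>2(D)\<close> and \<open>V\<close> depend on the set \<open>D\<close> and are subsets of a function type, and their forms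
  may vanish on nonzero functions; hence a carrier set, pointwise operations and no definiteness.\<close>

locale semi_inner =
  fixes S :: "('x \<Rightarrow> 'b::real_vector) set"
    and B :: "('x \<Rightarrow> 'b) \<Rightarrow> ('x \<Rightarrow> 'b) \<Rightarrow> real"
  assumes zero_mem: "(\<lambda>x. 0) \<in> S"
    and add_mem: "u \<in> S \<Longrightarrow> v \<in> S \<Longrightarrow> (\<lambda>x. u x + v x) \<in> S"
    and scale_mem: "u \<in> S \<Longrightarrow> (\<lambda>x. c *\<^sub>R u x) \<in> S"
    and form_add: "u \<in> S \<Longrightarrow> v \<in> S \<Longrightarrow> w \<in> S \<Longrightarrow> B (\<lambda>x. u x + v x) w = B u w + B v w"
    and form_scale: "u \<in> S \<Longrightarrow> w \<in> S \<Longrightarrow> B (\<lambda>x. c *\<^sub>R u x) w = c * B u w"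
    and form_sym: "u \<in> S \<Longrightarrow> v \<in> S \<Longrightarrow> B u v = B v u"
    and form_nonneg: "u \<in> S \<Longrightarrow> 0 \<le> B u u"
begin

definition nrm :: "('x \<Rightarrow> 'b) \<Rightarrow> real" where "nrm u = sqrt (B u u)"

lemma diff_mem: "u \<in> S \<Longrightarrow> v \<in> S \<Longrightarrow> (\<lambda>x. u x - v x) \<in> S"
  using add_mem[of u "\<lambda>x. (-1) *\<^sub>R v x"] scale_mem[of v "-1"] by simp

lemma form_diff:
  assumes "u \<in> S" "v \<in> S" "w \<in> S"
  shows "B (\<lambda>x. u x - v x) w = B u w - B v w"
  using form_add[of u "\<lambda>x. (-1) *\<^sub>R v x" w] form_scale[of v w "-1"] scale_mem[of v "-1"] assms
  by simp

lemma form_add_right: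
  "u \<in> S \<Longrightarrow> v \<in> S \<Longrightarrow> w \<in> S \<Longrightarrow> B w (\<lambda>x. u x + v x) = B w u + B w v"
  using form_add[of u v w] form_sym add_mem by metis

lemma form_diff_right:
  "u \<in> S \<Longrightarrow> v \<in> S \<Longrightarrow> w \<in> S \<Longrightarrow> B w (\<lambda>x. u x - v x) = B w u - B w v"
  using form_diff[of u v w] form_sym diff_mem by metis

lemma form_scale_right: "u \<in> S \<Longrightarrow> w \<in> S \<Longrightarrow> B w (\<lambda>x. c *\<^sub>R u x) = c * B w u"
  using form_scale[of u w c] form_sym scale_mem by metis

lemmas mems = zero_mem add_mem scale_mem diff_mem
lemmas form_simps = form_add form_diff form_scale form_add_right form_diff_right form_scale_right

lemma nrm_nonneg [simp]: "0 \<le> nrm u" if "u \<in> S"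
  using form_nonneg[OF that] by (simp add: nrm_def)

lemma nrm_square: "u \<in> S \<Longrightarrow> (nrm u)\<^sup>2 = B u u"
  by (simp add: nrm_def form_nonneg)

lemma nrm_scale: "u \<in> S \<Longrightarrow> nrm (\<lambda>x. c *\<^sub>R u x) = \<bar>c\<bar> * nrm u"
  by (simp add: nrm_def form_simps mems real_sqrt_mult flip: mult.assoc)

lemma Cauchy_Schwarz:
  assumes u: "u \<in> S" and v: "v \<in> S"
  shows "\<bar>B u v\<bar> \<le> nrm u * nrm v"
proof -
  have ineq: "0 \<le> B u u + 2 * t * B u v + t\<^sup>2 * B v v" for t
  proof -
    have "0 \<le> B (\<lambda>x. u x + t *\<^sub>R v x) (\<lambda>x. u x + t *\<^sub>R v x)"
      by (intro form_nonneg mems u v)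
    also have "\<dots> = B u u + 2 * t * B u v + t\<^sup>2 * B v v"
      using form_sym[OF v u] by (simp add: form_simps mems u v power2_eq_square algebra_simps)
    finally show ?thesis .
  qed
  have "(B u v)\<^sup>2 \<le> B u u * B v v"
  proof (cases "B v v = 0")
    case True
    have "B u v = 0"
    proof (rule ccontr)
      assume nz: "B u v \<noteq> 0"
      have "0 \<le> B u u + 2 * (- (B u u + 1) / (2 * B u v)) * B u v"
        using ineq[of "- (B u u + 1) / (2 * B u v)"] True by simp
      then show False using nz by (simp add: field_simps)
    qed
    then show ?thesis using True by simp
  next
    case False
    then have pos: "B v v > 0" using form_nonneg[OF v] by simp
    have "0 \<le> B u u + 2 * (- B u v / B v v) * B u v + (- B u v / B v v)\<^sup>2 * B v v"
      by (rule ineq)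
    also have "\<dots> = B u u - (B u v)\<^sup>2 / B v v"
      using pos by (simp add: field_simps power2_eq_square)
    finally show ?thesis using pos by (simp add: field_simps)
  qed
  then have "sqrt ((B u v)\<^sup>2) \<le> sqrt (B u u * B v v)" by (rule real_sqrt_le_mono)
  then show ?thesis by (simp add: nrm_def real_sqrt_mult)
qed

lemma nrm_triangle:
  assumes "u \<in> S" "v \<in> S"
  shows "nrm (\<lambda>x. u x + v x) \<le> nrm u + nrm v"
proof (rule power2_le_imp_le)
  have "(nrm (\<lambda>x. u x + v x))\<^sup>2 = B u u + 2 * B u v + B v v"
    using assms form_sym[of u v] by (simp add: nrm_square form_simps mems)
  also have "\<dots> \<le> (nrm u)\<^sup>2 + 2 * (nrm u * nrm v) + (nrm v)\<^sup>2"
    using Cauchy_Schwarz[OF assms] by (simp add: nrm_square assms)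
  finally show "(nrm (\<lambda>x. u x + v x))\<^sup>2 \<le> (nrm u + nrm v)\<^sup>2"
    by (simp add: power2_sum)
qed (simp add: assms)

lemma nrm_minus_commute:
  assumes "u \<in> S" "v \<in> S"
  shows "nrm (\<lambda>x. u x - v x) = nrm (\<lambda>x. v x - u x)"
  using nrm_scale[OF diff_mem[OF assms], of "-1"] by simp

lemma nrm_triangle_diff:
  assumes "u \<in> S" "v \<in> S" "w \<in> S"
  shows "nrm (\<lambda>x. u x - w x) \<le> nrm (\<lambda>x. u x - v x) + nrm (\<lambda>x. v x - w x)"
  using nrm_triangle[OF diff_mem[OF assms(1,2)] diff_mem[OF assms(2,3)]] by simp

lemma nrm_diff_le:
  assumes "u \<in> S" "v \<in> S"
  shows "\<bar>nrm u - nrm v\<bar> \<le> nrm (\<lambda>x. u x - v x)"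
proof -
  have "nrm u \<le> nrm (\<lambda>x. u x - v x) + nrm v"
    using nrm_triangle[OF diff_mem[OF assms] assms(2)] by simp
  moreover have "nrm v \<le> nrm (\<lambda>x. v x - u x) + nrm u"
    using nrm_triangle[OF diff_mem[OF assms(2,1)] assms(1)] by simp
  ultimately show ?thesis using nrm_minus_commute[OF assms] by linarith
qed

lemma form_tendsto:
  assumes X: "\<And>n. X n \<in> S" and u: "u \<in> S" and v: "v \<in> S"
    and lim: "(\<lambda>n. nrm (\<lambda>x. X n x - u x)) \<longlonglongrightarrow> 0"
  shows "(\<lambda>n. B (X n) v) \<longlonglongrightarrow> B u v"
proof (rule Lim_null[THEN iffD2], rule Lim_null_comparison)
  show "\<forall>\<^sub>F n in sequentially. norm (B (X n) v - B u v) \<le> nrm (\<lambda>x. X n x - u x) * nrm v"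
    using Cauchy_Schwarz[OF diff_mem[OF X u] v] by (simp add: form_simps X u v)
  show "(\<lambda>n. nrm (\<lambda>x. X n x - u x) * nrm v) \<longlonglongrightarrow> 0"
    using tendsto_mult_right[OF lim, of "nrm v"] by simp
qed

definition complete_form :: bool where
  "complete_form \<longleftrightarrow> (\<forall>X. (\<forall>n. X n \<in> S) \<longrightarrow>
     (\<forall>e>0. \<exists>N. \<forall>m\<ge>N. \<forall>n\<ge>N. nrm (\<lambda>x. X m x - X n x) < e) \<longrightarrow>
     (\<exists>u\<in>S. (\<lambda>n. nrm (\<lambda>x. X n x - u x)) \<longlonglongrightarrow> 0))"

text \<open>The minimiser of \<open>B u u - 2 l u\<close> represents \<open>l\<close>. A minimising sequence is Cauchy by the parallelogram
  identity, and the first-order condition at its limit is the claim.\<close>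

theorem Riesz_representation:
  assumes compl: complete_form
    and l_add: "\<And>u v. u \<in> S \<Longrightarrow> v \<in> S \<Longrightarrow> l (\<lambda>x. u x + v x) = l u + l v"
    and l_scale: "\<And>c u. u \<in> S \<Longrightarrow> l (\<lambda>x. c *\<^sub>R u x) = c * l u"
    and l_bound: "\<And>u. u \<in> S \<Longrightarrow> \<bar>l u\<bar> \<le> C * nrm u"
  shows "\<exists>w\<in>S. \<forall>v\<in>S. B w v = l v"
proof -
  define J where "J u = B u u - 2 * l u" for u
  define m where "m = Inf (J ` S)"
  have bdd: "bdd_below (J ` S)"
  proof (rule bdd_belowI2)
    fix u assume u: "u \<in> S"
    have "0 \<le> (nrm u - C)\<^sup>2" by simp
    then show "- C\<^sup>2 \<le> J u"
      using l_bound[OF u] nrm_square[OF u] unfolding J_def by (simp add: power2_diff algebra_simps)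
  qed
  have m_le: "m \<le> J u" if "u \<in> S" for u
    unfolding m_def using bdd that by (intro cInf_lower) auto
  have "\<exists>u\<in>S. J u < m + inverse (real (Suc n))" for n
    using cInf_lessD[of "J ` S" "m + inverse (real (Suc n))"] zero_mem unfolding m_def by auto
  then obtain X where X: "\<And>n. X n \<in> S" "\<And>n. J (X n) < m + inverse (real (Suc n))"
    by metis
  have close: "(nrm (\<lambda>x. X p x - X q x))\<^sup>2 \<le> 2 * (inverse (real (Suc p)) + inverse (real (Suc q)))"
    for p q
  proof -
    let ?mid = "\<lambda>x. (1/2) *\<^sub>R (X p x + X q x)"
    have "J ?mid = (B (X p) (X p) + 2 * B (X p) (X q) + B (X q) (X q)) / 4 - l (X p) - l (X q)"
      using form_sym[OF X(1)[of p] X(1)[of q]] l_scale[OF add_mem[OF X(1)[of p] X(1)[of q]], of "1/2"]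
        form_scale[OF add_mem[OF X(1)[of p] X(1)[of q]], of ?mid "1/2"]
        form_scale_right[OF add_mem[OF X(1)[of p] X(1)[of q]] add_mem[OF X(1)[of p] X(1)[of q]], of "1/2"]
      unfolding J_def by (simp add: form_add form_add_right mems X l_add) argo
    moreover have "(nrm (\<lambda>x. X p x - X q x))\<^sup>2 = B (X p) (X p) - 2 * B (X p) (X q) + B (X q) (X q)"
      using form_sym[OF X(1)[of p] X(1)[of q]] by (simp add: nrm_square form_diff form_diff_right mems X)
    ultimately have "(nrm (\<lambda>x. X p x - X q x))\<^sup>2 = 2 * (J (X p) + J (X q) - 2 * J ?mid)"
      unfolding J_def by argo
    also have "\<dots> \<le> 2 * (inverse (real (Suc p)) + inverse (real (Suc q)))"
      using X(2)[of p] X(2)[of q] m_le[OF scale_mem[OF add_mem[OF X(1)[of p] X(1)[of q]], of "1/2"]]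
      by argo
    finally show ?thesis .
  qed
  have "\<exists>u\<in>S. (\<lambda>n. nrm (\<lambda>x. X n x - u x)) \<longlonglongrightarrow> 0"
  proof (rule compl[unfolded complete_form_def, rule_format])
    fix e :: real assume e: "e > 0"
    obtain N where N: "inverse (real (Suc N)) < e\<^sup>2 / 4"
      using reals_Archimedean[of "e\<^sup>2 / 4"] e by auto
    have "nrm (\<lambda>x. X p x - X q x) < e" if "p \<ge> N" "q \<ge> N" for p q
    proof (rule power2_less_imp_less)
      have "inverse (real (Suc p)) \<le> inverse (real (Suc N))" "inverse (real (Suc q)) \<le> inverse (real (Suc N))"
        using that by (auto intro!: le_imp_inverse_le)
      then show "(nrm (\<lambda>x. X p x - X q x))\<^sup>2 < e\<^sup>2" using close[of p q] N by argo
    qed (use e in auto)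
    then show "\<exists>N. \<forall>p\<ge>N. \<forall>q\<ge>N. nrm (\<lambda>x. X p x - X q x) < e" by blast
  qed (rule X)
  then obtain w where w: "w \<in> S" "(\<lambda>n. nrm (\<lambda>x. X n x - w x)) \<longlonglongrightarrow> 0" by blast
  have "B w v = l v" if v: "v \<in> S" for v
  proof -
    define d where "d = B w v - l v"
    have ineq: "0 \<le> t\<^sup>2 * B v v + 2 * t * d" for t
    proof (rule LIMSEQ_le)
      have "0 \<le> t\<^sup>2 * B v v + 2 * t * (B (X n) v - l v) + inverse (real (Suc n))" for n
      proof -
        have "m \<le> J (\<lambda>x. X n x + t *\<^sub>R v x)" by (intro m_le mems X v)
        also have "\<dots> = J (X n) + (t\<^sup>2 * B v v + 2 * t * (B (X n) v - l v))"
          using form_sym[OF X(1)[of n] v] unfolding J_def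
          by (simp add: form_simps mems X v l_add l_scale power2_eq_square algebra_simps)
        finally show ?thesis using X(2)[of n] by linarith
      qed
      then show "\<exists>N. \<forall>n\<ge>N. 0 \<le> t\<^sup>2 * B v v + 2 * t * (B (X n) v - l v) + inverse (real (Suc n))"
        by blast
      have "(\<lambda>n. t\<^sup>2 * B v v + 2 * t * (B (X n) v - l v) + inverse (real (Suc n)))
              \<longlonglongrightarrow> t\<^sup>2 * B v v + 2 * t * (B w v - l v) + 0"
        by (intro tendsto_intros form_tendsto[OF X(1) w(1) v w(2)] LIMSEQ_inverse_real_of_nat)
      then show "(\<lambda>n. t\<^sup>2 * B v v + 2 * t * (B (X n) v - l v) + inverse (real (Suc n)))
              \<longlonglongrightarrow> t\<^sup>2 * B v v + 2 * t * d"
        by (simp add: d_def)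
    qed simp
    define k where "k = B v v + 1"
    have k: "k \<ge> 1" "B v v = k - 1" using form_nonneg[OF v] by (simp_all add: k_def)
    \<comment> \<open>The parabola in \<open>t\<close> is tested near its vertex.\<close>
    have "0 \<le> (- d / k)\<^sup>2 * B v v + 2 * (- d / k) * d" by (rule ineq)
    also have "\<dots> = - (d\<^sup>2 * (k + 1) / k\<^sup>2)"
      using k(1) unfolding k(2) by (simp add: field_simps power2_eq_square)
    finally have "d\<^sup>2 * (k + 1) / k\<^sup>2 \<le> 0" by simp
    then have "d\<^sup>2 * (k + 1) \<le> 0" using k(1) by (simp add: divide_le_0_iff)
    then have "d\<^sup>2 \<le> 0" using k(1) by (simp add: mult_le_0_iff)
    then show ?thesis by (simp add: d_def)
  qed
  then show ?thesis using w(1) by blast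
qed

end

section \<open>Square-integrable functions\<close>

definition L2_inner :: "(real^'d) set \<Rightarrow> (real^'d \<Rightarrow> real) \<Rightarrow>
    (real^'d \<Rightarrow> 'b::euclidean_space) \<Rightarrow> (real^'d \<Rightarrow> 'b) \<Rightarrow> real" where
  "L2_inner D c g h = (LINT x|lebesgue_on D. c x * (g x \<bullet> h x))"

lemma L2_measurable: "g \<in> L2 D \<Longrightarrow> g \<in> borel_measurable (lebesgue_on D)"
  by (simp add: L2_def)

lemma L2_square_integrable: "g \<in> L2 D \<Longrightarrow> integrable (lebesgue_on D) (\<lambda>x. (norm (g x))\<^sup>2)"
  by (simp add: L2_def)

lemma L2I_bound:
  assumes "g \<in> borel_measurable (lebesgue_on D)" "integrable (lebesgue_on D) k"
    "\<And>x. (norm (g x))\<^sup>2 \<le> k x"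
  shows "g \<in> L2 D"
  unfolding L2_def using assms
  by (auto intro!: Bochner_Integration.integrable_bound[OF assms(2)] intro!: AE_I2 order_trans[OF _ abs_ge_self])

lemma L2_zero: "(\<lambda>x. 0) \<in> L2 D"
  by (simp add: L2_def)

lemma L2_scaleR:
  assumes "g \<in> L2 D"
  shows "(\<lambda>x. c *\<^sub>R g x) \<in> L2 D"
  using assms by (auto simp: L2_def power_mult_distrib)

lemma norm_add_square_le: "(norm (a + b))\<^sup>2 \<le> 2 * (norm a)\<^sup>2 + 2 * (norm b)\<^sup>2"
  for a b :: "'a::real_normed_vector"
proof -
  have "(norm (a + b))\<^sup>2 \<le> (norm a + norm b)\<^sup>2"
    by (intro power_mono norm_triangle_ineq) simp
  also have "\<dots> \<le> 2 * (norm a)\<^sup>2 + 2 * (norm b)\<^sup>2"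
    using zero_le_power2[of "norm a - norm b"] by (simp add: power2_sum power2_diff)
  finally show ?thesis .
qed

lemma L2_add:
  assumes "g \<in> L2 D" "h \<in> L2 D"
  shows "(\<lambda>x. g x + h x) \<in> L2 D"
proof (rule L2I_bound[where k = "\<lambda>x. 2 * (norm (g x))\<^sup>2 + 2 * (norm (h x))\<^sup>2"])
  show "(\<lambda>x. g x + h x) \<in> borel_measurable (lebesgue_on D)"
    using assms[THEN L2_measurable] by measurable
qed (use assms[THEN L2_square_integrable] norm_add_square_le in auto)

lemma L2_integrable_form:
  fixes g h :: "real^'d \<Rightarrow> 'b::euclidean_space"
  assumes g: "g \<in> L2 D" and h: "h \<in> L2 D"
    and c: "c \<in> borel_measurable (lebesgue_on D)" "AE x in lebesgue_on D. \<bar>c x\<bar> \<le> K"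
  shows "integrable (lebesgue_on D) (\<lambda>x. c x * (g x \<bullet> h x))"
proof (rule Bochner_Integration.integrable_bound)
  show "integrable (lebesgue_on D) (\<lambda>x. K * ((norm (g x))\<^sup>2 + (norm (h x))\<^sup>2))"
    using assms(1,2)[THEN L2_square_integrable] by simp
  show "(\<lambda>x. c x * (g x \<bullet> h x)) \<in> borel_measurable (lebesgue_on D)"
    using assms(1,2)[THEN L2_measurable] c by measurable
  show "AE x in lebesgue_on D. norm (c x * (g x \<bullet> h x)) \<le> norm (K * ((norm (g x))\<^sup>2 + (norm (h x))\<^sup>2))"
    using c(2)
  proof eventually_elim
    case (elim x)
    have "\<bar>g x \<bullet> h x\<bar> \<le> norm (g x) * norm (h x)" by (rule Cauchy_Schwarz_ineq2)
    also have "\<dots> \<le> (norm (g x))\<^sup>2 + (norm (h x))\<^sup>2"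
      using zero_le_power2[of "norm (g x) - norm (h x)"] mult_nonneg_nonneg[OF norm_ge_zero[of "g x"] norm_ge_zero[of "h x"]]
      unfolding power2_diff by linarith
    finally have "\<bar>c x\<bar> * \<bar>g x \<bullet> h x\<bar> \<le> \<bar>K\<bar> * ((norm (g x))\<^sup>2 + (norm (h x))\<^sup>2)"
      using elim by (intro mult_mono) auto
    then show ?case by (simp add: abs_mult)
  qed
qed

lemma L2_integrable_inner:
  assumes "g \<in> L2 D" "h \<in> L2 D"
  shows "integrable (lebesgue_on D) (\<lambda>x. g x \<bullet> h x)"
  using L2_integrable_form[OF assms, of "\<lambda>_. 1" 1] by simp

lemma L2_inner_add_left:
  assumes "u \<in> L2 D" "v \<in> L2 D" "w \<in> L2 D"
    and "c \<in> borel_measurable (lebesgue_on D)" "AE x in lebesgue_on D. \<bar>c x\<bar> \<le> K"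
  shows "L2_inner D c (\<lambda>x. u x + v x) w = L2_inner D c u w + L2_inner D c v w"
  unfolding L2_inner_def using assms
  by (simp add: inner_add_left distrib_left L2_integrable_form[OF _ _ assms(4,5)]
      flip: Bochner_Integration.integral_add)

lemma L2_inner_scaleR_left: "L2_inner D c (\<lambda>x. r *\<^sub>R u x) w = r * L2_inner D c u w"
  unfolding L2_inner_def by (simp add: mult.left_commute flip: integral_mult_right_zero)

lemma L2_inner_commute: "L2_inner D c u w = L2_inner D c w u"
  by (simp add: L2_inner_def inner_commute)

lemma L2_inner_cong_AE:
  assumes "g \<in> borel_measurable (lebesgue_on D)" "g' \<in> borel_measurable (lebesgue_on D)"
    "h \<in> borel_measurable (lebesgue_on D)" "h' \<in> borel_measurable (lebesgue_on D)"
    "c \<in> borel_measurable (lebesgue_on D)" 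
    "AE x in lebesgue_on D. g x = g' x" "AE x in lebesgue_on D. h x = h' x"
  shows "L2_inner D c g h = L2_inner D c g' h'"
  unfolding L2_inner_def
proof (rule integral_cong_AE)
  show "AE x in lebesgue_on D. c x * (g x \<bullet> h x) = c x * (g' x \<bullet> h' x)"
    using assms(6,7) by eventually_elim simp
qed (use assms in measurable)

text \<open>The weights of interest are \<open>1\<close>, \<open>a\<^sub>0\<close> and \<open>a(y)\<close>; the resulting forms share one carrier, which allows
  comparing their seminorms.\<close>

lemma semi_inner_L2_weighted:
  assumes c: "c \<in> borel_measurable (lebesgue_on D)" "AE x in lebesgue_on D. 0 \<le> c x \<and> c x \<le> K"
  shows "semi_inner (L2 D) (L2_inner D c :: (real^'d \<Rightarrow> 'b::euclidean_space) \<Rightarrow> _)"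
proof -
  have c': "AE x in lebesgue_on D. \<bar>c x\<bar> \<le> K" using c(2) by eventually_elim auto
  show ?thesis
  proof
    fix u :: "real^'d \<Rightarrow> 'b"
    show "0 \<le> L2_inner D c u u"
      unfolding L2_inner_def using c(2) by (intro integral_nonneg_AE) (auto elim!: eventually_mono)
  qed (fact L2_zero L2_add L2_scaleR L2_inner_add_left[OF _ _ _ c(1) c'] |
      rule L2_inner_scaleR_left L2_inner_commute)+
qed

interpretation L2: semi_inner "L2 D" "L2_inner D (\<lambda>_. 1)" for D :: "(real^'d) set"
  by (rule semi_inner_L2_weighted[where K = 1]) auto

lemma L2_nrm_eq: "L2.nrm D g = L2_norm D g"
  by (simp add: L2.nrm_def L2_norm_def L2_inner_def power2_norm_eq_inner)

lemmas L2_diff = L2.diff_mem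
lemmas L2_norm_triangle = L2.nrm_triangle[unfolded L2_nrm_eq]
lemmas L2_norm_triangle_diff = L2.nrm_triangle_diff[unfolded L2_nrm_eq]
lemmas L2_norm_scaleR = L2.nrm_scale[unfolded L2_nrm_eq]

lemma L2_norm_nonneg [simp]: "0 \<le> L2_norm D g"
  by (simp add: L2_norm_def)

lemma L2_norm_sq_int: "(L2_norm D g)\<^sup>2 = (LINT x|lebesgue_on D. (norm (g x))\<^sup>2)"
  by (simp add: L2_norm_def)

lemma L2_norm_cong_AE:
  assumes "g \<in> borel_measurable (lebesgue_on D)" "h \<in> borel_measurable (lebesgue_on D)"
    "AE x in lebesgue_on D. g x = h x"
  shows "L2_norm D g = L2_norm D h"
  unfolding L2_norm_def using assms
  by (auto intro!: arg_cong[where f = sqrt] integral_cong_AE elim: eventually_mono)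

lemma L2_norm_form_bound:
  fixes g h :: "real^'d \<Rightarrow> 'b::euclidean_space"
  assumes g: "g \<in> L2 D" and h: "h \<in> L2 D"
    and c: "c \<in> borel_measurable (lebesgue_on D)" "AE x in lebesgue_on D. \<bar>c x\<bar> \<le> K"
    and K: "0 \<le> K"
  shows "\<bar>L2_inner D c g h\<bar> \<le> K * (L2_norm D g * L2_norm D h)"
proof -
  let ?ng = "\<lambda>x. norm (g x)" and ?nh = "\<lambda>x. norm (h x)"
  have n: "?ng \<in> L2 D" "?nh \<in> L2 D" using g h by (auto simp: L2_def)
  have "\<bar>L2_inner D c g h\<bar> \<le> (LINT x|lebesgue_on D. \<bar>c x * (g x \<bullet> h x)\<bar>)"
    unfolding L2_inner_def using integral_norm_bound[of "lebesgue_on D" "\<lambda>x. c x * (g x \<bullet> h x)"] by simp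
  also have "\<dots> \<le> (LINT x|lebesgue_on D. K * (?ng x \<bullet> ?nh x))"
  proof (rule integral_mono_AE)
    show "integrable (lebesgue_on D) (\<lambda>x. \<bar>c x * (g x \<bullet> h x)\<bar>)"
      using L2_integrable_form[OF g h c] by (rule integrable_abs)
    show "integrable (lebesgue_on D) (\<lambda>x. K * (?ng x \<bullet> ?nh x))"
      using L2_integrable_inner[OF n] by simp
    show "AE x in lebesgue_on D. \<bar>c x * (g x \<bullet> h x)\<bar> \<le> K * (?ng x \<bullet> ?nh x)"
      using c(2)
    proof eventually_elim
      case (elim x)
      then have "\<bar>c x\<bar> * \<bar>g x \<bullet> h x\<bar> \<le> K * (norm (g x) * norm (h x))"
        by (intro mult_mono Cauchy_Schwarz_ineq2) auto
      then show ?case by (simp add: abs_mult)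
    qed
  qed
  also have "\<dots> = K * L2_inner D (\<lambda>_. 1) ?ng ?nh" by (simp add: L2_inner_def)
  also have "\<dots> \<le> K * (L2_norm D ?ng * L2_norm D ?nh)"
    using L2.Cauchy_Schwarz[OF n] K unfolding L2_nrm_eq by (intro mult_left_mono) auto
  finally show ?thesis by (simp add: L2_norm_def)
qed

text \<open>Fatou's lemma. It is applied to differences \<open>g m - g (r n)\<close> with \<open>n \<rightarrow> \<infinity>\<close> in the proof of completeness.\<close>

lemma L2_Fatou:
  fixes g :: "nat \<Rightarrow> real^'d \<Rightarrow> 'b::euclidean_space"
  assumes g: "\<And>n. g n \<in> L2 D" and h: "h \<in> borel_measurable (lebesgue_on D)"
    and lim: "AE x in lebesgue_on D. (\<lambda>n. g n x) \<longlonglongrightarrow> h x"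
    and bound: "\<And>n. L2_norm D (g n) \<le> e"
  shows "h \<in> L2 D" "L2_norm D h \<le> e"
proof -
  note [measurable] = L2_measurable[OF g] h
  have e: "0 \<le> e" using bound[of 0] L2_norm_nonneg[of D "g 0"] by linarith
  have nn: "(\<integral>\<^sup>+x. ennreal ((norm (g n x))\<^sup>2) \<partial>lebesgue_on D) \<le> ennreal (e\<^sup>2)" for n
  proof -
    have "(\<integral>\<^sup>+x. ennreal ((norm (g n x))\<^sup>2) \<partial>lebesgue_on D) = ennreal ((L2_norm D (g n))\<^sup>2)"
      unfolding L2_norm_sq_int by (rule nn_integral_eq_integral[OF L2_square_integrable[OF g]]) simp
    also have "\<dots> \<le> ennreal (e\<^sup>2)" by (intro ennreal_leI power_mono bound) simp
    finally show ?thesis .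
  qed
  have "(\<integral>\<^sup>+x. ennreal ((norm (h x))\<^sup>2) \<partial>lebesgue_on D)
      = (\<integral>\<^sup>+x. liminf (\<lambda>n. ennreal ((norm (g n x))\<^sup>2)) \<partial>lebesgue_on D)"
    using lim
  proof (intro nn_integral_cong_AE, eventually_elim)
    case (elim x)
    then have "(\<lambda>n. ennreal ((norm (g n x))\<^sup>2)) \<longlonglongrightarrow> ennreal ((norm (h x))\<^sup>2)"
      by (intro tendsto_intros tendsto_ennrealI)
    then show ?case by (rule lim_imp_Liminf[OF trivial_limit_sequentially, symmetric])
  qed
  also have "\<dots> \<le> liminf (\<lambda>n. \<integral>\<^sup>+x. ennreal ((norm (g n x))\<^sup>2) \<partial>lebesgue_on D)"
    by (intro nn_integral_liminf) measurable
  also have "\<dots> \<le> ennreal (e\<^sup>2)"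
    using nn by (intro Liminf_le) auto
  finally have le: "(\<integral>\<^sup>+x. ennreal ((norm (h x))\<^sup>2) \<partial>lebesgue_on D) \<le> ennreal (e\<^sup>2)" .
  have int: "integrable (lebesgue_on D) (\<lambda>x. (norm (h x))\<^sup>2)"
    using le by (intro integrableI_bounded) (auto simp: top_unique less_top intro: order.strict_trans1)
  then show "h \<in> L2 D" by (simp add: L2_def h)
  have "ennreal ((L2_norm D h)\<^sup>2) \<le> ennreal (e\<^sup>2)"
    unfolding L2_norm_sq_int using le nn_integral_eq_integral[OF int] by simp
  then have "(L2_norm D h)\<^sup>2 \<le> e\<^sup>2" by (simp add: ennreal_le_iff)
  then show "L2_norm D h \<le> e" using e by (rule power2_le_imp_le)
qed

text \<open>A subsequence whose increments have norm at most \<open>2\<^bsup>-k\<^esup>\<close> converges almost everywhere, because on a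
  finite measure space the increments are summable in \<open>L\<^sup>1\<close>. Fatou's lemma turns pointwise convergence
  into convergence in norm of the whole sequence.\<close>

theorem L2_complete:
  fixes g :: "nat \<Rightarrow> real^'d \<Rightarrow> 'b::euclidean_space"
  assumes fin: "finite_measure (lebesgue_on D)"
    and g: "\<And>n. g n \<in> L2 D"
    and Cauchy: "\<And>e. e > 0 \<Longrightarrow> \<exists>N. \<forall>m\<ge>N. \<forall>n\<ge>N. L2_norm D (\<lambda>x. g m x - g n x) < e"
  shows "\<exists>h\<in>L2 D. (\<lambda>n. L2_norm D (\<lambda>x. g n x - h x)) \<longlonglongrightarrow> 0"
proof -
  interpret finite_measure "lebesgue_on D" by (rule fin)
  have "\<forall>k. \<exists>N. \<forall>m\<ge>N. \<forall>n\<ge>N. L2_norm D (\<lambda>x. g m x - g n x) < (1/2)^k"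
    using Cauchy by simp
  then obtain N where N: "\<And>k m n. m \<ge> N k \<Longrightarrow> n \<ge> N k \<Longrightarrow> L2_norm D (\<lambda>x. g m x - g n x) < (1/2)^k"
    by metis
  \<comment> \<open>The sum dominates every \<open>N i\<close> with \<open>i \<le> k\<close>: the index serves all earlier tolerances, too.\<close>
  define r where "r k = (\<Sum>i\<le>k. N i)" for k
  have rN: "r m \<ge> N k" if "m \<ge> k" for m k
    unfolding r_def using that by (intro member_le_sum) auto
  define d where "d k x = g (r (Suc k)) x - g (r k) x" for k x
  have d: "d k \<in> L2 D" for k unfolding d_def by (intro L2_diff g)
  have one: "(\<lambda>_. 1::real) \<in> L2 D" by (simp add: L2_def)
  note [measurable] = L2_measurable[OF d] L2_measurable[OF g]
  let ?c = "L2_norm D (\<lambda>_::real^'d. 1::real)"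
  have nd: "(\<lambda>x. norm (d k x)) \<in> L2 D" for k using d[of k] by (simp add: L2_def)
  have d_int: "integrable (lebesgue_on D) (\<lambda>x. norm (d k x))" for k
    using L2_integrable_inner[OF nd one] by simp
  have d_le: "(LINT x|lebesgue_on D. norm (d k x)) \<le> ?c * (1/2)^k" for k
  proof -
    have "(LINT x|lebesgue_on D. norm (d k x)) = L2_inner D (\<lambda>_. 1) (\<lambda>x. norm (d k x)) (\<lambda>_. 1)"
      by (simp add: L2_inner_def)
    also have "\<dots> \<le> L2_norm D (\<lambda>x. norm (d k x)) * ?c"
      using L2.Cauchy_Schwarz[OF nd one] unfolding L2_nrm_eq by (rule order_trans[OF abs_ge_self])
    also have "L2_norm D (\<lambda>x. norm (d k x)) = L2_norm D (d k)" by (simp add: L2_norm_def)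
    also have "L2_norm D (d k) * ?c \<le> (1/2)^k * ?c"
      unfolding d_def by (intro mult_right_mono less_imp_le[OF N] rN) auto
    finally show ?thesis by (simp add: mult.commute)
  qed
  have "AE x in lebesgue_on D. (\<Sum>k. ennreal (norm (d k x))) \<noteq> \<infinity>"
  proof (rule nn_integral_PInf_AE)
    have "(\<integral>\<^sup>+x. (\<Sum>k. ennreal (norm (d k x))) \<partial>lebesgue_on D)
        = (\<Sum>k. ennreal (LINT x|lebesgue_on D. norm (d k x)))"
      by (subst nn_integral_suminf) (auto simp: nn_integral_eq_integral[OF d_int])
    also have "\<dots> \<le> (\<Sum>k. ennreal (?c * (1/2)^k))"
      by (intro suminf_le ennreal_leI d_le) auto
    also have "\<dots> = ennreal (\<Sum>k. ?c * (1/2)^k)"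
      by (intro suminf_ennreal2) (auto intro!: summable_mult summable_geometric)
    finally show "(\<integral>\<^sup>+x. (\<Sum>k. ennreal (norm (d k x))) \<partial>lebesgue_on D) \<noteq> \<infinity>"
      by (auto simp: top_unique)
  qed measurable
  then have conv: "AE x in lebesgue_on D. convergent (\<lambda>k. g (r k) x)"
  proof eventually_elim
    case (elim x)
    have "summable (\<lambda>k. norm (d k x))"
      using elim by (intro summable_suminf_not_top) (auto simp: infinity_ennreal_def)
    then have "summable (\<lambda>k. d k x)" by (rule summable_norm_cancel)
    then have "convergent (\<lambda>n. \<Sum>k<n. d k x)" by (simp add: summable_iff_convergent)
    then have "convergent (\<lambda>n. (g (r n) x - g (r 0) x) + g (r 0) x)"
      unfolding d_def using sum_lessThan_telescope[of "\<lambda>k. g (r k) x"]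
      by (intro convergent_add convergent_const) simp
    then show ?case by simp
  qed
  define h where "h x = lim (\<lambda>k. g (r k) x)" for x
  have [measurable]: "h \<in> borel_measurable (lebesgue_on D)"
    unfolding h_def by measurable
  have lim: "AE x in lebesgue_on D. (\<lambda>k. g (r k) x) \<longlonglongrightarrow> h x"
    using conv by eventually_elim (simp add: h_def convergent_LIMSEQ_iff)
  have close: "(\<lambda>x. g m x - h x) \<in> L2 D \<and> L2_norm D (\<lambda>x. g m x - h x) \<le> (1/2)^k" if m: "m \<ge> N k" for m k
  proof -
    have lm: "AE x in lebesgue_on D. (\<lambda>n. g m x - g (r (n + k)) x) \<longlonglongrightarrow> g m x - h x"
      using lim by eventually_elim (intro tendsto_intros LIMSEQ_ignore_initial_segment)
    have "L2_norm D (\<lambda>x. g m x - g (r (n + k)) x) \<le> (1/2)^k" for n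
      by (intro less_imp_le[OF N] m rN) simp
    from L2_Fatou[OF L2_diff[OF g g] _ lm this] show ?thesis by simp
  qed
  have h: "h \<in> L2 D"
    using L2_diff[OF g[of "N 0"] conjunct1[OF close[of 0 "N 0"]]] by simp
  have "(\<lambda>n. L2_norm D (\<lambda>x. g n x - h x)) \<longlonglongrightarrow> 0"
  proof (rule LIMSEQ_I)
    fix e :: real assume "e > 0"
    then obtain k where k: "(1/2)^k < e" using real_arch_pow_inv[of e "1/2"] by auto
    show "\<exists>no. \<forall>n\<ge>no. norm (L2_norm D (\<lambda>x. g n x - h x) - 0) < e"
      using close k by (intro exI[of _ "N k"]) force
  qed
  then show ?thesis using h by blast
qed

section \<open>Smooth test functions\<close>

lemma pd_eqI: "(\<phi> has_derivative f') (at x) \<Longrightarrow> pd i \<phi> x = f' (axis i 1)"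
  unfolding pd_def by (metis frechet_derivative_at)

lemma Ck_differentiable: "Ck (Suc k) \<phi> \<Longrightarrow> \<phi> differentiable (at x)"
  by simp

lemma Ck_SucD: "Ck (Suc k) \<phi> \<Longrightarrow> Ck k \<phi>"
proof (induction k arbitrary: \<phi>)
  case 0
  then show ?case
    by (auto simp: continuous_on_eq_continuous_within intro: differentiable_imp_continuous_within)
next
  case (Suc k)
  from Suc.prems have "\<forall>x. \<phi> differentiable (at x)" "\<And>i. Ck (Suc k) (pd i \<phi>)" by auto
  then show ?case using Suc.IH by auto
qed

lemma pd_const [simp]: "pd i (\<lambda>x. c) = (\<lambda>x. 0)"
proof
  fix x :: "real^'a"
  show "pd i (\<lambda>x. c) x = 0" using pd_eqI[OF has_derivative_const[of c]] by auto
qed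

lemma Ck_const: "Ck k (\<lambda>x. c)"
  by (induction k arbitrary: c) auto

lemma pd_add:
  assumes "\<phi> differentiable (at x)" "\<psi> differentiable (at x)"
  shows "pd i (\<lambda>x. \<phi> x + \<psi> x) x = pd i \<phi> x + pd i \<psi> x"
  using pd_eqI[OF has_derivative_add[OF assms[unfolded frechet_derivative_works]]]
  by (simp add: pd_def)

lemma pd_mult:
  assumes "\<phi> differentiable (at x)" "\<psi> differentiable (at x)"
  shows "pd i (\<lambda>x. \<phi> x * \<psi> x) x = \<phi> x * pd i \<psi> x + pd i \<phi> x * \<psi> x"
  using pd_eqI[OF has_derivative_mult[OF assms[unfolded frechet_derivative_works]]]
  by (simp add: pd_def)

lemma pd_component: "pd i (\<lambda>x. x $ j) x = (if i = j then 1 else 0)"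
proof -
  have "((\<lambda>x. x $ j) has_derivative (\<lambda>v. v $ j)) (at x)"
    by (rule bounded_linear_imp_has_derivative[OF bounded_linear_vec_nth])
  from pd_eqI[OF this, of i] show ?thesis by (simp add: axis_def)
qed

lemma Ck_add: "Ck k \<phi> \<Longrightarrow> Ck k \<psi> \<Longrightarrow> Ck k (\<lambda>x. \<phi> x + \<psi> x)"
proof (induction k arbitrary: \<phi> \<psi>)
  case 0
  then show ?case by (simp add: continuous_on_add)
next
  case (Suc k)
  then have d: "\<And>x. \<phi> differentiable (at x)" "\<And>x. \<psi> differentiable (at x)" by auto
  have "pd i (\<lambda>x. \<phi> x + \<psi> x) = (\<lambda>x. pd i \<phi> x + pd i \<psi> x)" for i
    by (rule ext) (rule pd_add[OF d])
  then show ?case using Suc d by (auto intro: differentiable_add)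
qed

lemma Ck_mult: "Ck k \<phi> \<Longrightarrow> Ck k \<psi> \<Longrightarrow> Ck k (\<lambda>x. \<phi> x * \<psi> x)"
proof (induction k arbitrary: \<phi> \<psi>)
  case 0
  then show ?case by (simp add: continuous_on_mult)
next
  case (Suc k)
  then have d: "\<And>x. \<phi> differentiable (at x)" "\<And>x. \<psi> differentiable (at x)" by auto
  have eq: "pd i (\<lambda>x. \<phi> x * \<psi> x) = (\<lambda>x. \<phi> x * pd i \<psi> x + pd i \<phi> x * \<psi> x)" for i
    by (rule ext) (rule pd_mult[OF d])
  have "Ck k (\<lambda>x. \<phi> x * pd i \<psi> x + pd i \<phi> x * \<psi> x)" for i
    using Suc.prems Suc.IH Ck_SucD[OF Suc.prems(1)] Ck_SucD[OF Suc.prems(2)]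
    by (intro Ck_add) auto
  then show ?case using d by (auto simp: eq intro: differentiable_mult)
qed

lemma Ck_cmult: "Ck k \<phi> \<Longrightarrow> Ck k (\<lambda>x. c * \<phi> x)"
  by (intro Ck_mult Ck_const)

lemma Ck_diff: "Ck k \<phi> \<Longrightarrow> Ck k \<psi> \<Longrightarrow> Ck k (\<lambda>x. \<phi> x - \<psi> x)"
  using Ck_add[of k \<phi> "\<lambda>x. - 1 * \<psi> x"] Ck_cmult[of k \<psi> "-1"] by simp

lemma Ck_prod: "finite I \<Longrightarrow> (\<And>i. i \<in> I \<Longrightarrow> Ck k (\<phi> i)) \<Longrightarrow> Ck k (\<lambda>x. \<Prod>i\<in>I. \<phi> i x)"
  by (induction I rule: finite_induct) (auto intro: Ck_const Ck_mult)

lemma Ck_component: "Ck k (\<lambda>x. x $ j)"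
proof (cases k)
  case 0
  then show ?thesis by (auto intro!: continuous_intros)
next
  case (Suc m)
  have "pd i (\<lambda>x. x $ j) = (\<lambda>x. if i = j then 1 else 0)" for i
    by (rule ext) (rule pd_component)
  moreover have "(\<lambda>x. x $ j) differentiable (at x)" for x :: "real^'a"
    by (rule differentiableI[OF bounded_linear_imp_has_derivative[OF bounded_linear_vec_nth]])
  ultimately show ?thesis using Suc by (auto intro: Ck_const)
qed

text \<open>The family is closed under differentiation up to linear combinations, so that smoothness is an
  induction over all \<open>m\<close> simultaneously. For \<open>m = 0\<close> it increases to the indicator of the positive
  half-line as \<open>c\<close> decreases to \<open>0\<close>.\<close>

definition flat_exp :: "nat \<Rightarrow> real \<Rightarrow> real \<Rightarrow> real" where
  "flat_exp m c t = (if t > 0 then (1/t)^m * exp (- (c/t)) else 0)"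

text \<open>Substituting \<open>s = c/t\<close> turns this into \<open>s\<^bsup>m\<^esup> / exp s \<rightarrow> 0\<close>.\<close>

lemma flat_exp_tendsto_0:
  assumes "c > 0"
  shows "((\<lambda>t. flat_exp m c t) \<longlongrightarrow> 0) (at_right 0)"
proof -
  have "((\<lambda>s. (1/c)^m * (s ^ m / exp s)) \<longlongrightarrow> (1/c)^m * 0) at_top"
    by (intro tendsto_intros tendsto_power_div_exp_0)
  moreover have "filterlim (\<lambda>t::real. c * inverse t) at_top (at_right 0)"
    by (rule filterlim_tendsto_pos_mult_at_top[OF tendsto_const assms filterlim_inverse_at_top_right])
  ultimately have "((\<lambda>t. (1/c)^m * ((c * inverse t) ^ m / exp (c * inverse t))) \<longlongrightarrow> 0) (at_right 0)"
    using filterlim_compose[of _ _ at_top "\<lambda>t::real. c * inverse t" "at_right 0"] by force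
  then show ?thesis
    by (rule Lim_transform_eventually)
      (use assms in \<open>auto simp: eventually_at_filter flat_exp_def field_simps exp_minus\<close>)
qed

lemma flat_exp_deriv:
  assumes c: "c > 0"
  shows "(flat_exp m c has_real_derivative - real m * flat_exp (Suc m) c t + c * flat_exp (m + 2) c t) (at t)"
proof (cases "t = 0")
  case False
  show ?thesis
  proof (cases "t > 0")
    case True
    have inv: "((\<lambda>t. 1/t) has_real_derivative - ((1/t)^2)) (at t)"
      using True by (auto intro!: derivative_eq_intros simp: power2_eq_square)
    have eq: "real m * (- ((1/t)^2) * (1/t)^(m - Suc 0)) = - real m * (1/t)^(Suc m)"
      by (cases m) (simp_all add: power2_eq_square algebra_simps add_divide_distrib diff_divide_distrib)
    have pow: "((\<lambda>t. (1/t)^m) has_real_derivative - real m * (1/t)^(Suc m)) (at t)"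
      using DERIV_power[OF inv, of m] unfolding eq .
    have "((\<lambda>t. - (c * (1/t))) has_real_derivative - (c * - ((1/t)^2))) (at t)"
      by (intro DERIV_minus DERIV_cmult inv)
    from DERIV_mult[OF pow DERIV_fun_exp[OF this]]
    have "((\<lambda>t. (1/t)^m * exp (- (c/t))) has_real_derivative
        - real m * flat_exp (Suc m) c t + c * flat_exp (m + 2) c t) (at t)"
      using True by (simp add: flat_exp_def power2_eq_square algebra_simps)
    moreover have "\<forall>\<^sub>F s in nhds t. (1/s)^m * exp (- (c/s)) = flat_exp m c s"
      using eventually_nhds_in_open[of "{0<..}" t] True
      by (auto elim!: eventually_mono simp: flat_exp_def)
    ultimately show ?thesis by (subst DERIV_cong_ev[OF refl _ refl, symmetric]) auto
  next
    case neg: False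
    have "((\<lambda>t. 0) has_real_derivative - real m * flat_exp (Suc m) c t + c * flat_exp (m + 2) c t) (at t)"
      using neg by (simp add: flat_exp_def)
    moreover have "\<forall>\<^sub>F s in nhds t. 0 = flat_exp m c s"
      using eventually_nhds_in_open[of "{..<0}" t] neg False
      by (auto elim!: eventually_mono simp: flat_exp_def)
    ultimately show ?thesis by (subst DERIV_cong_ev[OF refl _ refl, symmetric]) auto
  qed
next
  case True
  have "((\<lambda>s. (flat_exp m c s - flat_exp m c 0) / (s - 0)) \<longlongrightarrow> 0) (at 0)"
    unfolding filterlim_at_split
  proof
    show "((\<lambda>s. (flat_exp m c s - flat_exp m c 0) / (s - 0)) \<longlongrightarrow> 0) (at_left 0)"
      by (rule tendsto_eventually) (auto simp: eventually_at_filter flat_exp_def)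
    show "((\<lambda>s. (flat_exp m c s - flat_exp m c 0) / (s - 0)) \<longlongrightarrow> 0) (at_right 0)"
      by (rule Lim_transform_eventually[OF flat_exp_tendsto_0[OF c, of "Suc m"]])
        (auto simp: eventually_at_filter flat_exp_def)
  qed
  then show ?thesis using True by (simp add: has_field_derivative_iff flat_exp_def)
qed

lemma Ck_flat_exp:
  assumes c: "c > 0"
  shows "Ck k (\<lambda>x. flat_exp m c (s * x $ j + a))"
proof (induction k arbitrary: m)
  have der: "((\<lambda>x. flat_exp m c (s * x $ j + a)) has_derivative
      (\<lambda>v. (- real m * flat_exp (Suc m) c (s * x $ j + a) + c * flat_exp (m + 2) c (s * x $ j + a)) * (s * v $ j)))
      (at x)" for m and x :: "real^'a"
  proof -
    have "((\<lambda>x. s * x $ j + a) has_derivative (\<lambda>v. s * v $ j)) (at x)"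
      by (auto intro!: derivative_eq_intros bounded_linear_imp_has_derivative[OF bounded_linear_vec_nth])
    from has_derivative_compose[OF this flat_exp_deriv[OF c, of m, unfolded has_field_derivative_def]]
    show ?thesis by simp
  qed
  {
    case 0
    have "continuous (at x) (\<lambda>x. flat_exp m c (s * x $ j + a))" for x :: "real^'a"
      by (rule has_derivative_continuous[OF der])
    then show ?case by (simp add: continuous_on_eq_continuous_within)
  next
    case (Suc k)
    have "pd i (\<lambda>x. flat_exp m c (s * x $ j + a)) = (\<lambda>x. (if i = j then s else 0) *
        (- real m * flat_exp (Suc m) c (s * x $ j + a) + c * flat_exp (m + 2) c (s * x $ j + a)))" for i
      by (rule ext) (use pd_eqI[OF der[of m], of i] in \<open>auto simp: axis_def\<close>)
    moreover have "Ck k (\<lambda>x. (if i = j then s else 0) *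
        (- real m * flat_exp (Suc m) c (s * x $ j + a) + c * flat_exp (m + 2) c (s * x $ j + a)))" for i
      by (intro Ck_cmult Ck_add Suc)
    ultimately show ?case using der[of m] by (auto intro: differentiableI)
  }
qed

lemma test_functionsD:
  assumes "\<phi> \<in> test_functions D"
  shows "Ck k \<phi>" "compact (closure {x. \<phi> x \<noteq> 0})" "closure {x. \<phi> x \<noteq> 0} \<subseteq> D" "\<phi> differentiable (at x)"
    "continuous_on UNIV \<phi>"
proof -
  show Ck: "Ck k \<phi>" for k using assms by (simp add: test_functions_def)
  show "\<phi> differentiable (at x)" "continuous_on UNIV \<phi>"
    using Ck[of 1] Ck[of 0] by auto
qed (use assms in \<open>auto simp: test_functions_def\<close>)

text \<open>Any compact set off which the function vanishes may stand in for the closed support.\<close>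

lemma test_functionsI:
  assumes "\<And>k. Ck k \<phi>" "compact K" "K \<subseteq> D" "\<And>x. x \<notin> K \<Longrightarrow> \<phi> x = 0"
  shows "\<phi> \<in> test_functions D"
proof -
  have "closure {x. \<phi> x \<noteq> 0} \<subseteq> K"
    using assms(2,4) by (intro closure_minimal) (auto intro: compact_imp_closed)
  moreover from this have "compact (closure {x. \<phi> x \<noteq> 0})"
    using compact_Int_closed[OF assms(2) closed_closure, of "{x. \<phi> x \<noteq> 0}"] by (simp add: Int_absorb1)
  ultimately show ?thesis using assms(1,3) by (auto simp: test_functions_def)
qed

lemma test_functions_zero_outside:
  "\<phi> \<in> test_functions D \<Longrightarrow> x \<notin> closure {x. \<phi> x \<noteq> 0} \<Longrightarrow> \<phi> x = 0"
  using closure_subset[of "{x. \<phi> x \<noteq> 0}"] by blast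

lemma test_functions_mult:
  assumes "\<phi> \<in> test_functions D" "\<And>k. Ck k \<psi>"
  shows "(\<lambda>x. \<psi> x * \<phi> x) \<in> test_functions D"
proof (rule test_functionsI[where K = "closure {x. \<phi> x \<noteq> 0}"])
  show "Ck k (\<lambda>x. \<psi> x * \<phi> x)" for k
    by (intro Ck_mult assms(2) test_functionsD(1)[OF assms(1)])
  show "\<psi> x * \<phi> x = 0" if "x \<notin> closure {x. \<phi> x \<noteq> 0}" for x
    unfolding test_functions_zero_outside[OF assms(1) that] by (rule mult_zero_right)
qed (fact test_functionsD(2)[OF assms(1)] test_functionsD(3)[OF assms(1)])+

lemma test_functions_add:
  assumes "\<phi> \<in> test_functions D" "\<psi> \<in> test_functions D"
  shows "(\<lambda>x. \<phi> x + \<psi> x) \<in> test_functions D"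
proof (rule test_functionsI[where K = "closure {x. \<phi> x \<noteq> 0} \<union> closure {x. \<psi> x \<noteq> 0}"])
  show "Ck k (\<lambda>x. \<phi> x + \<psi> x)" for k
    by (intro Ck_add test_functionsD(1)[OF assms(1)] test_functionsD(1)[OF assms(2)])
  show "compact (closure {x. \<phi> x \<noteq> 0} \<union> closure {x. \<psi> x \<noteq> 0})"
    by (intro compact_Un test_functionsD(2)[OF assms(1)] test_functionsD(2)[OF assms(2)])
  show "closure {x. \<phi> x \<noteq> 0} \<union> closure {x. \<psi> x \<noteq> 0} \<subseteq> D"
    by (intro Un_least test_functionsD(3)[OF assms(1)] test_functionsD(3)[OF assms(2)])
  fix x assume "x \<notin> closure {x. \<phi> x \<noteq> 0} \<union> closure {x. \<psi> x \<noteq> 0}"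
  then have "\<phi> x = 0" "\<psi> x = 0"
    using test_functions_zero_outside[OF assms(1), of x] test_functions_zero_outside[OF assms(2), of x]
    by blast+
  then show "\<phi> x + \<psi> x = 0" by simp
qed

lemma test_functions_zero: "(\<lambda>x. 0) \<in> test_functions D"
  by (rule test_functionsI[where K = "{}"]) (auto intro: Ck_const)

lemma test_functions_cmult:
  "\<phi> \<in> test_functions D \<Longrightarrow> (\<lambda>x. c * \<phi> x) \<in> test_functions D"
  by (rule test_functions_mult) (auto intro: Ck_const)

lemma pd_zero_outside:
  assumes "\<phi> \<in> test_functions D" "x \<notin> closure {x. \<phi> x \<noteq> 0}"
  shows "pd i \<phi> x = 0"
proof -
  have "((\<lambda>x. 0) has_derivative (\<lambda>_. 0)) (at x)" by simp
  then have "(\<phi> has_derivative (\<lambda>_. 0)) (at x)"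
    by (rule has_derivative_transform_within_open[where s = "- closure {x. \<phi> x \<noteq> 0}"])
      (use assms(2) test_functions_zero_outside[OF assms(1), symmetric] in \<open>blast intro: open_Compl closed_closure\<close>)+
  from pd_eqI[OF this] show ?thesis .
qed

lemma pd_test_functions:
  assumes "\<phi> \<in> test_functions D"
  shows "pd i \<phi> \<in> test_functions D"
proof (rule test_functionsI[where K = "closure {x. \<phi> x \<noteq> 0}"])
  show "Ck k (pd i \<phi>)" for k
    using test_functionsD(1)[OF assms, of "Suc k"] by simp
qed (fact test_functionsD(2)[OF assms] test_functionsD(3)[OF assms] pd_zero_outside[OF assms])+

lemma test_functions_bounded:
  assumes "\<phi> \<in> test_functions D"
  obtains K where "\<And>x. \<bar>\<phi> x\<bar> \<le> K" "0 \<le> K"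
proof -
  have "compact (\<phi> ` closure {x. \<phi> x \<noteq> 0})"
    by (rule compact_continuous_image[OF continuous_on_subset[OF test_functionsD(5)[OF assms]]])
      (use test_functionsD(2)[OF assms] in auto)
  then have "bounded (\<phi> ` closure {x. \<phi> x \<noteq> 0})" by (rule compact_imp_bounded)
  then obtain K where K: "\<And>x. x \<in> closure {x. \<phi> x \<noteq> 0} \<Longrightarrow> \<bar>\<phi> x\<bar> \<le> K"
    unfolding bounded_iff by auto
  have "\<bar>\<phi> x\<bar> \<le> max K 0" for x
  proof (cases "\<phi> x = 0")
    case False
    then have "x \<in> closure {x. \<phi> x \<noteq> 0}" using closure_subset[of "{x. \<phi> x \<noteq> 0}"] by blast
    from K[OF this] show ?thesis by linarith
  qed simp
  then show ?thesis using that[of "max K 0"] by simp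
qed

section \<open>The fundamental lemma of the calculus of variations\<close>

definition box_bump :: "real \<Rightarrow> real^'d \<Rightarrow> real^'d \<Rightarrow> real^'d \<Rightarrow> real" where
  "box_bump c a b x = (\<Prod>j\<in>UNIV. flat_exp 0 c (x $ j - a $ j) * flat_exp 0 c (b $ j - x $ j))"

lemma flat_exp_0_bounds: "c > 0 \<Longrightarrow> 0 \<le> flat_exp 0 c t \<and> flat_exp 0 c t \<le> 1"
  by (simp add: flat_exp_def)

lemma box_bump_bounds: "c > 0 \<Longrightarrow> 0 \<le> box_bump c a b x \<and> box_bump c a b x \<le> 1"
  unfolding box_bump_def
  by (auto intro!: prod_nonneg prod_le_1 mult_nonneg_nonneg mult_le_one dest: flat_exp_0_bounds)

lemma Ck_box_bump: "c > 0 \<Longrightarrow> Ck k (box_bump c a b)"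
proof -
  assume c: "c > 0"
  have "Ck k (\<lambda>x. flat_exp 0 c (1 * x $ j + - a $ j) * flat_exp 0 c (- 1 * x $ j + b $ j))" for j
    by (intro Ck_mult Ck_flat_exp c)
  then show ?thesis
    unfolding box_bump_def[abs_def] by (intro Ck_prod) (auto simp: algebra_simps)
qed

lemma box_bump_outside: "x \<notin> box a b \<Longrightarrow> box_bump c a b x = 0"
proof -
  assume "x \<notin> box a b"
  then obtain j where "\<not> (a $ j < x $ j \<and> x $ j < b $ j)" by (auto simp: mem_box_cart)
  then have "flat_exp 0 c (x $ j - a $ j) * flat_exp 0 c (b $ j - x $ j) = 0"
    by (auto simp: flat_exp_def)
  then show ?thesis unfolding box_bump_def by (auto intro: prod_zero)
qed

lemma box_bump_tendsto:
  assumes "x \<in> box a b"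
  shows "(\<lambda>n. box_bump (inverse (real (Suc n))) a b x) \<longlonglongrightarrow> 1"
proof -
  have one: "(\<lambda>n. flat_exp 0 (inverse (real (Suc n))) t) \<longlonglongrightarrow> 1" if "t > 0" for t
  proof -
    have "(\<lambda>n. exp (- (inverse (real (Suc n)) / t))) \<longlonglongrightarrow> exp (- (0 / t))"
      by (intro tendsto_intros LIMSEQ_inverse_real_of_nat) (use that in auto)
    then show ?thesis using that by (simp add: flat_exp_def)
  qed
  have "(\<lambda>n. box_bump (inverse (real (Suc n))) a b x) \<longlonglongrightarrow> (\<Prod>j\<in>(UNIV::'a set). 1 * 1)"
    unfolding box_bump_def using assms
    by (intro tendsto_prod tendsto_mult one) (auto simp: mem_box_cart)
  then show ?thesis by simp
qed

text \<open>An open set is a countable union of boxes whose closures it contains. The union of the first \<open>n\<close> boxes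
  is imitated by one minus the product of the functions one minus bump, which stays in \<open>[0, 1]\<close> and
  inherits compact support.\<close>

lemma indicator_open_limit_of_test_functions:
  fixes D :: "(real^'d) set"
  assumes "open G" "G \<subseteq> D"
  obtains \<phi> :: "nat \<Rightarrow> real^'d \<Rightarrow> real" where "\<And>n. \<phi> n \<in> test_functions D"
    "\<And>n x. 0 \<le> \<phi> n x \<and> \<phi> n x \<le> 1" "\<And>x. (\<lambda>n. \<phi> n x) \<longlonglongrightarrow> indicator G x"
proof (cases "G = {}")
  case True
  then show ?thesis using that[of "\<lambda>_ _. 0"] by (simp add: test_functions_zero)
next
  case False
  define F where "F = {box a b | a b. cbox a b \<subseteq> G}"
  have UF: "\<Union>F = G"
  proof
    show "\<Union>F \<subseteq> G" unfolding F_def using box_subset_cbox by blast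
    show "G \<subseteq> \<Union>F"
    proof
      fix x assume "x \<in> G"
      then obtain a b where "cbox a b \<subseteq> G" "x \<in> box a b"
        using open_contains_cbox[OF \<open>open G\<close>] by metis
      then show "x \<in> \<Union>F" unfolding F_def by blast
    qed
  qed
  have "\<And>S. S \<in> F \<Longrightarrow> open S" by (auto simp: F_def)
  then obtain F' where F': "F' \<subseteq> F" "countable F'" "\<Union>F' = \<Union>F"
    using Lindelof by metis
  then have ne: "F' \<noteq> {}" using UF False by auto
  have "\<exists>a b. from_nat_into F' i = box a b \<and> cbox a b \<subseteq> G" for i
    using from_nat_into[OF ne, of i] F'(1) unfolding F_def by blast
  then obtain a b where ab: "\<And>i. from_nat_into F' i = box (a i) (b i)" "\<And>i. cbox (a i) (b i) \<subseteq> G"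
    by metis
  have G: "G = (\<Union>i. box (a i) (b i))"
    using F'(3) UF range_from_nat_into[OF ne F'(2)] ab(1) by (metis (no_types, lifting) SUP_cong image_image)
  \<comment> \<open>The number of boxes and the sharpness of all bumps grow together, so that a single sequence exhausts the set.\<close>
  define q where "q n i x = 1 - box_bump (inverse (real (Suc n))) (a i) (b i) x" for n i x
  have q: "0 \<le> q n i x \<and> q n i x \<le> 1" for n i x
    using box_bump_bounds[of "inverse (real (Suc n))" "a i" "b i" x] by (auto simp: q_def)
  define \<phi> where "\<phi> n x = 1 - (\<Prod>i<n. q n i x)" for n x
  have prod01: "0 \<le> (\<Prod>i<n. q n i x) \<and> (\<Prod>i<n. q n i x) \<le> 1" for n x
    using q by (auto intro!: prod_nonneg prod_le_1)
  show ?thesis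
  proof
    show "\<phi> n \<in> test_functions D" for n
    proof (rule test_functionsI[where K = "\<Union>i<n. cbox (a i) (b i)"])
      show "Ck k (\<phi> n)" for k
        unfolding \<phi>_def[abs_def] q_def by (intro Ck_diff Ck_const Ck_prod Ck_box_bump) auto
      show "(\<Union>i<n. cbox (a i) (b i)) \<subseteq> D" using ab(2) \<open>G \<subseteq> D\<close> by blast
      show "\<phi> n x = 0" if "x \<notin> (\<Union>i<n. cbox (a i) (b i))" for x
      proof -
        have "q n i x = 1" if "i < n" for i
          using \<open>x \<notin> _\<close> that box_subset_cbox[of "a i" "b i"] box_bump_outside[of x "a i" "b i"]
          by (auto simp: q_def)
        then show ?thesis by (simp add: \<phi>_def)
      qed
    qed auto
    show "0 \<le> \<phi> n x \<and> \<phi> n x \<le> 1" for n x using prod01 by (auto simp: \<phi>_def)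
    show "(\<lambda>n. \<phi> n x) \<longlonglongrightarrow> indicator G x" for x
    proof (cases "x \<in> G")
      case True
      then obtain i where i: "x \<in> box (a i) (b i)" unfolding G by auto
      have "(\<lambda>n. \<Prod>i<n. q n i x) \<longlonglongrightarrow> 0"
      proof (rule tendsto_sandwich)
        show "\<forall>\<^sub>F n in sequentially. 0 \<le> (\<Prod>i<n. q n i x)" using prod01 by simp
        show "\<forall>\<^sub>F n in sequentially. (\<Prod>i<n. q n i x) \<le> q n i x"
          using eventually_gt_at_top[of i]
        proof eventually_elim
          case (elim n)
          have "(\<Prod>i<n. q n i x) = q n i x * (\<Prod>i\<in>{..<n} - {i}. q n i x)"
            using elim by (subst prod.remove[of _ i]) auto
          also have "\<dots> \<le> q n i x * 1"
            using q by (intro mult_left_mono prod_le_1) auto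
          finally show ?case by simp
        qed
        show "(\<lambda>n. q n i x) \<longlonglongrightarrow> 0"
          unfolding q_def using tendsto_diff[OF tendsto_const[of 1] box_bump_tendsto[OF i]] by simp
      qed simp
      from tendsto_diff[OF tendsto_const[of 1] this] show ?thesis using True by (simp add: \<phi>_def)
    next
      case False
      then have "x \<notin> box (a i) (b i)" for i unfolding G by auto
      then have "\<phi> n x = 0" for n by (simp add: \<phi>_def q_def box_bump_outside)
      then show ?thesis using False by simp
    qed
  qed
qed

text \<open>Dominated convergence extends orthogonality from test functions to indicators of open sets.\<close>

lemma integral_indicator_open_eq_0:
  fixes D :: "(real^'d) set"
  assumes "open G" "G \<subseteq> D" and g: "integrable (lebesgue_on D) g"
    and orth: "\<And>\<phi>. \<phi> \<in> test_functions D \<Longrightarrow> (LINT x|lebesgue_on D. g x * \<phi> x) = 0"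
    and D: "D \<in> sets lebesgue"
  shows "(LINT x|lebesgue_on D. g x * indicator G x) = 0"
proof -
  obtain \<phi> where \<phi>: "\<And>n. \<phi> n \<in> test_functions D"
    "\<And>n x. 0 \<le> \<phi> n x \<and> \<phi> n x \<le> 1" "\<And>x. (\<lambda>n. \<phi> n x) \<longlonglongrightarrow> indicator G x"
    using indicator_open_limit_of_test_functions[OF assms(1,2)] by metis
  have [measurable]: "\<phi> n \<in> borel_measurable (lebesgue_on D)" for n
    by (rule continuous_imp_measurable_on_sets_lebesgue[OF continuous_on_subset[OF test_functionsD(5)[OF \<phi>(1)]] D]) simp
  have [measurable]: "(\<lambda>x. indicator G x :: real) \<in> borel_measurable (lebesgue_on D)"
    by (rule borel_measurable_LIMSEQ_real[OF \<phi>(3)]) simp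
  note [measurable] = borel_measurable_integrable[OF g]
  have "(\<lambda>n. LINT x|lebesgue_on D. g x * \<phi> n x) \<longlonglongrightarrow> (LINT x|lebesgue_on D. g x * indicator G x)"
  proof (rule integral_dominated_convergence[where w = "\<lambda>x. \<bar>g x\<bar>"])
    show "AE x in lebesgue_on D. norm (g x * \<phi> n x) \<le> \<bar>g x\<bar>" for n
      using \<phi>(2) by (intro AE_I2) (auto simp: abs_mult intro!: mult_left_le)
  qed (use g \<phi>(3) in \<open>auto intro!: tendsto_intros\<close>)
  then show ?thesis by (simp add: orth[OF \<phi>(1)] LIMSEQ_const_iff)
qed

text \<open>If \<open>g\<close> were positive on a set of positive measure, it would be so on a closed subset \<open>T\<close> of \<open>D\<close> of positive
  measure. But the integral over \<open>T\<close> is the difference of those over the open sets \<open>D\<close> and \<open>D - T\<close>, which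
  vanish.\<close>

lemma AE_nonpos_if_orthogonal_to_test_functions:
  fixes D :: "(real^'d) set"
  assumes D: "open D" and g: "integrable (lebesgue_on D) g"
    and orth: "\<And>\<phi>. \<phi> \<in> test_functions D \<Longrightarrow> (LINT x|lebesgue_on D. g x * \<phi> x) = 0"
  shows "AE x in lebesgue_on D. g x \<le> 0"
proof -
  have DL: "D \<in> sets lebesgue" using D by (simp add: borel_open)
  note g_meas [measurable] = borel_measurable_integrable[OF g]
  define A where "A = {x \<in> space (lebesgue_on D). g x > 0}"
  have "A \<in> sets (lebesgue_on D)" unfolding A_def by measurable
  then have A: "A \<in> sets lebesgue" "A \<subseteq> D"
    using DL by (auto simp: sets_restrict_space A_def)
  have small: "emeasure lebesgue A < ennreal e" if e: "e > 0" for e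
  proof -
    obtain T where T: "closed T" "T \<subseteq> A" "A - T \<in> lmeasurable" "emeasure lebesgue (A - T) < ennreal e"
      using sets_lebesgue_inner_closed[OF A(1) e] by metis
    have TL: "T \<in> sets lebesgue" using T(1) by (simp add: borel_closed)
    have indT: "(\<lambda>x. indicator S x :: real) \<in> borel_measurable (lebesgue_on D)" if "S \<in> sets lebesgue" for S
      by (rule measurable_restrict_space1[OF borel_measurable_indicator[OF that]])
    have int: "integrable (lebesgue_on D) (\<lambda>x. g x * indicator S x)" if "S \<in> sets lebesgue" for S
      using indT[OF that]
      by (intro Bochner_Integration.integrable_bound[OF g]) (auto simp: indicator_def)
    have "(LINT x|lebesgue_on D. g x * indicator T x)
        = (LINT x|lebesgue_on D. g x * indicator D x - g x * indicator (D - T) x)"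
      using T(2) A(2) by (intro Bochner_Integration.integral_cong) (auto simp: indicator_def)
    also have "\<dots> = (LINT x|lebesgue_on D. g x * indicator D x) - (LINT x|lebesgue_on D. g x * indicator (D - T) x)"
      using int DL TL by (intro Bochner_Integration.integral_diff) auto
    also have "\<dots> = 0"
      using integral_indicator_open_eq_0[OF _ _ g orth DL] D T(1) by (simp add: open_Diff)
    finally have "(LINT x|lebesgue_on D. g x * indicator T x) = 0" .
    moreover have "AE x in lebesgue_on D. 0 \<le> g x * indicator T x"
      using T(2) by (intro AE_I2) (auto simp: A_def indicator_def)
    ultimately have "AE x in lebesgue_on D. g x * indicator T x = 0"
      using integral_nonneg_eq_0_iff_AE[OF int[OF TL]] by simp
    then have "AE x in lebesgue. x \<in> D \<longrightarrow> g x * indicator T x = 0"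
      using DL by (subst (asm) AE_restrict_space_iff) auto
    then have "AE x in lebesgue. x \<notin> T"
      by eventually_elim (use T(2) in \<open>auto simp: A_def indicator_def\<close>)
    then have "emeasure lebesgue T = 0"
      using TL by (simp add: AE_iff_measurable[OF TL])
    moreover have "emeasure lebesgue A = emeasure lebesgue T + emeasure lebesgue (A - T)"
      using T(2) TL A(1) by (subst plus_emeasure) (auto simp: Un_absorb1)
    ultimately show ?thesis using T(4) by simp
  qed
  have "emeasure lebesgue A = 0"
  proof (rule ccontr)
    assume "emeasure lebesgue A \<noteq> 0"
    then have pos: "emeasure lebesgue A > 0" by (simp add: zero_less_iff_neq_zero)
    moreover have fin: "emeasure lebesgue A < top" using small[of 1] by (auto simp: less_top[symmetric])
    ultimately have "emeasure lebesgue A = ennreal (enn2real (emeasure lebesgue A))" "enn2real (emeasure lebesgue A) > 0"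
      by (auto simp: enn2real_positive_iff)
    then show False using small by (metis order.irrefl)
  qed
  then have "AE x in lebesgue. x \<notin> A"
    using A(1) by (simp add: AE_iff_measurable[OF A(1)])
  then show ?thesis
    using DL by (subst AE_restrict_space_iff) (auto simp: A_def elim!: eventually_mono)
qed

theorem AE_eq_0_if_orthogonal_to_test_functions:
  fixes D :: "(real^'d) set"
  assumes D: "open D" and g: "integrable (lebesgue_on D) g"
    and orth: "\<And>\<phi>. \<phi> \<in> test_functions D \<Longrightarrow> (LINT x|lebesgue_on D. g x * \<phi> x) = 0"
  shows "AE x in lebesgue_on D. g x = 0"
proof -
  have "AE x in lebesgue_on D. g x \<le> 0"
    by (rule AE_nonpos_if_orthogonal_to_test_functions[OF assms])
  moreover have "AE x in lebesgue_on D. - g x \<le> 0"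
    by (rule AE_nonpos_if_orthogonal_to_test_functions[OF D]) (use g orth in auto)
  ultimately show ?thesis by eventually_elim simp
qed

section \<open>Integration by parts\<close>

lemma indicator_scaleR_support:
  fixes \<phi> :: "'a \<Rightarrow> real"
  shows "(\<And>x. x \<notin> C \<Longrightarrow> \<phi> x = 0) \<Longrightarrow> (\<lambda>x. indicator C x *\<^sub>R \<phi> x) = \<phi>"
  by (auto simp: indicator_def fun_eq_iff)

lemma test_function_integrable_lborel:
  assumes "\<phi> \<in> test_functions D"
  shows "integrable lborel \<phi>"
proof -
  have "integrable lborel (\<lambda>x. indicator (closure {x. \<phi> x \<noteq> 0}) x *\<^sub>R \<phi> x)"
    by (intro borel_integrable_compact test_functionsD(2)[OF assms]
        continuous_on_subset[OF test_functionsD(5)[OF assms]]) auto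
  moreover have "(\<lambda>x. indicator (closure {x. \<phi> x \<noteq> 0}) x *\<^sub>R \<phi> x) = \<phi>"
    by (rule indicator_scaleR_support[OF test_functions_zero_outside[OF assms]])
  ultimately show ?thesis by simp
qed

lemma test_function_lebesgue_on:
  assumes "\<phi> \<in> test_functions D" "D \<in> sets lebesgue"
  shows "integrable (lebesgue_on D) \<phi>" "(LINT x|lebesgue_on D. \<phi> x) = (LINT x|lborel. \<phi> x)"
    "\<phi> \<in> borel_measurable (lebesgue_on D)"
proof -
  have b: "\<phi> \<in> borel_measurable lborel"
    using test_function_integrable_lborel[OF assms(1)] by (rule borel_measurable_integrable)
  have eq: "(\<lambda>x. indicator D x *\<^sub>R \<phi> x) = \<phi>"
    by (rule indicator_scaleR_support)
      (use test_functions_zero_outside[OF assms(1)] test_functionsD(3)[OF assms(1)] in blast)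
  have DS: "D \<inter> space lebesgue \<in> sets lebesgue" using assms(2) by simp
  show int: "integrable (lebesgue_on D) \<phi>"
    unfolding integrable_restrict_space[OF DS] eq
    using test_function_integrable_lborel[OF assms(1)] integrable_completion[OF b] by simp
  show "(LINT x|lebesgue_on D. \<phi> x) = (LINT x|lborel. \<phi> x)"
    unfolding integral_restrict_space[OF DS] eq by (rule integral_completion[OF b])
  show "\<phi> \<in> borel_measurable (lebesgue_on D)" using int by (rule borel_measurable_integrable)
qed

lemma DERIV_along_axis:
  assumes "\<And>x. \<phi> differentiable (at x)"
  shows "((\<lambda>t. \<phi> (x + t *\<^sub>R axis i 1)) has_real_derivative pd i \<phi> (x + t *\<^sub>R axis i 1)) (at t)"
proof -
  let ?F = "frechet_derivative \<phi> (at (x + t *\<^sub>R axis i 1))"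
  have F: "(\<phi> has_derivative ?F) (at (x + t *\<^sub>R axis i 1))"
    using assms frechet_derivative_works by blast
  have "((\<lambda>t. x + t *\<^sub>R axis i 1) has_derivative (\<lambda>s. s *\<^sub>R axis i 1)) (at t)"
    by (auto intro!: derivative_eq_intros)
  from has_derivative_compose[OF this F]
  have "((\<lambda>t. \<phi> (x + t *\<^sub>R axis i 1)) has_derivative (\<lambda>s. ?F (s *\<^sub>R axis i 1))) (at t)" .
  moreover have "(\<lambda>s. ?F (s *\<^sub>R axis i 1)) = (*) (pd i \<phi> (x + t *\<^sub>R axis i 1))"
    using linear_frechet_derivative[OF assms] by (auto simp: pd_def linear_scale)
  ultimately show ?thesis by (simp add: has_field_derivative_def)
qed

lemma lborel_integral_translate:
  fixes f :: "'a::euclidean_space \<Rightarrow> real"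
  assumes "f \<in> borel_measurable borel"
  shows "(LINT x|lborel. f (x + c)) = (LINT x|lborel. f x)"
proof -
  have "(LINT x|lborel. f x) = (LINT x|distr lborel borel ((+) c). f x)"
    by (simp add: lborel_distr_plus)
  also have "\<dots> = (LINT x|lborel. f (c + x))"
    using assms by (subst integral_distr) auto
  finally show ?thesis by (simp add: add.commute)
qed

text \<open>Translation invariance makes the integral of each difference quotient zero. The quotients are bounded,
  by the mean value theorem, and supported in one ball, so that dominated convergence applies.\<close>

theorem integral_pd_test_function:
  fixes \<phi> :: "real^'d \<Rightarrow> real"
  assumes \<phi>: "\<phi> \<in> test_functions D"
  shows "(LINT x|lborel. pd i \<phi> x) = 0"
proof -
  let ?e = "axis i 1 :: real^'d"
  define h where "h n = inverse (real (Suc n))" for n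
  have h: "0 < h n" "h n \<le> 1" for n by (auto simp: h_def inverse_le_1_iff)
  define q where "q n x = (\<phi> (x + h n *\<^sub>R ?e) - \<phi> x) / h n" for n x
  note diff = test_functionsD(4)[OF \<phi>]
  obtain K where K: "\<And>x. \<bar>pd i \<phi> x\<bar> \<le> K" "0 \<le> K"
    using test_functions_bounded[OF pd_test_functions[OF \<phi>, of i]] by blast
  obtain R where R: "\<And>x. x \<in> closure {x. \<phi> x \<noteq> 0} \<Longrightarrow> norm x \<le> R"
    using compact_imp_bounded[OF test_functionsD(2)[OF \<phi>]] unfolding bounded_iff by blast
  have bound: "\<bar>q n x\<bar> \<le> K * indicator (cball 0 (R + 1)) x" for n x
  proof -
    obtain z where z: "0 < z" "z < h n"
      "\<phi> (x + h n *\<^sub>R ?e) - \<phi> (x + 0 *\<^sub>R ?e) = (h n - 0) * pd i \<phi> (x + z *\<^sub>R ?e)"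
      using MVT2[OF h(1)[of n], of "\<lambda>t. \<phi> (x + t *\<^sub>R ?e)" "\<lambda>t. pd i \<phi> (x + t *\<^sub>R ?e)"]
        DERIV_along_axis[OF diff] by blast
    then have q: "q n x = pd i \<phi> (x + z *\<^sub>R ?e)" using h[of n] by (simp add: q_def)
    show ?thesis
    proof (cases "x \<in> cball 0 (R + 1)")
      case True
      then show ?thesis using K by (simp add: q)
    next
      case False
      have "norm x \<le> norm (x + z *\<^sub>R ?e) + norm (z *\<^sub>R ?e)"
        using norm_triangle_ineq4[of "x + z *\<^sub>R ?e" "z *\<^sub>R ?e"] by simp
      also have "norm (z *\<^sub>R ?e) \<le> 1" using z h(2)[of n] by simp
      finally have "norm (x + z *\<^sub>R ?e) > R" using False by simp
      then have "x + z *\<^sub>R ?e \<notin> closure {x. \<phi> x \<noteq> 0}" using R by force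
      then show ?thesis using False by (simp add: q pd_zero_outside[OF \<phi>])
    qed
  qed
  have [measurable]: "\<phi> \<in> borel_measurable borel" "pd i \<phi> \<in> borel_measurable borel"
    using test_functionsD(5)[OF \<phi>] test_functionsD(5)[OF pd_test_functions[OF \<phi>]]
    by (auto intro: borel_measurable_continuous_onI)
  have "(\<lambda>n. LINT x|lborel. q n x) \<longlonglongrightarrow> (LINT x|lborel. pd i \<phi> x)"
  proof (rule integral_dominated_convergence[where w = "\<lambda>x. K * indicator (cball 0 (R + 1)) x"])
    show "integrable lborel (\<lambda>x. K * indicator (cball 0 (R + 1)) x :: real)"
      by (intro integrable_mult_right integrable_real_indicator emeasure_lborel_cball_finite) simp
    show "AE x in lborel. (\<lambda>n. q n x) \<longlonglongrightarrow> pd i \<phi> x"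
    proof (rule AE_I2)
      fix x
      have lim: "((\<lambda>t. (\<phi> (x + t *\<^sub>R ?e) - \<phi> x) / t) \<longlongrightarrow> pd i \<phi> x) (at 0)"
        using DERIV_along_axis[OF diff, of x i 0] by (simp add: has_field_derivative_iff)
      have "filterlim h (at 0) sequentially"
        using LIMSEQ_inverse_real_of_nat h(1) unfolding h_def[abs_def]
        by (auto simp: filterlim_at intro!: eventuallyI)
      from filterlim_compose[OF lim this] show "(\<lambda>n. q n x) \<longlonglongrightarrow> pd i \<phi> x" by (simp add: q_def)
    qed
    show "AE x in lborel. norm (q n x) \<le> K * indicator (cball 0 (R + 1)) x" for n
      using bound by simp
    show "q n \<in> borel_measurable lborel" for n unfolding q_def by measurable
  qed simp
  moreover have "(LINT x|lborel. q n x) = 0" for n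
  proof -
    note int = test_function_integrable_lborel[OF \<phi>]
    have int': "integrable lborel (\<lambda>x. \<phi> (x + h n *\<^sub>R ?e))"
    proof -
      have "integrable (distr lborel borel ((+) (h n *\<^sub>R ?e))) \<phi>"
        using int by (simp add: lborel_distr_plus)
      then show ?thesis by (subst (asm) integrable_distr_eq) (auto simp: add.commute)
    qed
    show ?thesis
      unfolding q_def using int int' by (simp add: lborel_integral_translate)
  qed
  ultimately show ?thesis by (simp add: LIMSEQ_const_iff)
qed

lemma integration_by_parts_test_functions:
  assumes "\<phi> \<in> test_functions D" "\<psi> \<in> test_functions D" "D \<in> sets lebesgue"
  shows "(LINT x|lebesgue_on D. \<phi> x * pd i \<psi> x) = - (LINT x|lebesgue_on D. pd i \<phi> x * \<psi> x)"
proof -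
  have t: "(\<lambda>x. \<phi> x * pd i \<psi> x) \<in> test_functions D" "(\<lambda>x. pd i \<phi> x * \<psi> x) \<in> test_functions D"
    "(\<lambda>x. \<phi> x * \<psi> x) \<in> test_functions D"
    using test_functions_mult[OF pd_test_functions[OF assms(2)] test_functionsD(1)[OF assms(1)]]
      test_functions_mult[OF assms(2) test_functionsD(1)[OF pd_test_functions[OF assms(1)]]]
      test_functions_mult[OF assms(2) test_functionsD(1)[OF assms(1)]] by blast+
  have "(LINT x|lebesgue_on D. \<phi> x * pd i \<psi> x) + (LINT x|lebesgue_on D. pd i \<phi> x * \<psi> x)
      = (LINT x|lborel. \<phi> x * pd i \<psi> x + pd i \<phi> x * \<psi> x)"
    unfolding test_function_lebesgue_on(2)[OF t(1) assms(3)] test_function_lebesgue_on(2)[OF t(2) assms(3)]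
    by (rule Bochner_Integration.integral_add[OF test_function_integrable_lborel[OF t(1)]
        test_function_integrable_lborel[OF t(2)], symmetric])
  also have "\<dots> = (LINT x|lborel. pd i (\<lambda>x. \<phi> x * \<psi> x) x)"
    by (intro Bochner_Integration.integral_cong refl)
      (simp add: pd_mult test_functionsD(4)[OF assms(1)] test_functionsD(4)[OF assms(2)])
  also have "\<dots> = 0" by (rule integral_pd_test_function[OF t(3)])
  finally show ?thesis by simp
qed

section \<open>Weak gradients\<close>

lemma semi_inner_subset:
  assumes "semi_inner S B" "T \<subseteq> S" "(\<lambda>x. 0) \<in> T"
    and "\<And>u v. u \<in> T \<Longrightarrow> v \<in> T \<Longrightarrow> (\<lambda>x. u x + v x) \<in> T"
    and "\<And>u c. u \<in> T \<Longrightarrow> (\<lambda>x. c *\<^sub>R u x) \<in> T"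
  shows "semi_inner T B"
proof -
  interpret semi_inner S B by fact
  show ?thesis
    using assms(2-) by unfold_locales (auto simp: form_simps subset_iff form_sym form_nonneg)
qed

definition classical_grad :: "(real^'d \<Rightarrow> real) \<Rightarrow> real^'d \<Rightarrow> real^'d" where
  "classical_grad \<phi> x = (\<chi> i. pd i \<phi> x)"

definition energy :: "(real^'d) set \<Rightarrow> (real^'d \<Rightarrow> real) \<Rightarrow> (real^'d \<Rightarrow> real) \<Rightarrow> (real^'d \<Rightarrow> real) \<Rightarrow> real" where
  "energy D c u v = L2_inner D c (weak_grad D u) (weak_grad D v)"

locale bounded_domain =
  fixes D :: "(real^'d) set"
  assumes open_D: "open D" and bounded_D: "bounded D"
begin

lemma sets_D: "D \<in> sets lebesgue"
  using open_D by (simp add: borel_open)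

lemma finite_measure_D: "finite_measure (lebesgue_on D)"
  by (intro finite_measure_lebesgue_on bounded_set_imp_lmeasurable bounded_D sets_D)

lemma test_functions_L2:
  assumes "\<phi> \<in> test_functions D"
  shows "\<phi> \<in> L2 D"
  unfolding L2_def
  using test_function_lebesgue_on(3)[OF assms sets_D]
    test_function_lebesgue_on(1)[OF test_functions_mult[OF assms test_functionsD(1)[OF assms]] sets_D]
  by (simp add: power2_eq_square)

lemma L2_component:
  fixes g :: "real^'d \<Rightarrow> real^'d"
  assumes g: "g \<in> L2 D"
  shows "(\<lambda>x. g x $ i) \<in> L2 D"
proof (rule L2I_bound[OF _ L2_square_integrable[OF g]])
  have "(\<lambda>x. g x \<bullet> axis i 1) \<in> borel_measurable (lebesgue_on D)"
    using L2_measurable[OF g] by measurable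
  then show "(\<lambda>x. g x $ i) \<in> borel_measurable (lebesgue_on D)"
    by (simp add: cart_eq_inner_axis)
  show "(norm (g x $ i))\<^sup>2 \<le> (norm (g x))\<^sup>2" for x
    by (intro power_mono) (simp_all add: component_le_norm_cart)
qed

lemma L2_times_axis:
  fixes \<phi> :: "real^'d \<Rightarrow> real"
  assumes "\<phi> \<in> L2 D"
  shows "(\<lambda>x. \<phi> x *\<^sub>R (axis i 1 :: real^'d)) \<in> L2 D"
proof (rule L2I_bound[OF _ L2_square_integrable[OF assms]])
  show "(\<lambda>x. \<phi> x *\<^sub>R (axis i 1 :: real^'d)) \<in> borel_measurable (lebesgue_on D)"
    using L2_measurable[OF assms] by measurable
qed simp

lemma classical_grad_L2:
  assumes "\<phi> \<in> test_functions D"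
  shows "classical_grad \<phi> \<in> L2 D"
proof (rule L2I_bound)
  have "continuous_on UNIV (classical_grad \<phi>)"
    unfolding classical_grad_def[abs_def]
    by (intro continuous_on_vec_lambda test_functionsD(5)[OF pd_test_functions[OF assms]])
  then show "classical_grad \<phi> \<in> borel_measurable (lebesgue_on D)"
    using sets_D by (intro continuous_imp_measurable_on_sets_lebesgue) (auto intro: continuous_on_subset)
  show "integrable (lebesgue_on D) (\<lambda>x. \<Sum>i\<in>UNIV. (norm (pd i \<phi> x))\<^sup>2)"
    by (intro Bochner_Integration.integrable_sum L2_square_integrable test_functions_L2 pd_test_functions assms)
  show "(norm (classical_grad \<phi> x))\<^sup>2 \<le> (\<Sum>i\<in>UNIV. (norm (pd i \<phi> x))\<^sup>2)" for x
    unfolding classical_grad_def power2_norm_eq_inner inner_vec_def by simp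
qed

lemma classical_grad_weak:
  "\<phi> \<in> test_functions D \<Longrightarrow> has_weak_gradient D \<phi> (classical_grad \<phi>)"
  using integration_by_parts_test_functions[OF _ _ sets_D]
  by (simp add: has_weak_gradient_def classical_grad_def)

lemma weak_gradient_unique:
  assumes g: "g \<in> L2 D" "has_weak_gradient D v g" and h: "h \<in> L2 D" "has_weak_gradient D v h"
  shows "AE x in lebesgue_on D. g x = h x"
proof -
  have "AE x in lebesgue_on D. g x $ i - h x $ i = 0" for i
  proof (rule AE_eq_0_if_orthogonal_to_test_functions[OF open_D])
    have one: "(\<lambda>_. 1::real) \<in> L2 D"
      using finite_measure_D by (simp add: L2_def finite_measure.integrable_const)
    have d: "(\<lambda>x. g x $ i - h x $ i) \<in> L2 D"
      by (intro L2_diff L2_component g h)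
    show "integrable (lebesgue_on D) (\<lambda>x. g x $ i - h x $ i)"
      using L2_integrable_inner[OF d one] by simp
    fix \<phi> assume t: "\<phi> \<in> test_functions D"
    have int: "integrable (lebesgue_on D) (\<lambda>x. g x $ i * \<phi> x)" "integrable (lebesgue_on D) (\<lambda>x. h x $ i * \<phi> x)"
      using L2_integrable_inner[OF L2_component test_functions_L2[OF t]] g h by simp_all
    have "(LINT x|lebesgue_on D. (g x $ i - h x $ i) * \<phi> x)
        = (LINT x|lebesgue_on D. g x $ i * \<phi> x) - (LINT x|lebesgue_on D. h x $ i * \<phi> x)"
      using int by (simp add: left_diff_distrib)
    also have "\<dots> = 0"
      using bspec[OF g(2)[unfolded has_weak_gradient_def] t, THEN spec[of _ i]]
        bspec[OF h(2)[unfolded has_weak_gradient_def] t, THEN spec[of _ i]] by linarith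
    finally show "(LINT x|lebesgue_on D. (g x $ i - h x $ i) * \<phi> x) = 0" .
  qed
  then have "AE x in lebesgue_on D. \<forall>i\<in>UNIV. g x $ i - h x $ i = 0"
    by (intro AE_finite_allI) auto
  then show ?thesis by eventually_elim (simp add: vec_eq_iff)
qed

lemma H1_weak_grad:
  assumes "v \<in> H1 D"
  shows "v \<in> L2 D" "weak_grad D v \<in> L2 D" "has_weak_gradient D v (weak_grad D v)"
proof -
  have "\<exists>g. g \<in> L2 D \<and> has_weak_gradient D v g" using assms by (auto simp: H1_def)
  from someI_ex[OF this] show "weak_grad D v \<in> L2 D" "has_weak_gradient D v (weak_grad D v)"
    by (auto simp: weak_grad_def)
qed (use assms in \<open>simp add: H1_def\<close>)

text \<open>All statements about the chosen \<open>weak_grad\<close> are obtained by exhibiting some weak gradient.\<close>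

lemma H1I:
  assumes "v \<in> L2 D" "g \<in> L2 D" "has_weak_gradient D v g"
  shows "v \<in> H1 D" "AE x in lebesgue_on D. weak_grad D v x = g x"
proof -
  show H: "v \<in> H1 D" using assms by (auto simp: H1_def)
  show "AE x in lebesgue_on D. weak_grad D v x = g x"
    by (rule weak_gradient_unique[OF H1_weak_grad(2,3)[OF H] assms(2,3)])
qed

lemma has_weak_gradient_add:
  assumes "v \<in> L2 D" "g \<in> L2 D" "has_weak_gradient D v g" "w \<in> L2 D" "h \<in> L2 D" "has_weak_gradient D w h"
  shows "has_weak_gradient D (\<lambda>x. v x + w x) (\<lambda>x. g x + h x)"
  unfolding has_weak_gradient_def
proof (intro ballI allI)
  fix \<phi> i assume t: "\<phi> \<in> test_functions D"
  note int = L2_integrable_inner[OF assms(1) test_functions_L2[OF pd_test_functions[OF t, of i]]]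
    L2_integrable_inner[OF assms(4) test_functions_L2[OF pd_test_functions[OF t, of i]]]
    L2_integrable_inner[OF L2_component[OF assms(2), of i] test_functions_L2[OF t]]
    L2_integrable_inner[OF L2_component[OF assms(5), of i] test_functions_L2[OF t]]
  have "(LINT x|lebesgue_on D. v x * pd i \<phi> x) = - (LINT x|lebesgue_on D. g x $ i * \<phi> x)"
    "(LINT x|lebesgue_on D. w x * pd i \<phi> x) = - (LINT x|lebesgue_on D. h x $ i * \<phi> x)"
    using bspec[OF assms(3)[unfolded has_weak_gradient_def] t, THEN spec[of _ i]]
      bspec[OF assms(6)[unfolded has_weak_gradient_def] t, THEN spec[of _ i]] by simp_all
  then show "(LINT x|lebesgue_on D. (v x + w x) * pd i \<phi> x) = - (LINT x|lebesgue_on D. (g x + h x) $ i * \<phi> x)"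
    using int by (simp add: distrib_right)
qed

lemma has_weak_gradient_scale:
  assumes "has_weak_gradient D v g"
  shows "has_weak_gradient D (\<lambda>x. c *\<^sub>R v x) (\<lambda>x. c *\<^sub>R g x)"
  unfolding has_weak_gradient_def
proof (intro ballI allI)
  fix \<phi> i assume t: "\<phi> \<in> test_functions D"
  have "(LINT x|lebesgue_on D. v x * pd i \<phi> x) = - (LINT x|lebesgue_on D. g x $ i * \<phi> x)"
    using bspec[OF assms[unfolded has_weak_gradient_def] t, THEN spec[of _ i]] by simp
  then have "c * (LINT x|lebesgue_on D. v x * pd i \<phi> x) = - (c * (LINT x|lebesgue_on D. g x $ i * \<phi> x))"
    by simp
  then show "(LINT x|lebesgue_on D. c *\<^sub>R v x * pd i \<phi> x) = - (LINT x|lebesgue_on D. (c *\<^sub>R g x) $ i * \<phi> x)"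
    by (simp add: mult.assoc)
qed

lemma H1_add:
  assumes v: "v \<in> H1 D" and w: "w \<in> H1 D"
  shows "(\<lambda>x. v x + w x) \<in> H1 D"
    "AE x in lebesgue_on D. weak_grad D (\<lambda>x. v x + w x) x = weak_grad D v x + weak_grad D w x"
proof -
  note V = H1_weak_grad[OF v] and W = H1_weak_grad[OF w]
  show "(\<lambda>x. v x + w x) \<in> H1 D"
    "AE x in lebesgue_on D. weak_grad D (\<lambda>x. v x + w x) x = weak_grad D v x + weak_grad D w x"
  by (rule H1I[OF L2_add[OF V(1) W(1)] L2_add[OF V(2) W(2)] has_weak_gradient_add[OF V W]])+
qed

lemma H1_scale:
  assumes v: "v \<in> H1 D"
  shows "(\<lambda>x. c *\<^sub>R v x) \<in> H1 D"
    "AE x in lebesgue_on D. weak_grad D (\<lambda>x. c *\<^sub>R v x) x = c *\<^sub>R weak_grad D v x"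
  by (rule H1I[OF L2_scaleR[OF H1_weak_grad(1)[OF v]] L2_scaleR[OF H1_weak_grad(2)[OF v]]
        has_weak_gradient_scale[OF H1_weak_grad(3)[OF v]]])+

lemma test_functions_H1:
  assumes "\<phi> \<in> test_functions D"
  shows "\<phi> \<in> H1 D" "AE x in lebesgue_on D. weak_grad D \<phi> x = classical_grad \<phi> x"
  by (rule H1I[OF test_functions_L2[OF assms] classical_grad_L2[OF assms] classical_grad_weak[OF assms]])+

lemma energy_add_left:
  assumes u: "u \<in> H1 D" and v: "v \<in> H1 D" and w: "w \<in> H1 D"
    and c: "c \<in> borel_measurable (lebesgue_on D)" "AE x in lebesgue_on D. \<bar>c x\<bar> \<le> K"
  shows "energy D c (\<lambda>x. u x + v x) w = energy D c u w + energy D c v w"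
proof -
  note L = H1_weak_grad(2)[OF u] H1_weak_grad(2)[OF v] H1_weak_grad(2)[OF w]
  have "energy D c (\<lambda>x. u x + v x) w = L2_inner D c (\<lambda>x. weak_grad D u x + weak_grad D v x) (weak_grad D w)"
    unfolding energy_def
    by (rule L2_inner_cong_AE[OF L2_measurable[OF H1_weak_grad(2)[OF H1_add(1)[OF u v]]]
          L2_measurable[OF L2_add[OF L(1,2)]] L2_measurable[OF L(3)] L2_measurable[OF L(3)] c(1) H1_add(2)[OF u v]])
      simp
  then show ?thesis unfolding energy_def by (simp add: L2_inner_add_left[OF L c])
qed

lemma energy_scale_left:
  assumes u: "u \<in> H1 D" and w: "w \<in> H1 D" and c: "c \<in> borel_measurable (lebesgue_on D)"
  shows "energy D c (\<lambda>x. r *\<^sub>R u x) w = r * energy D c u w"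
proof -
  note L = H1_weak_grad(2)[OF u] H1_weak_grad(2)[OF w]
  have "energy D c (\<lambda>x. r *\<^sub>R u x) w = L2_inner D c (\<lambda>x. r *\<^sub>R weak_grad D u x) (weak_grad D w)"
    unfolding energy_def
    by (rule L2_inner_cong_AE[OF L2_measurable[OF H1_weak_grad(2)[OF H1_scale(1)[OF u]]]
          L2_measurable[OF L2_scaleR[OF L(1)]] L2_measurable[OF L(2)] L2_measurable[OF L(2)] c H1_scale(2)[OF u]])
      simp
  then show ?thesis unfolding energy_def by (simp add: L2_inner_scaleR_left)
qed

lemma energy_commute: "energy D c u w = energy D c w u"
  unfolding energy_def by (rule L2_inner_commute)

lemma H1_zero: "(\<lambda>x. 0) \<in> H1 D"
  by (rule test_functions_H1(1)[OF test_functions_zero])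

lemma semi_inner_H1:
  assumes c: "c \<in> borel_measurable (lebesgue_on D)" "AE x in lebesgue_on D. 0 \<le> c x \<and> c x \<le> K"
  shows "semi_inner (H1 D) (energy D c)"
proof -
  have c': "AE x in lebesgue_on D. \<bar>c x\<bar> \<le> K" using c(2) by eventually_elim auto
  interpret W: semi_inner "L2 D" "L2_inner D c :: (real^'d \<Rightarrow> real^'d) \<Rightarrow> _"
    by (rule semi_inner_L2_weighted[OF c])
  show ?thesis
  proof
    show "0 \<le> energy D c u u" if "u \<in> H1 D" for u
      unfolding energy_def by (rule W.form_nonneg[OF H1_weak_grad(2)[OF that]])
  qed (fact H1_zero H1_add(1) H1_scale(1) energy_add_left[OF _ _ _ c(1) c'] energy_scale_left[OF _ _ c(1)]
      | rule energy_commute)+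
qed

sublocale H1: semi_inner "H1 D" "energy D (\<lambda>_. 1)"
  by (rule semi_inner_H1[where K = 1]) auto

lemma H1_nrm_eq: "H1.nrm v = V_norm D v"
  by (simp add: H1.nrm_def V_norm_def energy_def L2_norm_def L2_inner_def power2_norm_eq_inner)

lemma V_norm_nonneg [simp]: "0 \<le> V_norm D v"
  by (simp add: V_norm_def)

lemmas V_norm_triangle = H1.nrm_triangle[unfolded H1_nrm_eq]
lemmas V_norm_triangle_diff = H1.nrm_triangle_diff[unfolded H1_nrm_eq]

lemma H10_subset_H1: "v \<in> H10 D \<Longrightarrow> v \<in> H1 D"
  by (simp add: H10_def)

section \<open>The space of functions vanishing on the boundary\<close>

text \<open>The \<open>H\<^sup>1\<close>-norm of the definition is replaced by its two parts, which satisfy separate triangle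
  inequalities.\<close>

lemma H10_iff:
  "v \<in> H10 D \<longleftrightarrow> v \<in> H1 D \<and>
    (\<forall>e>0. \<exists>\<phi>\<in>test_functions D. L2_norm D (\<lambda>x. \<phi> x - v x) < e \<and> V_norm D (\<lambda>x. \<phi> x - v x) < e)"
    (is "?L \<longleftrightarrow> ?R")
proof
  assume ?L
  then obtain \<phi> where v: "v \<in> H1 D" and \<phi>: "\<And>n. \<phi> n \<in> test_functions D"
    and lim: "(\<lambda>n. H1_norm D (\<lambda>x. \<phi> n x - v x)) \<longlonglongrightarrow> 0"
    unfolding H10_def by auto
  have "\<exists>\<phi>\<in>test_functions D. L2_norm D (\<lambda>x. \<phi> x - v x) < e \<and> V_norm D (\<lambda>x. \<phi> x - v x) < e" if "e > 0" for e
  proof -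
    have "\<forall>\<^sub>F n in sequentially. H1_norm D (\<lambda>x. \<phi> n x - v x) < e"
      using order_tendstoD(2)[OF lim that] .
    then obtain n where n: "H1_norm D (\<lambda>x. \<phi> n x - v x) < e"
      using eventually_happens by fastforce
    have "L2_norm D w \<le> H1_norm D w" "V_norm D w \<le> H1_norm D w" for w
      unfolding H1_norm_def V_norm_def by (auto intro: real_le_rsqrt)
    then show ?thesis using n \<phi>[of n] by (meson order.strict_trans1)
  qed
  then show ?R using v by blast
next
  assume R: ?R
  then have "\<exists>\<phi>\<in>test_functions D. L2_norm D (\<lambda>x. \<phi> x - v x) < inverse (real (Suc n)) \<and>
      V_norm D (\<lambda>x. \<phi> x - v x) < inverse (real (Suc n))" for n
    by simp
  then obtain \<phi> where \<phi>: "\<And>n. \<phi> n \<in> test_functions D"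
    "\<And>n. L2_norm D (\<lambda>x. \<phi> n x - v x) < inverse (real (Suc n))"
    "\<And>n. V_norm D (\<lambda>x. \<phi> n x - v x) < inverse (real (Suc n))" by metis
  have "(\<lambda>n. H1_norm D (\<lambda>x. \<phi> n x - v x)) \<longlonglongrightarrow> 0"
  proof (rule tendsto_sandwich)
    show "\<forall>\<^sub>F n in sequentially. 0 \<le> H1_norm D (\<lambda>x. \<phi> n x - v x)" by (simp add: H1_norm_def)
    have "H1_norm D (\<lambda>x. \<phi> n x - v x) \<le> inverse (real (Suc n)) + inverse (real (Suc n))" for n
    proof -
      have "H1_norm D (\<lambda>x. \<phi> n x - v x) \<le> L2_norm D (\<lambda>x. \<phi> n x - v x) + V_norm D (\<lambda>x. \<phi> n x - v x)"
        unfolding H1_norm_def V_norm_def by (rule sqrt_sum_squares_le_sum) auto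
      then show ?thesis using \<phi>(2,3)[of n] by linarith
    qed
    then show "\<forall>\<^sub>F n in sequentially. H1_norm D (\<lambda>x. \<phi> n x - v x) \<le> inverse (real (Suc n)) + inverse (real (Suc n))"
      by simp
    show "(\<lambda>n. inverse (real (Suc n)) + inverse (real (Suc n))) \<longlonglongrightarrow> 0"
      using tendsto_add[OF LIMSEQ_inverse_real_of_nat LIMSEQ_inverse_real_of_nat] by simp
  qed simp
  then show ?L using R \<phi>(1) unfolding H10_def by blast
qed

lemma H10_add:
  assumes v: "v \<in> H10 D" and w: "w \<in> H10 D"
  shows "(\<lambda>x. v x + w x) \<in> H10 D"
  unfolding H10_iff
proof (intro conjI allI impI)
  note H = H10_subset_H1[OF v] H10_subset_H1[OF w]
  show "(\<lambda>x. v x + w x) \<in> H1 D" by (rule H1_add(1)[OF H])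
  fix e :: real assume "e > 0"
  then have e: "e / 2 > 0" by simp
  obtain \<phi> where \<phi>: "\<phi> \<in> test_functions D" "L2_norm D (\<lambda>x. \<phi> x - v x) < e/2" "V_norm D (\<lambda>x. \<phi> x - v x) < e/2"
    using v e unfolding H10_iff by blast
  obtain \<psi> where \<psi>: "\<psi> \<in> test_functions D" "L2_norm D (\<lambda>x. \<psi> x - w x) < e/2" "V_norm D (\<lambda>x. \<psi> x - w x) < e/2"
    using w e unfolding H10_iff by blast
  have eq: "(\<lambda>x. (\<phi> x + \<psi> x) - (v x + w x)) = (\<lambda>x. (\<phi> x - v x) + (\<psi> x - w x))" by auto
  have d: "(\<lambda>x. \<phi> x - v x) \<in> H1 D" "(\<lambda>x. \<psi> x - w x) \<in> H1 D"
    by (intro H1.diff_mem test_functions_H1(1) \<phi> \<psi> H)+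
  have "L2_norm D (\<lambda>x. (\<phi> x + \<psi> x) - (v x + w x)) < e" "V_norm D (\<lambda>x. (\<phi> x + \<psi> x) - (v x + w x)) < e"
    unfolding eq using L2_norm_triangle[OF d[THEN H1_weak_grad(1)]] V_norm_triangle[OF d] \<phi>(2,3) \<psi>(2,3)
    by linarith+
  then show "\<exists>\<phi>\<in>test_functions D. L2_norm D (\<lambda>x. \<phi> x - (v x + w x)) < e \<and> V_norm D (\<lambda>x. \<phi> x - (v x + w x)) < e"
    by (intro bexI[OF _ test_functions_add[OF \<phi>(1) \<psi>(1)]] conjI)
qed

lemma H10_scale:
  assumes v: "v \<in> H10 D"
  shows "(\<lambda>x. c *\<^sub>R v x) \<in> H10 D"
  unfolding H10_iff
proof (intro conjI allI impI)
  note H = H10_subset_H1[OF v]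
  show "(\<lambda>x. c *\<^sub>R v x) \<in> H1 D" by (rule H1_scale(1)[OF H])
  fix e :: real assume "e > 0"
  then have e: "e / (\<bar>c\<bar> + 1) > 0" by simp
  obtain \<phi> where \<phi>: "\<phi> \<in> test_functions D" "L2_norm D (\<lambda>x. \<phi> x - v x) < e / (\<bar>c\<bar> + 1)"
    "V_norm D (\<lambda>x. \<phi> x - v x) < e / (\<bar>c\<bar> + 1)"
    using v e unfolding H10_iff by blast
  have eq: "(\<lambda>x. c * \<phi> x - c *\<^sub>R v x) = (\<lambda>x. c *\<^sub>R (\<phi> x - v x))" by (auto simp: algebra_simps)
  have d: "(\<lambda>x. \<phi> x - v x) \<in> H1 D"
    by (intro H1.diff_mem test_functions_H1(1) \<phi> H)
  have *: "\<bar>c\<bar> * r < e" if "r < e / (\<bar>c\<bar> + 1)" "r \<ge> 0" for r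
  proof -
    have "\<bar>c\<bar> * r \<le> (\<bar>c\<bar> + 1) * r" using that by (simp add: algebra_simps)
    also have "\<dots> < e" using that(1) by (simp add: field_simps)
    finally show ?thesis .
  qed
  have "L2_norm D (\<lambda>x. c * \<phi> x - c *\<^sub>R v x) < e" "V_norm D (\<lambda>x. c * \<phi> x - c *\<^sub>R v x) < e"
    unfolding eq L2_norm_scaleR[OF d[THEN H1_weak_grad(1)]] H1.nrm_scale[OF d, unfolded H1_nrm_eq]
    by (intro * \<phi>; simp)+
  then show "\<exists>\<phi>\<in>test_functions D. L2_norm D (\<lambda>x. \<phi> x - c *\<^sub>R v x) < e \<and> V_norm D (\<lambda>x. \<phi> x - c *\<^sub>R v x) < e"
    by (intro bexI[OF _ test_functions_cmult[OF \<phi>(1), of c]] conjI)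
qed

lemma test_functions_H10: "\<phi> \<in> test_functions D \<Longrightarrow> \<phi> \<in> H10 D"
  unfolding H10_iff using test_functions_H1(1) H1.nrm_scale[OF H1_zero, of 0]
  by (auto simp: H1_nrm_eq L2_norm_def intro!: bexI[of _ \<phi>])

lemma semi_inner_H10:
  assumes c: "c \<in> borel_measurable (lebesgue_on D)" "AE x in lebesgue_on D. 0 \<le> c x \<and> c x \<le> K"
  shows "semi_inner (H10 D) (energy D c)"
  using semi_inner_H1[OF c]
  by (rule semi_inner_subset) (auto intro: H10_subset_H1 test_functions_H10[OF test_functions_zero] H10_add H10_scale[unfolded real_scaleR_def])

sublocale V: semi_inner "H10 D" "energy D (\<lambda>_. 1)"
  by (rule semi_inner_H10[where K = 1]) auto

lemma V_nrm_eq: "V.nrm v = V_norm D v"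
  by (simp add: V.nrm_def V_norm_def energy_def L2_norm_def L2_inner_def power2_norm_eq_inner)

text \<open>Integrating \<open>\<partial>\<^sub>i (x\<^sub>i \<phi>\<^sup>2) = \<phi>\<^sup>2 + 2 x\<^sub>i \<phi> \<partial>\<^sub>i\<phi>\<close> over \<open>D\<close> gives \<open>\<parallel>\<phi>\<parallel>\<^sup>2 \<le> 2 R \<parallel>\<phi>\<parallel> \<parallel>\<partial>\<^sub>i\<phi>\<parallel>\<close>\<close>

lemma Poincare_test_function:
  assumes R: "\<And>x. x \<in> D \<Longrightarrow> norm x \<le> R" "0 \<le> R" and \<phi>: "\<phi> \<in> test_functions D"
  shows "L2_norm D \<phi> \<le> 2 * R * V_norm D \<phi>"
proof -
  obtain i :: 'd where True by simp
  note t = \<phi> pd_test_functions[OF \<phi>, of i]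
  note diff = test_functionsD(4)[OF \<phi>]
  define c where "c x = - 2 * x $ i" for x :: "real^'d"
  have sq: "(\<lambda>x. \<phi> x * \<phi> x) \<in> test_functions D"
    by (rule test_functions_mult[OF \<phi> test_functionsD(1)[OF \<phi>]])
  have F: "(\<lambda>x. x $ i * (\<phi> x * \<phi> x)) \<in> test_functions D"
    by (rule test_functions_mult[OF sq Ck_component])
  have xp: "(\<lambda>x. x $ i) differentiable (at x)" for x :: "real^'d"
    using Ck_differentiable[OF Ck_component] .
  have pdF: "pd i (\<lambda>x. x $ i * (\<phi> x * \<phi> x)) x = \<phi> x * \<phi> x - c x * (\<phi> x * pd i \<phi> x)" for x
    using pd_mult[where i = i and x = x, OF xp differentiable_mult[OF diff diff]]
      pd_mult[where i = i and x = x, OF diff diff]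
    by (simp add: pd_component c_def algebra_simps)
  have cm: "c \<in> borel_measurable (lebesgue_on D)"
    unfolding c_def[abs_def]
    by (rule continuous_imp_measurable_on_sets_lebesgue[OF _ sets_D]) (intro continuous_intros)
  have cb: "AE x in lebesgue_on D. \<bar>c x\<bar> \<le> 2 * R"
    using R(1) order_trans[OF component_le_norm_cart]
    by (intro AE_I2) (force simp: c_def abs_mult)
  have "0 = (LINT x|lebesgue_on D. pd i (\<lambda>x. x $ i * (\<phi> x * \<phi> x)) x)"
    using test_function_lebesgue_on(2)[OF pd_test_functions[OF F] sets_D] integral_pd_test_function[OF F] by simp
  also have "\<dots> = (LINT x|lebesgue_on D. \<phi> x * \<phi> x) - L2_inner D c \<phi> (pd i \<phi>)"
    unfolding pdF L2_inner_def
    using test_function_lebesgue_on(1)[OF sq sets_D]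
      L2_integrable_form[OF test_functions_L2[OF t(1)] test_functions_L2[OF t(2)] cm cb]
    by simp
  finally have "(L2_norm D \<phi>)\<^sup>2 = L2_inner D c \<phi> (pd i \<phi>)"
    unfolding L2_norm_sq_int by (simp add: power2_eq_square)
  also have "\<dots> \<le> 2 * R * (L2_norm D \<phi> * L2_norm D (pd i \<phi>))"
    using L2_norm_form_bound[OF test_functions_L2[OF t(1)] test_functions_L2[OF t(2)] cm cb] R(2) by simp
  finally have "L2_norm D \<phi> * L2_norm D \<phi> \<le> (2 * R * L2_norm D (pd i \<phi>)) * L2_norm D \<phi>"
    by (simp add: power2_eq_square algebra_simps)
  then have "L2_norm D \<phi> \<le> 2 * R * L2_norm D (pd i \<phi>)"
    by (cases "L2_norm D \<phi> = 0") (use R(2) L2_norm_nonneg[of D \<phi>] in \<open>auto simp: less_le mult_le_cancel_right\<close>)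
  also have "L2_norm D (pd i \<phi>) \<le> L2_norm D (classical_grad \<phi>)"
    unfolding L2_norm_def
  proof (intro real_sqrt_le_mono integral_mono L2_square_integrable test_functions_L2 t classical_grad_L2 \<phi>)
    show "(norm (pd i \<phi> x))\<^sup>2 \<le> (norm (classical_grad \<phi> x))\<^sup>2" for x
      using component_le_norm_cart[of "classical_grad \<phi> x" i]
      by (intro power_mono) (simp_all add: classical_grad_def)
  qed
  also have "L2_norm D (classical_grad \<phi>) = V_norm D \<phi>"
    unfolding V_norm_def
    by (intro L2_norm_cong_AE L2_measurable classical_grad_L2 \<phi> H1_weak_grad(2) test_functions_H1(1)
        AE_symmetric[OF test_functions_H1(2)])
  finally show ?thesis using R(2) by (simp add: mult_left_mono)
qed

lemma Poincare:
  obtains C where "0 \<le> C" "\<And>v. v \<in> H10 D \<Longrightarrow> L2_norm D v \<le> C * V_norm D v"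
proof -
  obtain R where R: "\<And>x. x \<in> D \<Longrightarrow> norm x \<le> R" "0 \<le> R"
    using bounded_D bounded_pos by (metis less_imp_le)
  have "L2_norm D v \<le> 2 * R * V_norm D v" if v: "v \<in> H10 D" for v
  proof (rule field_le_epsilon)
    fix e :: real assume e: "e > 0"
    \<comment> \<open>Approximating \<open>v\<close> within \<open>d\<close> in both norms costs \<open>d\<close> on the left and \<open>2 * R * d\<close> on the right.\<close>
    define d where "d = e / (1 + 2 * R)"
    have d: "d > 0" "d * (1 + 2 * R) = e" using e R(2) by (auto simp: d_def)
    obtain \<phi> where \<phi>: "\<phi> \<in> test_functions D" "L2_norm D (\<lambda>x. \<phi> x - v x) < d" "V_norm D (\<lambda>x. \<phi> x - v x) < d"
      using v d(1) unfolding H10_iff by blast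
    note H = test_functions_H1(1)[OF \<phi>(1)] H10_subset_H1[OF v]
    have "L2_norm D v \<le> L2_norm D \<phi> + d"
      using L2.nrm_diff_le[OF H[THEN H1_weak_grad(1)]] \<phi>(2) unfolding L2_nrm_eq by linarith
    also have "L2_norm D \<phi> \<le> 2 * R * V_norm D \<phi>" by (rule Poincare_test_function[OF R \<phi>(1)])
    also have "2 * R * V_norm D \<phi> \<le> 2 * R * (V_norm D v + d)"
      using H1.nrm_diff_le[OF H] \<phi>(3) R(2) unfolding H1_nrm_eq by (intro mult_left_mono) linarith+
    finally show "L2_norm D v \<le> 2 * R * V_norm D v + e"
      using d(2) by (simp add: algebra_simps)
  qed
  then show ?thesis using that[of "2 * R"] R(2) by simp
qed

text \<open>The gradients of a Cauchy sequence converge in \<open>L\<^sup>2\<close>, and by the Poincare inequality so do the functions.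
  The defining identity of weak gradients passes to these limits.\<close>

theorem H10_complete: "V.complete_form"
  unfolding V.complete_form_def
proof (intro allI impI)
  fix X :: "nat \<Rightarrow> real^'d \<Rightarrow> real" assume X: "\<forall>n. X n \<in> H10 D"
    and Cauchy: "\<forall>e>0. \<exists>N. \<forall>m\<ge>N. \<forall>n\<ge>N. V.nrm (\<lambda>x. X m x - X n x) < e"
  note H = H10_subset_H1[OF X[rule_format]]
  note L = H1_weak_grad(1)[OF H] and G = H1_weak_grad(2)[OF H]
  have grad_diff: "V_norm D (\<lambda>x. v x - w x) = L2_norm D (\<lambda>x. weak_grad D v x - weak_grad D w x)"
    if v: "v \<in> H1 D" and w: "w \<in> H1 D" for v w
    unfolding V_norm_def
  proof (rule L2_norm_cong_AE)
    show "AE x in lebesgue_on D. weak_grad D (\<lambda>x. v x - w x) x = weak_grad D v x - weak_grad D w x"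
      using H1_add(2)[OF H1.diff_mem[OF v w] w] by eventually_elim (simp add: algebra_simps)
  qed (intro L2_measurable H1_weak_grad(2) H1.diff_mem v w L2_diff)+
  obtain C where C: "0 \<le> C" "\<And>v. v \<in> H10 D \<Longrightarrow> L2_norm D v \<le> C * V_norm D v"
    using Poincare by blast
  have "\<exists>g\<in>L2 D. (\<lambda>n. L2_norm D (\<lambda>x. weak_grad D (X n) x - g x)) \<longlonglongrightarrow> 0"
    using Cauchy unfolding V_nrm_eq grad_diff[OF H H] by (intro L2_complete finite_measure_D G) blast
  then obtain g where g: "g \<in> L2 D" "(\<lambda>n. L2_norm D (\<lambda>x. weak_grad D (X n) x - g x)) \<longlonglongrightarrow> 0"
    by blast
  have "\<exists>h\<in>L2 D. (\<lambda>n. L2_norm D (\<lambda>x. X n x - h x)) \<longlonglongrightarrow> 0"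
  proof (intro L2_complete finite_measure_D L)
    fix e :: real assume "e > 0"
    then have "e / (C + 1) > 0" using C(1) by simp
    then obtain N where N: "\<And>m n. m \<ge> N \<Longrightarrow> n \<ge> N \<Longrightarrow> V_norm D (\<lambda>x. X m x - X n x) < e / (C + 1)"
      using Cauchy unfolding V_nrm_eq by blast
    have "L2_norm D (\<lambda>x. X m x - X n x) < e" if "m \<ge> N" "n \<ge> N" for m n
    proof -
      have "L2_norm D (\<lambda>x. X m x - X n x) \<le> C * V_norm D (\<lambda>x. X m x - X n x)"
        using X by (intro C(2) V.diff_mem) auto
      also have "\<dots> \<le> (C + 1) * V_norm D (\<lambda>x. X m x - X n x)"
        by (intro mult_right_mono) auto
      also have "\<dots> < e" using N[OF that] C(1) by (simp add: field_simps)
      finally show ?thesis .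
    qed
    then show "\<exists>N. \<forall>m\<ge>N. \<forall>n\<ge>N. L2_norm D (\<lambda>x. X m x - X n x) < e" by blast
  qed
  then obtain h where h: "h \<in> L2 D" "(\<lambda>n. L2_norm D (\<lambda>x. X n x - h x)) \<longlonglongrightarrow> 0" by blast
  have wg: "has_weak_gradient D h g"
    unfolding has_weak_gradient_def
  proof (intro ballI allI)
    fix \<phi> i assume t: "\<phi> \<in> test_functions D"
    have 1: "(\<lambda>n. LINT x|lebesgue_on D. X n x * pd i \<phi> x) \<longlonglongrightarrow> (LINT x|lebesgue_on D. h x * pd i \<phi> x)"
      using L2.form_tendsto[OF L h(1) test_functions_L2[OF pd_test_functions[OF t, of i]]] h(2)
      unfolding L2_nrm_eq by (simp add: L2_inner_def)
    have 2: "(\<lambda>n. LINT x|lebesgue_on D. weak_grad D (X n) x $ i * \<phi> x)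
        \<longlonglongrightarrow> (LINT x|lebesgue_on D. g x $ i * \<phi> x)"
      using L2.form_tendsto[OF G g(1) L2_times_axis[OF test_functions_L2[OF t], of i]] g(2)
      unfolding L2_nrm_eq by (simp add: L2_inner_def mult.commute flip: cart_eq_inner_axis)
    have "(LINT x|lebesgue_on D. X n x * pd i \<phi> x) = - (LINT x|lebesgue_on D. weak_grad D (X n) x $ i * \<phi> x)" for n
      using bspec[OF H1_weak_grad(3)[OF H[of n], unfolded has_weak_gradient_def] t, THEN spec[of _ i]] by simp
    then show "(LINT x|lebesgue_on D. h x * pd i \<phi> x) = - (LINT x|lebesgue_on D. g x $ i * \<phi> x)"
      using LIMSEQ_unique[OF 1] tendsto_minus[OF 2] by simp
  qed
  note hH = H1I[OF h(1) g(1) wg]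
  have norm_eq: "V_norm D (\<lambda>x. X n x - h x) = L2_norm D (\<lambda>x. weak_grad D (X n) x - g x)" for n
    unfolding grad_diff[OF H hH(1)]
  proof (rule L2_norm_cong_AE)
    show "AE x in lebesgue_on D. weak_grad D (X n) x - weak_grad D h x = weak_grad D (X n) x - g x"
      using hH(2) by eventually_elim simp
  qed (intro L2_measurable L2_diff G g(1) H1_weak_grad(2) hH(1))+
  have lim: "(\<lambda>n. V_norm D (\<lambda>x. X n x - h x)) \<longlonglongrightarrow> 0" unfolding norm_eq by (rule g(2))
  have "h \<in> H10 D"
    unfolding H10_iff
  proof (intro conjI allI impI)
    show "h \<in> H1 D" by (rule hH(1))
    fix e :: real assume "e > 0"
    then have e: "e / 2 > 0" by simp
    have "\<forall>\<^sub>F n in sequentially. V_norm D (\<lambda>x. X n x - h x) < e/2 \<and> L2_norm D (\<lambda>x. X n x - h x) < e/2"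
      by (intro eventually_conj order_tendstoD(2)[OF lim e] order_tendstoD(2)[OF h(2) e])
    then obtain n where n: "V_norm D (\<lambda>x. X n x - h x) < e/2" "L2_norm D (\<lambda>x. X n x - h x) < e/2"
      using eventually_happens by fastforce
    obtain \<phi> where \<phi>: "\<phi> \<in> test_functions D" "L2_norm D (\<lambda>x. \<phi> x - X n x) < e/2" "V_norm D (\<lambda>x. \<phi> x - X n x) < e/2"
      using X e unfolding H10_iff by blast
    note \<phi>H = test_functions_H1(1)[OF \<phi>(1)]
    have "L2_norm D (\<lambda>x. \<phi> x - h x) < e"
      using L2_norm_triangle_diff[OF H1_weak_grad(1)[OF \<phi>H] L h(1), of n] \<phi>(2) n(2) by linarith
    moreover have "V_norm D (\<lambda>x. \<phi> x - h x) < e"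
      using V_norm_triangle_diff[OF \<phi>H H hH(1), of n] \<phi>(3) n(1) by linarith
    ultimately show "\<exists>\<phi>\<in>test_functions D. L2_norm D (\<lambda>x. \<phi> x - h x) < e \<and> V_norm D (\<lambda>x. \<phi> x - h x) < e"
      using \<phi>(1) by blast
  qed
  then show "\<exists>u\<in>H10 D. (\<lambda>n. V.nrm (\<lambda>x. X n x - u x)) \<longlonglongrightarrow> 0"
    using lim unfolding V_nrm_eq by blast
qed

end

section \<open>Energy forms with varying coefficients\<close>

text \<open>Boundedness here only serves integrability, so the bound is not a parameter; quantitative estimates
  name theirs.\<close>

definition bounded_coeff :: "(real^'d) set \<Rightarrow> (real^'d \<Rightarrow> real) \<Rightarrow> bool" where
  "bounded_coeff D c \<longleftrightarrow> c \<in> borel_measurable (lebesgue_on D) \<and> (\<exists>K. AE x in lebesgue_on D. \<bar>c x\<bar> \<le> K)"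

context bounded_domain
begin

lemma energy_integrable:
  assumes "bounded_coeff D c" "u \<in> H10 D" "v \<in> H10 D"
  shows "integrable (lebesgue_on D) (\<lambda>x. c x * (weak_grad D u x \<bullet> weak_grad D v x))"
  using assms L2_integrable_form[OF H1_weak_grad(2)[OF H10_subset_H1] H1_weak_grad(2)[OF H10_subset_H1]]
  unfolding bounded_coeff_def by blast

lemma energy_add:
  assumes "bounded_coeff D c" "u \<in> H10 D" "v \<in> H10 D" "w \<in> H10 D"
  shows "energy D c (\<lambda>x. u x + v x) w = energy D c u w + energy D c v w"
  using assms energy_add_left[OF H10_subset_H1 H10_subset_H1 H10_subset_H1] unfolding bounded_coeff_def by blast

lemma energy_scale:
  assumes "bounded_coeff D c" "u \<in> H10 D" "w \<in> H10 D"
  shows "energy D c (\<lambda>x. r *\<^sub>R u x) w = r * energy D c u w"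
  using assms energy_scale_left[OF H10_subset_H1 H10_subset_H1] unfolding bounded_coeff_def by blast

lemma energy_diff:
  assumes "bounded_coeff D c" "u \<in> H10 D" "v \<in> H10 D" "w \<in> H10 D"
  shows "energy D c (\<lambda>x. u x - v x) w = energy D c u w - energy D c v w"
  using energy_add[OF assms(1,2) V.scale_mem[OF assms(3), of "-1"] assms(4)]
    energy_scale[OF assms(1,3,4), of "-1"] by simp

lemma energy_bound:
  assumes "c \<in> borel_measurable (lebesgue_on D)" "AE x in lebesgue_on D. \<bar>c x\<bar> \<le> K" "0 \<le> K"
    and "u \<in> H10 D" "v \<in> H10 D"
  shows "\<bar>energy D c u v\<bar> \<le> K * (V_norm D u * V_norm D v)"
  unfolding energy_def V_norm_def
  by (rule L2_norm_form_bound[OF H1_weak_grad(2)[OF H10_subset_H1[OF assms(4)]]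
        H1_weak_grad(2)[OF H10_subset_H1[OF assms(5)]] assms(1-3)])

lemma energy_coeff_mono:
  assumes "bounded_coeff D c" "bounded_coeff D c'" "AE x in lebesgue_on D. c x \<le> c' x" "u \<in> H10 D"
  shows "energy D c u u \<le> energy D c' u u"
  unfolding energy_def L2_inner_def
proof (rule integral_mono_AE)
  show "AE x in lebesgue_on D. c x * (weak_grad D u x \<bullet> weak_grad D u x) \<le> c' x * (weak_grad D u x \<bullet> weak_grad D u x)"
    using assms(3) by eventually_elim (rule mult_right_mono, auto)
qed (intro energy_integrable assms)+

lemma energy_coeff_sum:
  assumes "finite J" "\<And>j. j \<in> J \<Longrightarrow> bounded_coeff D (c j)" "u \<in> H10 D" "v \<in> H10 D"
  shows "energy D (\<lambda>x. \<Sum>j\<in>J. c j x) u v = (\<Sum>j\<in>J. energy D (c j) u v)"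
  unfolding energy_def L2_inner_def sum_distrib_right
  by (rule Bochner_Integration.integral_sum) (intro energy_integrable assms)

lemma energy_coeff_scale: "energy D (\<lambda>x. r * c x) u v = r * energy D c u v"
  by (simp add: energy_def L2_inner_def mult.assoc)

lemma energy_one: "energy D (\<lambda>_. 1) u u = (V_norm D u)\<^sup>2"
  using V_nrm_eq[of u] by (simp add: V_norm_def energy_def L2_norm_sq_int L2_inner_def power2_norm_eq_inner)

lemma bounded_coeff_cmult:
  assumes "bounded_coeff D c"
  shows "bounded_coeff D (\<lambda>x. r * c x)"
proof -
  obtain K where K: "c \<in> borel_measurable (lebesgue_on D)" "AE x in lebesgue_on D. \<bar>c x\<bar> \<le> K"
    using assms unfolding bounded_coeff_def by blast
  have "AE x in lebesgue_on D. \<bar>r * c x\<bar> \<le> \<bar>r\<bar> * K"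
    using K(2) by eventually_elim (auto simp: abs_mult intro: mult_left_mono)
  moreover have "(\<lambda>x. r * c x) \<in> borel_measurable (lebesgue_on D)" using K(1) by measurable
  ultimately show ?thesis unfolding bounded_coeff_def by blast
qed

lemma bounded_coeff_sum:
  assumes "finite J" "\<And>j. j \<in> J \<Longrightarrow> bounded_coeff D (c j)"
  shows "bounded_coeff D (\<lambda>x. \<Sum>j\<in>J. c j x)"
  using assms
proof (induction J rule: finite_induct)
  case empty
  show ?case by (auto simp: bounded_coeff_def)
next
  case (insert j J)
  obtain K where K: "c j \<in> borel_measurable (lebesgue_on D)" "AE x in lebesgue_on D. \<bar>c j x\<bar> \<le> K"
    using insert.prems unfolding bounded_coeff_def by blast
  obtain L where L: "(\<lambda>x. \<Sum>j\<in>J. c j x) \<in> borel_measurable (lebesgue_on D)" "AE x in lebesgue_on D. \<bar>\<Sum>j\<in>J. c j x\<bar> \<le> L"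
    using insert.IH insert.prems unfolding bounded_coeff_def by blast
  have "AE x in lebesgue_on D. \<bar>c j x + (\<Sum>j\<in>J. c j x)\<bar> \<le> K + L"
    using K(2) L(2) by eventually_elim linarith
  moreover have "(\<lambda>x. c j x + (\<Sum>j\<in>J. c j x)) \<in> borel_measurable (lebesgue_on D)"
    using K(1) L(1) by measurable
  ultimately show ?case using insert.hyps unfolding bounded_coeff_def by auto
qed

lemma dual_norm_upper:
  assumes f: "f \<in> V_dual D" and v: "v \<in> H10 D" "V_norm D v \<le> 1"
  shows "\<bar>f v\<bar> \<le> dual_norm D f"
  unfolding dual_norm_def
proof (rule cSup_upper)
  obtain C where C: "\<And>v. v \<in> H10 D \<Longrightarrow> \<bar>f v\<bar> \<le> C * V_norm D v"
    using f unfolding V_dual_def by blast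
  show "\<bar>f v\<bar> \<in> {\<bar>f v\<bar> | v. v \<in> H10 D \<and> V_norm D v \<le> 1}" using v by auto
  show "bdd_above {\<bar>f v\<bar> | v. v \<in> H10 D \<and> V_norm D v \<le> 1}"
  proof (rule bdd_aboveI)
    fix r assume "r \<in> {\<bar>f v\<bar> | v. v \<in> H10 D \<and> V_norm D v \<le> 1}"
    then obtain v where v: "v \<in> H10 D" "V_norm D v \<le> 1" "r = \<bar>f v\<bar>" by blast
    have "r \<le> C * V_norm D v" using C[OF v(1)] v(3) by simp
    also have "\<dots> \<le> \<bar>C\<bar> * 1" using v(2) by (intro mult_mono) auto
    finally show "r \<le> \<bar>C\<bar>" by simp
  qed
qed

lemma V_norm_zero: "V_norm D (\<lambda>x. 0) = 0"
  using V.nrm_scale[OF V.zero_mem, of 0] by (simp add: V_nrm_eq)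

lemma dual_norm_nonneg: "f \<in> V_dual D \<Longrightarrow> 0 \<le> dual_norm D f"
  using dual_norm_upper[OF _ V.zero_mem] V_norm_zero by (metis abs_ge_zero order_trans zero_le_one)

lemma dual_norm_bound:
  assumes f: "f \<in> V_dual D" and v: "v \<in> H10 D"
  shows "\<bar>f v\<bar> \<le> dual_norm D f * V_norm D v"
proof -
  obtain C where C: "\<And>v. v \<in> H10 D \<Longrightarrow> \<bar>f v\<bar> \<le> C * V_norm D v"
    using f unfolding V_dual_def by blast
  have f_scale: "f (\<lambda>x. c * v x) = c * f v" for c
    using f v unfolding V_dual_def by blast
  show ?thesis
  proof (cases "V_norm D v = 0")
    case True
    then show ?thesis using C[OF v] by simp
  next
    case False
    then have pos: "V_norm D v > 0" using V_norm_nonneg[of v] by linarith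
    let ?w = "\<lambda>x. (1 / V_norm D v) *\<^sub>R v x"
    have w: "?w \<in> H10 D" "V_norm D ?w = 1"
      using V.scale_mem[OF v, of "1 / V_norm D v"] V.nrm_scale[OF v, of "1 / V_norm D v"] pos
      by (auto simp: V_nrm_eq)
    have "\<bar>f ?w\<bar> \<le> dual_norm D f" by (intro dual_norm_upper f w order.refl[THEN ord_eq_le_trans[OF w(2)]])
    then have "\<bar>f v\<bar> / V_norm D v \<le> dual_norm D f"
      using f_scale[of "1 / V_norm D v"] pos by (simp add: abs_mult)
    then show ?thesis using pos by (simp add: field_simps)
  qed
qed

end

section \<open>Coercive diffusion forms\<close>

locale parametric_diffusion = bounded_domain D for D :: "(real^'d) set" +
  fixes a0 :: "real^'d \<Rightarrow> real" and \<psi> :: "nat \<Rightarrow> real^'d \<Rightarrow> real"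
    and a0min a0max \<kappa>bar :: real and f :: "(real^'d \<Rightarrow> real) \<Rightarrow> real"
    and u :: "(nat \<Rightarrow> real) \<Rightarrow> real^'d \<Rightarrow> real"
  assumes a0_meas: "a0 \<in> borel_measurable (lebesgue_on D)"
    and a0min_pos: "0 < a0min"
    and a0_bounds: "AE x in lebesgue_on D. a0min \<le> a0 x \<and> a0 x \<le> a0max"
    and psi_meas: "\<And>j. \<psi> j \<in> borel_measurable (lebesgue_on D)"
    and kbar: "0 < \<kappa>bar" "\<kappa>bar < 1"
      "Linf_norm D (\<lambda>x. \<Sum>j. ennreal (\<bar>\<psi> j x\<bar> / (2 * a0 x))) \<le> ennreal \<kappa>bar"
    and f: "f \<in> V_dual D"
    and u: "\<And>y. y \<in> param_U \<Longrightarrow> weak_solution D (diffusion a0 \<psi> y) f (u y)"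
begin

abbreviation A :: "(nat \<Rightarrow> real) \<Rightarrow> (real^'d \<Rightarrow> real) \<Rightarrow> (real^'d \<Rightarrow> real) \<Rightarrow> real" where
  "A y \<equiv> energy D (diffusion a0 \<psi> y)"

abbreviation B :: "nat \<Rightarrow> (real^'d \<Rightarrow> real) \<Rightarrow> (real^'d \<Rightarrow> real) \<Rightarrow> real" where
  "B j \<equiv> energy D (\<psi> j)"

definition \<beta> :: real where "\<beta> = 2 * \<kappa>bar * \<bar>a0max\<bar>"
definition \<alpha> :: real where "\<alpha> = (1 - \<kappa>bar) * a0min"

lemma alpha_pos: "\<alpha> > 0" and beta_nonneg: "\<beta> \<ge> 0"
  using kbar a0min_pos by (simp_all add: \<alpha>_def \<beta>_def)

text \<open>The essential supremum is taken of a series in \<^typ>\<open>ennreal\<close>; its finiteness is what makes the real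
  series that define the diffusion coefficient absolutely convergent.\<close>

lemma psi_summable:
  "AE x in lebesgue_on D. summable (\<lambda>j. \<bar>\<psi> j x\<bar>) \<and> (\<Sum>j. \<bar>\<psi> j x\<bar>) \<le> 2 * \<kappa>bar * a0 x"
proof -
  have "AE x in lebesgue_on D. (\<Sum>j. ennreal (\<bar>\<psi> j x\<bar> / (2 * a0 x)))
      \<le> Linf_norm D (\<lambda>x. \<Sum>j. ennreal (\<bar>\<psi> j x\<bar> / (2 * a0 x)))"
    unfolding Linf_norm_def by (rule esssup_AE)
  then show ?thesis
    using a0_bounds
  proof eventually_elim
    case (elim x)
    then have a0: "a0 x > 0" using a0min_pos by linarith
    have le: "(\<Sum>j. ennreal (\<bar>\<psi> j x\<bar> / (2 * a0 x))) \<le> ennreal \<kappa>bar"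
      using elim(1) kbar(3) by (rule order_trans)
    have nn: "0 \<le> \<bar>\<psi> j x\<bar> / (2 * a0 x)" for j using a0 by simp
    have "(\<Sum>j. ennreal (\<bar>\<psi> j x\<bar> / (2 * a0 x))) \<noteq> top" using le by (auto simp: top_unique)
    then have s: "summable (\<lambda>j. \<bar>\<psi> j x\<bar> / (2 * a0 x))" by (rule summable_suminf_not_top[OF nn])
    have "ennreal (\<Sum>j. \<bar>\<psi> j x\<bar> / (2 * a0 x)) \<le> ennreal \<kappa>bar"
      using le suminf_ennreal2[OF nn s] by simp
    then have le': "(\<Sum>j. \<bar>\<psi> j x\<bar> / (2 * a0 x)) \<le> \<kappa>bar"
      using kbar(1) by (simp add: ennreal_le_iff)
    have eq: "\<bar>\<psi> j x\<bar> = 2 * a0 x * (\<bar>\<psi> j x\<bar> / (2 * a0 x))" for j using a0 by simp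
    have "summable (\<lambda>j. 2 * a0 x * (\<bar>\<psi> j x\<bar> / (2 * a0 x)))" by (rule summable_mult[OF s])
    then have s': "summable (\<lambda>j. \<bar>\<psi> j x\<bar>)" using eq by simp
    have "(\<Sum>j. \<bar>\<psi> j x\<bar>) = 2 * a0 x * (\<Sum>j. \<bar>\<psi> j x\<bar> / (2 * a0 x))"
      using suminf_mult[OF s, of "2 * a0 x"] eq by simp
    also have "\<dots> \<le> 2 * a0 x * \<kappa>bar" using le' a0 by (intro mult_left_mono) auto
    finally show ?case using s' by (simp add: algebra_simps)
  qed
qed

lemma psi_bound: "AE x in lebesgue_on D. \<bar>\<psi> j x\<bar> \<le> \<beta>"
  using psi_summable a0_bounds
proof eventually_elim
  case (elim x)
  have "\<bar>\<psi> j x\<bar> \<le> (\<Sum>j. \<bar>\<psi> j x\<bar>)" using sum_le_suminf[of "\<lambda>j. \<bar>\<psi> j x\<bar>" "{j}"] elim by simp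
  also have "\<dots> \<le> 2 * \<kappa>bar * a0 x" using elim by blast
  also have "\<dots> \<le> \<beta>" unfolding \<beta>_def using elim kbar(1) by (intro mult_left_mono) auto
  finally show ?case .
qed

lemma bounded_coeff_psi: "bounded_coeff D (\<psi> j)"
  unfolding bounded_coeff_def using psi_meas psi_bound by blast

lemma B_bound: "v \<in> H10 D \<Longrightarrow> w \<in> H10 D \<Longrightarrow> \<bar>B j v w\<bar> \<le> \<beta> * (V_norm D v * V_norm D w)"
  by (rule energy_bound[OF psi_meas psi_bound beta_nonneg])

lemma diffusion_bounds:
  assumes "y \<in> param_U"
  shows "AE x in lebesgue_on D. (1 - \<kappa>bar) * a0 x \<le> diffusion a0 \<psi> y x \<and> diffusion a0 \<psi> y x \<le> 2 * a0 x"
  using psi_summable a0_bounds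
proof eventually_elim
  case (elim x)
  then have a0: "a0 x > 0" using a0min_pos by linarith
  have s: "summable (\<lambda>j. \<bar>\<psi> j x\<bar> / 2)" using elim by (intro summable_divide) blast
  have y: "\<bar>y j\<bar> \<le> 1/2" for j
  proof -
    have "y j \<in> {-1/2..1/2}" using assms unfolding param_U_def by blast
    then show ?thesis by auto
  qed
  have le: "\<bar>y j * \<psi> j x\<bar> \<le> \<bar>\<psi> j x\<bar> / 2" for j
    using mult_right_mono[OF y[of j], of "\<bar>\<psi> j x\<bar>"] by (simp add: abs_mult)
  have s1: "summable (\<lambda>j. \<bar>y j * \<psi> j x\<bar>)"
    by (rule summable_comparison_test'[OF s]) (use le in auto)
  have "\<bar>\<Sum>j. y j * \<psi> j x\<bar> \<le> (\<Sum>j. \<bar>y j * \<psi> j x\<bar>)" by (rule summable_rabs[OF s1])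
  also have "\<dots> \<le> (\<Sum>j. \<bar>\<psi> j x\<bar> / 2)" by (rule suminf_le[OF le s1 s])
  also have "\<dots> = (\<Sum>j. \<bar>\<psi> j x\<bar>) / 2" using elim by (intro suminf_divide) blast
  also have "\<dots> \<le> \<kappa>bar * a0 x" using elim by simp
  finally have m: "\<bar>\<Sum>j. y j * \<psi> j x\<bar> \<le> \<kappa>bar * a0 x" .
  moreover have "\<kappa>bar * a0 x \<le> a0 x" using kbar a0 by simp
  ultimately show ?case unfolding diffusion_def by (auto simp: algebra_simps)
qed

lemma diffusion_measurable: "diffusion a0 \<psi> y \<in> borel_measurable (lebesgue_on D)"
  unfolding diffusion_def[abs_def] using a0_meas psi_meas by measurable

lemma diffusion_nonneg_bounded:
  assumes "y \<in> param_U"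
  shows "AE x in lebesgue_on D. 0 \<le> diffusion a0 \<psi> y x \<and> diffusion a0 \<psi> y x \<le> 2 * \<bar>a0max\<bar>"
  using diffusion_bounds[OF assms] a0_bounds
proof eventually_elim
  case (elim x)
  then have "0 \<le> (1 - \<kappa>bar) * a0 x" using kbar a0min_pos by (intro mult_nonneg_nonneg) auto
  then show ?case using elim by linarith
qed

lemma bounded_coeff_diffusion:
  assumes "y \<in> param_U"
  shows "bounded_coeff D (diffusion a0 \<psi> y)"
proof -
  have "AE x in lebesgue_on D. \<bar>diffusion a0 \<psi> y x\<bar> \<le> 2 * \<bar>a0max\<bar>"
    using diffusion_nonneg_bounded[OF assms] by eventually_elim auto
  then show ?thesis unfolding bounded_coeff_def using diffusion_measurable by blast
qed

lemma bounded_coeff_a0: "bounded_coeff D a0"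
proof -
  have "AE x in lebesgue_on D. \<bar>a0 x\<bar> \<le> a0max"
    using a0_bounds by eventually_elim (use a0min_pos in auto)
  then show ?thesis unfolding bounded_coeff_def using a0_meas by blast
qed

lemma bounded_coeff_const: "bounded_coeff D (\<lambda>_. c)"
  by (auto simp: bounded_coeff_def)

lemma A_ge_energy_a0:
  assumes y: "y \<in> param_U" and v: "v \<in> H10 D"
  shows "(1 - \<kappa>bar) * energy D a0 v v \<le> A y v v"
  unfolding energy_coeff_scale[symmetric]
  using diffusion_bounds[OF y]
  by (intro energy_coeff_mono bounded_coeff_cmult bounded_coeff_a0 bounded_coeff_diffusion y v)
    (auto elim: eventually_mono)

lemma energy_a0_ge:
  assumes v: "v \<in> H10 D"
  shows "a0min * (V_norm D v)\<^sup>2 \<le> energy D a0 v v"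
  unfolding energy_one[symmetric] energy_coeff_scale[symmetric]
  using a0_bounds
  by (intro energy_coeff_mono bounded_coeff_cmult bounded_coeff_a0 bounded_coeff_const v)
    (auto elim: eventually_mono)

lemma A_coercive:
  assumes y: "y \<in> param_U" and v: "v \<in> H10 D"
  shows "\<alpha> * (V_norm D v)\<^sup>2 \<le> A y v v"
proof -
  have "\<alpha> * (V_norm D v)\<^sup>2 = (1 - \<kappa>bar) * (a0min * (V_norm D v)\<^sup>2)" by (simp add: \<alpha>_def)
  also have "\<dots> \<le> (1 - \<kappa>bar) * energy D a0 v v"
    using energy_a0_ge[OF v] kbar by (intro mult_left_mono) auto
  also have "\<dots> \<le> A y v v" by (rule A_ge_energy_a0[OF assms])
  finally show ?thesis .
qed

text \<open>The way in which all Lipschitz and difference quotient bounds are obtained: testing an equation for \<open>v\<close>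
  with \<open>v\<close> itself gives the premise.\<close>

lemma coercive_bound:
  assumes y: "y \<in> param_U" and v: "v \<in> H10 D" and le: "A y v v \<le> M * V_norm D v" and M: "0 \<le> M"
  shows "V_norm D v \<le> M / \<alpha>"
proof (cases "V_norm D v = 0")
  case True
  then show ?thesis using M alpha_pos by simp
next
  case False
  then have pos: "V_norm D v > 0" using V_norm_nonneg[of v] by linarith
  have "(\<alpha> * V_norm D v) * V_norm D v \<le> M * V_norm D v"
    using A_coercive[OF y v] le by (simp add: power2_eq_square mult.assoc)
  then have "\<alpha> * V_norm D v \<le> M" using pos by simp
  then show ?thesis using alpha_pos by (simp add: field_simps)
qed

text \<open>Differences of equations at two parameters become explicit in \<open>t\<close> by this identity. It holds
  because the series for the coefficient converges absolutely almost everywhere.\<close>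

lemma A_shift:
  assumes y: "y \<in> param_U" and y': "y(i := y i + t) \<in> param_U" and v: "v \<in> H10 D" and w: "w \<in> H10 D"
  shows "A (y(i := y i + t)) v w = A y v w + t * B i v w"
proof -
  have "A (y(i := y i + t)) v w = (LINT x|lebesgue_on D. diffusion a0 \<psi> y x * (weak_grad D v x \<bullet> weak_grad D w x)
      + t * (\<psi> i x * (weak_grad D v x \<bullet> weak_grad D w x)))"
    unfolding energy_def L2_inner_def
  proof (rule integral_cong_AE)
    note int = energy_integrable[OF bounded_coeff_diffusion[OF y'] v w]
      energy_integrable[OF bounded_coeff_diffusion[OF y] v w] energy_integrable[OF bounded_coeff_psi v w, of i]
    show "(\<lambda>x. diffusion a0 \<psi> (y(i := y i + t)) x * (weak_grad D v x \<bullet> weak_grad D w x)) \<in> borel_measurable (lebesgue_on D)"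
      by (rule borel_measurable_integrable[OF int(1)])
    show "(\<lambda>x. diffusion a0 \<psi> y x * (weak_grad D v x \<bullet> weak_grad D w x)
      + t * (\<psi> i x * (weak_grad D v x \<bullet> weak_grad D w x))) \<in> borel_measurable (lebesgue_on D)"
      using int(2,3)[THEN borel_measurable_integrable] by measurable
    show "AE x in lebesgue_on D. diffusion a0 \<psi> (y(i := y i + t)) x * (weak_grad D v x \<bullet> weak_grad D w x)
        = diffusion a0 \<psi> y x * (weak_grad D v x \<bullet> weak_grad D w x) + t * (\<psi> i x * (weak_grad D v x \<bullet> weak_grad D w x))"
      using psi_summable
    proof eventually_elim
      case (elim x)
      have yb: "\<bar>y j\<bar> \<le> 1" for j
      proof -
        have "y j \<in> {-1/2..1/2}" using y unfolding param_U_def by blast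
        then show ?thesis by auto
      qed
      have s: "summable (\<lambda>j. y j * \<psi> j x)"
      proof (rule summable_comparison_test'[where N = 0])
        show "summable (\<lambda>j. \<bar>\<psi> j x\<bar>)" using elim by blast
        show "norm (y j * \<psi> j x) \<le> \<bar>\<psi> j x\<bar>" for j
          using mult_right_mono[OF yb[of j], of "\<bar>\<psi> j x\<bar>"] by (simp add: abs_mult)
      qed
      have one: "(\<lambda>j. if j = i then t * \<psi> j x else 0) sums (t * \<psi> i x)" by (rule sums_single)
      have "(\<lambda>j. y j * \<psi> j x + (if j = i then t * \<psi> j x else 0)) sums ((\<Sum>j. y j * \<psi> j x) + t * \<psi> i x)"
        by (rule sums_add[OF summable_sums[OF s] one])
      moreover have "(\<lambda>j. y j * \<psi> j x + (if j = i then t * \<psi> j x else 0)) = (\<lambda>j. (y(i := y i + t)) j * \<psi> j x)"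
        by (auto simp: algebra_simps)
      ultimately have "(\<Sum>j. (y(i := y i + t)) j * \<psi> j x) = (\<Sum>j. y j * \<psi> j x) + t * \<psi> i x"
        using sums_unique by force
      then show ?case unfolding diffusion_def by (simp only:) (simp add: algebra_simps)
    qed
  qed
  also have "\<dots> = A y v w + t * B i v w"
    unfolding energy_def L2_inner_def
    using energy_integrable[OF bounded_coeff_diffusion[OF y] v w] energy_integrable[OF bounded_coeff_psi v w, of i]
    by simp
  finally show ?thesis .
qed

text \<open>\<open>A y\<close> is symmetric, so the Riesz theorem applies to its energy norm, which is equivalent to the norm of
  \<open>V\<close> and therefore complete.\<close>

theorem Lax_Milgram:
  assumes y: "y \<in> param_U"
    and l_add: "\<And>v w. v \<in> H10 D \<Longrightarrow> w \<in> H10 D \<Longrightarrow> l (\<lambda>x. v x + w x) = l v + l w"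
    and l_scale: "\<And>c v. v \<in> H10 D \<Longrightarrow> l (\<lambda>x. c *\<^sub>R v x) = c * l v"
    and l_bound: "\<And>v. v \<in> H10 D \<Longrightarrow> \<bar>l v\<bar> \<le> C * V_norm D v"
  shows "\<exists>w\<in>H10 D. \<forall>v\<in>H10 D. A y w v = l v"
proof -
  interpret Ay: semi_inner "H10 D" "A y"
    by (rule semi_inner_H10[OF diffusion_measurable diffusion_nonneg_bounded[OF y]])
  let ?K = "sqrt (2 * \<bar>a0max\<bar>)"
  have upper: "Ay.nrm v \<le> ?K * V_norm D v" if v: "v \<in> H10 D" for v
  proof -
    have "A y v v \<le> 2 * \<bar>a0max\<bar> * (V_norm D v)\<^sup>2"
      using diffusion_nonneg_bounded[OF y]
      unfolding energy_one[symmetric] energy_coeff_scale[symmetric]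
      by (intro energy_coeff_mono bounded_coeff_cmult bounded_coeff_diffusion bounded_coeff_const y v)
        (auto elim: eventually_mono)
    then have "sqrt (A y v v) \<le> sqrt (2 * \<bar>a0max\<bar> * (V_norm D v)\<^sup>2)" by (rule real_sqrt_le_mono)
    then show ?thesis by (simp add: Ay.nrm_def real_sqrt_mult)
  qed
  have lower: "sqrt \<alpha> * V_norm D v \<le> Ay.nrm v" if v: "v \<in> H10 D" for v
    using real_sqrt_le_mono[OF A_coercive[OF y v]] by (simp add: Ay.nrm_def real_sqrt_mult)
  have sa: "sqrt \<alpha> > 0" using alpha_pos by simp
  show ?thesis
  proof (rule Ay.Riesz_representation[where C = "\<bar>C\<bar> / sqrt \<alpha>"])
    show "Ay.complete_form"
      unfolding Ay.complete_form_def
    proof (intro allI impI)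
      fix X :: "nat \<Rightarrow> real^'d \<Rightarrow> real"
      assume X: "\<forall>n. X n \<in> H10 D" and Cauchy: "\<forall>e>0. \<exists>N. \<forall>m\<ge>N. \<forall>n\<ge>N. Ay.nrm (\<lambda>x. X m x - X n x) < e"
      have "\<exists>u\<in>H10 D. (\<lambda>n. V.nrm (\<lambda>x. X n x - u x)) \<longlonglongrightarrow> 0"
      proof (rule H10_complete[unfolded V.complete_form_def, rule_format])
        show "X n \<in> H10 D" for n using X by blast
        fix e :: real assume "e > 0"
        then have "sqrt \<alpha> * e > 0" using sa by simp
        then obtain N where N: "\<And>m n. m \<ge> N \<Longrightarrow> n \<ge> N \<Longrightarrow> Ay.nrm (\<lambda>x. X m x - X n x) < sqrt \<alpha> * e"
          using Cauchy by blast
        have "V.nrm (\<lambda>x. X m x - X n x) < e" if "m \<ge> N" "n \<ge> N" for m n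
        proof -
          have "(\<lambda>x. X m x - X n x) \<in> H10 D" using X by (intro V.diff_mem) auto
          from le_less_trans[OF lower[OF this] N[OF that]] show ?thesis using sa by (simp add: V_nrm_eq)
        qed
        then show "\<exists>N. \<forall>m\<ge>N. \<forall>n\<ge>N. V.nrm (\<lambda>x. X m x - X n x) < e" by blast
      qed
      then obtain w where w: "w \<in> H10 D" "(\<lambda>n. V_norm D (\<lambda>x. X n x - w x)) \<longlonglongrightarrow> 0"
        unfolding V_nrm_eq by blast
      have "(\<lambda>n. Ay.nrm (\<lambda>x. X n x - w x)) \<longlonglongrightarrow> 0"
      proof (rule Lim_null_comparison)
        have d: "(\<lambda>x. X n x - w x) \<in> H10 D" for n using X w by (intro V.diff_mem) auto
        show "\<forall>\<^sub>F n in sequentially. norm (Ay.nrm (\<lambda>x. X n x - w x)) \<le> ?K * V_norm D (\<lambda>x. X n x - w x)"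
          using upper[OF d] Ay.nrm_nonneg[OF d] by simp
        show "(\<lambda>n. ?K * V_norm D (\<lambda>x. X n x - w x)) \<longlonglongrightarrow> 0"
          using tendsto_mult_left[OF w(2), of ?K] by simp
      qed
      then show "\<exists>w\<in>H10 D. (\<lambda>n. Ay.nrm (\<lambda>x. X n x - w x)) \<longlonglongrightarrow> 0" using w(1) by blast
    qed
    fix v assume v: "v \<in> H10 D"
    have "\<bar>l v\<bar> \<le> \<bar>C\<bar> * V_norm D v"
      using l_bound[OF v] mult_right_mono[OF abs_ge_self[of C] V_norm_nonneg[of v]] by linarith
    also have "\<dots> = \<bar>C\<bar> / sqrt \<alpha> * (sqrt \<alpha> * V_norm D v)" using sa by simp
    also have "\<dots> \<le> \<bar>C\<bar> / sqrt \<alpha> * Ay.nrm v" using sa by (intro mult_left_mono lower v) auto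
    finally show "\<bar>l v\<bar> \<le> \<bar>C\<bar> / sqrt \<alpha> * Ay.nrm v" .
  qed (use l_add l_scale in auto)
qed

end

section \<open>Parametric derivatives of the solution\<close>

lemma distinct_if_count_list_le_1:
  assumes "\<And>j. count_list js j \<le> 1"
  shows "distinct js"
  using assms
proof (induction js)
  case (Cons a js)
  have "count_list js j \<le> 1" for j using Cons.prems[of j] by (simp split: if_splits)
  moreover have "count_list js a = 0" using Cons.prems[of a] by simp
  ultimately show ?case using Cons.IH by (simp add: count_list_0_iff)
qed simp

lemma count_list_distinct: "distinct js \<Longrightarrow> count_list js j = (if j \<in> set js then 1 else 0)"
  by (induction js) auto

context parametric_diffusion
begin

lemma u_mem: "y \<in> param_U \<Longrightarrow> u y \<in> H10 D"
  using u unfolding weak_solution_def by blast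

lemma u_eq: "y \<in> param_U \<Longrightarrow> v \<in> H10 D \<Longrightarrow> A y (u y) v = f v"
  using u[of y] unfolding weak_solution_def energy_def L2_inner_def by blast

text \<open>The recursion is on the number of elements of \<open>S\<close>. A step with \<open>Suc n\<close> is meaningful for sets of that
  size only.\<close>

primrec du_rec :: "nat \<Rightarrow> nat set \<Rightarrow> (nat \<Rightarrow> real) \<Rightarrow> real^'d \<Rightarrow> real" where
  "du_rec 0 S y = u y"
| "du_rec (Suc n) S y = (SOME w. w \<in> H10 D \<and>
     (\<forall>v\<in>H10 D. A y w v = - (\<Sum>j\<in>S. B j (du_rec n (S - {j}) y) v)))"

definition du :: "nat set \<Rightarrow> (nat \<Rightarrow> real) \<Rightarrow> real^'d \<Rightarrow> real" where
  "du S = du_rec (card S) S"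

lemma du_empty [simp]: "du {} y = u y"
  by (simp add: du_def)

lemma B_add_right:
  assumes "v \<in> H10 D" "w \<in> H10 D" "g \<in> H10 D"
  shows "B j g (\<lambda>x. v x + w x) = B j g v + B j g w"
  using energy_add[OF bounded_coeff_psi assms(1,2,3), of j]
  unfolding energy_commute[of "\<psi> j" g] .

lemma B_scale_right:
  assumes "v \<in> H10 D" "g \<in> H10 D"
  shows "B j g (\<lambda>x. c *\<^sub>R v x) = c * B j g v"
  using energy_scale[OF bounded_coeff_psi assms, of j c]
  unfolding energy_commute[of "\<psi> j" g] .

lemma du_exists:
  assumes "finite S" "y \<in> param_U" and g: "\<And>j. j \<in> S \<Longrightarrow> g j \<in> H10 D"
  shows "\<exists>w. w \<in> H10 D \<and> (\<forall>v\<in>H10 D. A y w v = - (\<Sum>j\<in>S. B j (g j) v))"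
proof -
  have "\<exists>w\<in>H10 D. \<forall>v\<in>H10 D. A y w v = - (\<Sum>j\<in>S. B j (g j) v)"
  proof (rule Lax_Milgram[OF assms(2), where C = "\<Sum>j\<in>S. \<beta> * V_norm D (g j)"])
    fix v w assume vw: "v \<in> H10 D" "w \<in> H10 D"
    show "- (\<Sum>j\<in>S. B j (g j) (\<lambda>x. v x + w x)) = - (\<Sum>j\<in>S. B j (g j) v) + - (\<Sum>j\<in>S. B j (g j) w)"
      using B_add_right[OF vw g] by (simp add: sum.distrib)
  next
    fix v c assume v: "v \<in> H10 D"
    show "- (\<Sum>j\<in>S. B j (g j) (\<lambda>x. c *\<^sub>R v x)) = c * - (\<Sum>j\<in>S. B j (g j) v)"
      unfolding minus_mult_right[symmetric] mult_minus_right sum_distrib_left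
      using B_scale_right[OF v g] by simp
  next
    fix v assume v: "v \<in> H10 D"
    have "\<bar>\<Sum>j\<in>S. B j (g j) v\<bar> \<le> (\<Sum>j\<in>S. \<bar>B j (g j) v\<bar>)" by (rule sum_abs)
    also have "\<dots> \<le> (\<Sum>j\<in>S. \<beta> * V_norm D (g j) * V_norm D v)"
      using B_bound[OF g v] by (intro sum_mono) (simp add: mult.assoc)
    finally show "\<bar>- (\<Sum>j\<in>S. B j (g j) v)\<bar> \<le> (\<Sum>j\<in>S. \<beta> * V_norm D (g j)) * V_norm D v"
      by (simp add: sum_distrib_right)
  qed
  then show ?thesis by blast
qed

lemma du_mem_eq:
  assumes "finite S" "y \<in> param_U"
  shows "du S y \<in> H10 D \<and>
    (\<forall>v\<in>H10 D. A y (du S y) v = (if S = {} then f v else 0) - (\<Sum>j\<in>S. B j (du (S - {j}) y) v))"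
  using assms(1)
proof (induction "card S" arbitrary: S)
  case 0
  then have "S = {}" by simp
  then show ?case using u_mem u_eq assms(2) by simp
next
  case (Suc n)
  then have S: "finite S" "S \<noteq> {}" by auto
  have card: "card (S - {j}) = n" if "j \<in> S" for j
    using Suc.hyps(2) that S(1) by simp
  have eq: "du_rec n (S - {j}) y = du (S - {j}) y" if "j \<in> S" for j
    using card[OF that] by (simp add: du_def)
  have mem: "du (S - {j}) y \<in> H10 D" if "j \<in> S" for j
    using Suc.hyps(1)[of "S - {j}"] card[OF that] S(1) by simp
  have "du S y = (SOME w. w \<in> H10 D \<and> (\<forall>v\<in>H10 D. A y w v = - (\<Sum>j\<in>S. B j (du (S - {j}) y) v)))"
    unfolding du_def[of S] Suc.hyps(2)[symmetric] du_rec.simps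
    using eq by (intro arg_cong[where f = Eps] ext) simp
  then show ?case
    using someI_ex[OF du_exists[OF S(1) assms(2) mem]] S(2) by simp
qed

lemma du_mem: "finite S \<Longrightarrow> y \<in> param_U \<Longrightarrow> du S y \<in> H10 D"
  using du_mem_eq by blast

lemma du_eq:
  "finite S \<Longrightarrow> y \<in> param_U \<Longrightarrow> v \<in> H10 D \<Longrightarrow>
    A y (du S y) v = (if S = {} then f v else 0) - (\<Sum>j\<in>S. B j (du (S - {j}) y) v)"
  using du_mem_eq by blast

lemma sum_B_bound:
  assumes "finite S" "\<And>j. j \<in> S \<Longrightarrow> g j \<in> H10 D" "v \<in> H10 D"
    "\<And>j. j \<in> S \<Longrightarrow> V_norm D (g j) \<le> K j"
  shows "\<bar>\<Sum>j\<in>S. B j (g j) v\<bar> \<le> \<beta> * (\<Sum>j\<in>S. K j) * V_norm D v"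
proof -
  have "\<bar>\<Sum>j\<in>S. B j (g j) v\<bar> \<le> (\<Sum>j\<in>S. \<bar>B j (g j) v\<bar>)" by (rule sum_abs)
  also have "\<dots> \<le> (\<Sum>j\<in>S. \<beta> * (K j * V_norm D v))"
  proof (rule sum_mono)
    fix j assume j: "j \<in> S"
    have "\<bar>B j (g j) v\<bar> \<le> \<beta> * (V_norm D (g j) * V_norm D v)" by (rule B_bound[OF assms(2)[OF j] assms(3)])
    also have "\<dots> \<le> \<beta> * (K j * V_norm D v)"
      by (intro mult_left_mono mult_right_mono assms(4) j beta_nonneg V_norm_nonneg)
    finally show "\<bar>B j (g j) v\<bar> \<le> \<beta> * (K j * V_norm D v)" .
  qed
  also have "\<dots> = \<beta> * (\<Sum>j\<in>S. K j) * V_norm D v"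
    by (simp add: sum_distrib_left sum_distrib_right mult.assoc)
  finally show ?thesis .
qed

text \<open>The difference \<open>d\<close> of the two values is inserted into the form at the shifted parameter. This
  leaves the differences for smaller sets and \<open>t\<close> times \<open>B i\<close> applied to \<open>du S y\<close>, which does not
  depend on \<open>t\<close>; the constant therefore depends on \<open>y\<close> and \<open>S\<close>.\<close>

lemma du_Lipschitz:
  assumes y: "y \<in> param_U" and "finite S"
  shows "\<exists>C\<ge>0. \<forall>t. y(i := y i + t) \<in> param_U \<longrightarrow> V_norm D (\<lambda>x. du S (y(i := y i + t)) x - du S y x) \<le> C * \<bar>t\<bar>"
  using \<open>finite S\<close>
proof (induction rule: finite_psubset_induct)
  case (psubset S)
  have "\<forall>j\<in>S. \<exists>C\<ge>0. \<forall>t. y(i := y i + t) \<in> param_U \<longrightarrow>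
      V_norm D (\<lambda>x. du (S - {j}) (y(i := y i + t)) x - du (S - {j}) y x) \<le> C * \<bar>t\<bar>"
    using psubset.IH by blast
  then obtain C where C: "\<And>j. j \<in> S \<Longrightarrow> C j \<ge> 0"
    "\<And>j t. j \<in> S \<Longrightarrow> y(i := y i + t) \<in> param_U \<Longrightarrow>
      V_norm D (\<lambda>x. du (S - {j}) (y(i := y i + t)) x - du (S - {j}) y x) \<le> C j * \<bar>t\<bar>"
    by metis
  define M where "M = \<beta> * (\<Sum>j\<in>S. C j) + \<beta> * V_norm D (du S y)"
  have M: "M \<ge> 0" using C(1) beta_nonneg by (auto simp: M_def intro!: add_nonneg_nonneg mult_nonneg_nonneg sum_nonneg)
  have fS: "finite (S - {j})" for j using psubset.hyps by simp
  have main: "V_norm D (\<lambda>x. du S (y(i := y i + t)) x - du S y x) \<le> (M / \<alpha>) * \<bar>t\<bar>" if y': "y(i := y i + t) \<in> param_U" for t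
  proof -
    let ?y = "y(i := y i + t)"
    let ?d = "\<lambda>S x. du S ?y x - du S y x"
    note Gm = du_mem[OF psubset.hyps y] du_mem[OF psubset.hyps y']
    note Gj = du_mem[OF fS y] du_mem[OF fS y']
    have d: "?d S \<in> H10 D" by (intro V.diff_mem Gm)
    have dj: "?d (S - {j}) \<in> H10 D" for j by (intro V.diff_mem Gj)
    have "A ?y (?d S) (?d S) = A ?y (du S ?y) (?d S) - (A y (du S y) (?d S) + t * B i (du S y) (?d S))"
      unfolding energy_diff[OF bounded_coeff_diffusion[OF y'] Gm(2,1) d] A_shift[OF y y' Gm(1) d] ..
    also have "\<dots> = - (\<Sum>j\<in>S. B j (?d (S - {j})) (?d S)) - t * B i (du S y) (?d S)"
      unfolding du_eq[OF psubset.hyps y' d] du_eq[OF psubset.hyps y d]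
        energy_diff[OF bounded_coeff_psi Gj(2,1) d] by (simp add: sum_subtractf)
    also have "\<dots> \<le> \<bar>\<Sum>j\<in>S. B j (?d (S - {j})) (?d S)\<bar> + \<bar>t\<bar> * \<bar>B i (du S y) (?d S)\<bar>"
      using abs_ge_minus_self[of "t * B i (du S y) (?d S)"] abs_ge_minus_self[of "\<Sum>j\<in>S. B j (?d (S - {j})) (?d S)"]
      unfolding abs_mult by linarith
    also have "\<dots> \<le> \<beta> * (\<Sum>j\<in>S. C j * \<bar>t\<bar>) * V_norm D (?d S) + \<bar>t\<bar> * (\<beta> * (V_norm D (du S y) * V_norm D (?d S)))"
      by (intro add_mono mult_left_mono B_bound sum_B_bound psubset.hyps dj d Gm C(2) y') auto
    also have "\<dots> = (M * \<bar>t\<bar>) * V_norm D (?d S)"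
      by (simp add: M_def algebra_simps flip: sum_distrib_left sum_distrib_right)
    finally have "V_norm D (?d S) \<le> (M * \<bar>t\<bar>) / \<alpha>"
      using M by (intro coercive_bound[OF y' d]) auto
    then show ?thesis by simp
  qed
  show ?case
    by (intro exI[of _ "M / \<alpha>"] conjI allI impI main divide_nonneg_pos M alpha_pos)
qed

text \<open>The error \<open>e\<^sub>S\<close> of the difference quotient satisfies an equation of the same shape as \<open>du S\<close> itself: its
  right-hand side consists of the errors for \<open>S - {j}\<close> and of \<open>B i\<close> applied to the increment of
  \<open>du S\<close>. The latter is \<open>O(t)\<close> by the Lipschitz bound.\<close>

lemma du_difference_quotient:
  assumes y: "y \<in> param_U" and "finite S" "i \<notin> S"
  shows "\<exists>C\<ge>0. \<forall>t. t \<noteq> 0 \<longrightarrow> y(i := y i + t) \<in> param_U \<longrightarrow>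
    V_norm D (\<lambda>x. (1 / t) *\<^sub>R (du S (y(i := y i + t)) x - du S y x) - du (insert i S) y x) \<le> C * \<bar>t\<bar>"
  using \<open>finite S\<close> \<open>i \<notin> S\<close>
proof (induction rule: finite_psubset_induct)
  case (psubset S)
  let ?e = "\<lambda>S t x. (1 / t) *\<^sub>R (du S (y(i := y i + t)) x - du S y x) - du (insert i S) y x"
  have "\<forall>j\<in>S. \<exists>C\<ge>0. \<forall>t. t \<noteq> 0 \<longrightarrow> y(i := y i + t) \<in> param_U \<longrightarrow> V_norm D (?e (S - {j}) t) \<le> C * \<bar>t\<bar>"
    using psubset.IH psubset.prems by blast
  then obtain C where C0: "\<forall>j\<in>S. C j \<ge> 0 \<and> (\<forall>t. t \<noteq> 0 \<longrightarrow> y(i := y i + t) \<in> param_U \<longrightarrow>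
      V_norm D (?e (S - {j}) t) \<le> C j * \<bar>t\<bar>)"
    by (rule bchoice[THEN exE])
  have C: "\<And>j. j \<in> S \<Longrightarrow> C j \<ge> 0"
    "\<And>j t. j \<in> S \<Longrightarrow> t \<noteq> 0 \<Longrightarrow> y(i := y i + t) \<in> param_U \<Longrightarrow> V_norm D (?e (S - {j}) t) \<le> C j * \<bar>t\<bar>"
    using C0 by blast+
  obtain L where L: "L \<ge> 0"
    "\<And>t. y(i := y i + t) \<in> param_U \<Longrightarrow> V_norm D (\<lambda>x. du S (y(i := y i + t)) x - du S y x) \<le> L * \<bar>t\<bar>"
    using du_Lipschitz[OF y psubset.hyps, of i] by blast
  define M where "M = \<beta> * (\<Sum>j\<in>S. C j) + \<beta> * L"
  have M: "M \<ge> 0" using C(1) L(1) beta_nonneg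
    by (auto simp: M_def intro!: add_nonneg_nonneg mult_nonneg_nonneg sum_nonneg)
  have fS: "finite (S - {j})" "finite (insert i (S - {j}))" "finite (insert i S)" for j
    using psubset.hyps by simp_all
  have main: "V_norm D (?e S t) \<le> (M / \<alpha>) * \<bar>t\<bar>" if t: "t \<noteq> 0" and y': "y(i := y i + t) \<in> param_U" for t
  proof -
    let ?y = "y(i := y i + t)"
    let ?d = "\<lambda>S x. du S ?y x - du S y x"
    note Gm = du_mem[OF psubset.hyps y] du_mem[OF psubset.hyps y'] du_mem[OF fS(3) y]
    note Gj = du_mem[OF fS(1) y] du_mem[OF fS(1) y'] du_mem[OF fS(2) y]
    have d: "?d S \<in> H10 D" and dj: "?d (S - {j}) \<in> H10 D" for j by (intro V.diff_mem Gm Gj)+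
    have q: "(\<lambda>x. (1/t) *\<^sub>R ?d S x) \<in> H10 D" and qj: "(\<lambda>x. (1/t) *\<^sub>R ?d (S - {j}) x) \<in> H10 D" for j
      by (intro V.scale_mem d dj)+
    have e: "?e S t \<in> H10 D" and ej: "?e (S - {j}) t \<in> H10 D" for j
      by (intro V.diff_mem[OF q Gm(3)] V.diff_mem[OF qj Gj(3)])+
    have ins: "insert i S - {j} = insert i (S - {j})" if "j \<in> S" for j
      using psubset.prems that by auto
    have ins': "insert i S - {i} = S" using psubset.prems by auto
    have A_quot: "A y (\<lambda>x. (1/t) *\<^sub>R ?d S x) v = - (\<Sum>j\<in>S. (1/t) * B j (?d (S - {j})) v) - B i (du S ?y) v"
      if v: "v \<in> H10 D" for v
    proof -
      have "A y (?d S) v = (A ?y (du S ?y) v - t * B i (du S ?y) v) - A y (du S y) v"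
        unfolding energy_diff[OF bounded_coeff_diffusion[OF y] Gm(2,1) v] A_shift[OF y y' Gm(2) v] by simp
      also have "\<dots> = - (\<Sum>j\<in>S. B j (?d (S - {j})) v) - t * B i (du S ?y) v"
        unfolding du_eq[OF psubset.hyps y' v] du_eq[OF psubset.hyps y v]
          energy_diff[OF bounded_coeff_psi Gj(2,1) v] by (simp add: sum_subtractf)
      finally show ?thesis
        unfolding energy_scale[OF bounded_coeff_diffusion[OF y] d v] sum_distrib_left[symmetric]
        using t by (simp add: field_simps)
    qed
    have A_ins: "A y (du (insert i S) y) v = - (\<Sum>j\<in>S. B j (du (insert i (S - {j})) y) v) - B i (du S y) v"
      if v: "v \<in> H10 D" for v
      using du_eq[OF fS(3) y v] ins ins' psubset.hyps psubset.prems by simp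
    have "A y (?e S t) (?e S t) = - (\<Sum>j\<in>S. B j (?e (S - {j}) t) (?e S t)) - B i (?d S) (?e S t)"
      unfolding energy_diff[OF bounded_coeff_diffusion[OF y] q Gm(3) e] A_quot[OF e] A_ins[OF e]
        energy_diff[OF bounded_coeff_psi qj Gj(3) e] energy_scale[OF bounded_coeff_psi dj e]
        energy_diff[OF bounded_coeff_psi Gm(2,1) e]
      by (simp add: sum_subtractf)
    also have "\<dots> \<le> \<bar>\<Sum>j\<in>S. B j (?e (S - {j}) t) (?e S t)\<bar> + \<bar>B i (?d S) (?e S t)\<bar>"
      by linarith
    also have "\<dots> \<le> \<beta> * (\<Sum>j\<in>S. C j * \<bar>t\<bar>) * V_norm D (?e S t) + \<beta> * (V_norm D (?d S) * V_norm D (?e S t))"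
      by (intro add_mono B_bound sum_B_bound psubset.hyps d e ej C(2) t y')
    also have "\<dots> \<le> \<beta> * (\<Sum>j\<in>S. C j * \<bar>t\<bar>) * V_norm D (?e S t) + \<beta> * ((L * \<bar>t\<bar>) * V_norm D (?e S t))"
      by (intro add_left_mono mult_left_mono mult_right_mono L(2) y' beta_nonneg V_norm_nonneg)
    also have "\<dots> = (M * \<bar>t\<bar>) * V_norm D (?e S t)"
      by (simp add: M_def algebra_simps flip: sum_distrib_left sum_distrib_right)
    finally have "V_norm D (?e S t) \<le> (M * \<bar>t\<bar>) / \<alpha>"
      using M by (intro coercive_bound[OF y e]) auto
    then show ?thesis by simp
  qed
  show ?case
    by (intro exI[of _ "M / \<alpha>"] conjI allI impI main divide_nonneg_pos M alpha_pos)
qed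

lemma du_has_param_deriv:
  assumes y: "y \<in> param_U" and "finite S" "i \<notin> S"
  shows "has_param_deriv D (du S) i y (du (insert i S) y)"
  unfolding has_param_deriv_def
proof
  show "du (insert i S) y \<in> H10 D" using assms by (intro du_mem) auto
  obtain C where C: "\<And>t. t \<noteq> 0 \<Longrightarrow> y(i := y i + t) \<in> param_U \<Longrightarrow>
    V_norm D (\<lambda>x. (1 / t) *\<^sub>R (du S (y(i := y i + t)) x - du S y x) - du (insert i S) y x) \<le> C * \<bar>t\<bar>"
    using du_difference_quotient[OF assms] by blast
  show "((\<lambda>t. V_norm D (\<lambda>x. (du S (y(i := y i + t)) x - du S y x) / t - du (insert i S) y x)) \<longlongrightarrow> 0)
      (at 0 within {t. y(i := y i + t) \<in> param_U})"
  proof (rule Lim_null_comparison)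
    show "\<forall>\<^sub>F t in at 0 within {t. y(i := y i + t) \<in> param_U}.
        norm (V_norm D (\<lambda>x. (du S (y(i := y i + t)) x - du S y x) / t - du (insert i S) y x)) \<le> C * \<bar>t\<bar>"
      using C by (auto simp: eventually_at_filter)
    have "((\<lambda>t. C * \<bar>t\<bar>) \<longlongrightarrow> C * \<bar>0\<bar>) (at 0 within {t. y(i := y i + t) \<in> param_U})"
      by (intro tendsto_intros)
    then show "((\<lambda>t. C * \<bar>t\<bar>) \<longlongrightarrow> 0) (at 0 within {t. y(i := y i + t) \<in> param_U})" by simp
  qed
qed

lemma du_iterated_deriv: "distinct js \<Longrightarrow> has_iterated_deriv D u js (du (set js))"
proof (induction js)
  case Nil
  show ?case using u_mem by simp
next
  case (Cons j js)
  then show ?case using du_has_param_deriv[of _ "set js" j] by auto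
qed

lemma F1_count_list:
  assumes "\<omega> \<in> F1" "\<forall>j. count_list js j = \<omega> j"
  shows "distinct js" "set js = supp \<omega>"
proof -
  show "set js = supp \<omega>"
  proof (rule set_eqI)
    show "j \<in> set js \<longleftrightarrow> j \<in> supp \<omega>" for j
      using assms(2)[rule_format, of j] count_list_0_iff[of js j] by (auto simp: supp_def)
  qed
  have "\<omega> j \<in> {0, 1}" for j using assms(1) unfolding F1_def by blast
  then have "count_list js j \<le> 1" for j using assms(2)[rule_format, of j] by (metis One_nat_def insertE le_refl singletonD zero_le_one)
  then show "distinct js" by (rule distinct_if_count_list_le_1)
qed

theorem du_mixed_deriv:
  assumes "\<omega> \<in> F1"
  shows "has_mixed_deriv D u \<omega> (du (supp \<omega>))"
  unfolding has_mixed_deriv_def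
proof (intro conjI allI impI)
  show "finite (supp \<omega>)" using assms unfolding F1_def by blast
  fix js assume js: "\<forall>j. count_list js j = \<omega> j"
  show "has_iterated_deriv D u js (du (supp \<omega>))"
    using du_iterated_deriv[OF F1_count_list(1)[OF assms js]] unfolding F1_count_list(2)[OF assms js] .
qed

end

context bounded_domain
begin

section \<open>Uniqueness of parametric derivatives\<close>

text \<open>At an endpoint of the parameter interval the admissible increments still accumulate at \<open>0\<close>, from one
  side; without this, limits along them would not be unique.\<close>

lemma param_set_limit_point:
  assumes "y \<in> param_U"
  shows "at 0 within {t. y(i := y i + t) \<in> param_U} \<noteq> bot"
proof -
  have yi: "y i \<in> {-1/2..1/2}" using assms unfolding param_U_def by blast
  have sub: "{-1/2 - y i..1/2 - y i} \<subseteq> {t. y(i := y i + t) \<in> param_U}"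
    using assms by (auto simp: param_U_def)
  have "0 islimpt {-1/2 - y i..1/2 - y i}"
    using yi by (subst islimpt_Icc) auto
  then have "0 islimpt {t. y(i := y i + t) \<in> param_U}"
    using islimpt_subset[OF _ sub] by blast
  then show ?thesis by (simp add: trivial_limit_within)
qed

text \<open>Iterated derivatives are known up to norm zero only, so uniqueness is needed for two functions that
  agree in this sense.\<close>

lemma param_deriv_unique:
  assumes y: "y \<in> param_U"
    and mem: "\<And>y. y \<in> param_U \<Longrightarrow> F y \<in> H10 D \<and> F' y \<in> H10 D \<and> V_norm D (\<lambda>x. F y x - F' y x) = 0"
    and w: "has_param_deriv D F i y w" and w': "has_param_deriv D F' i y w'"
  shows "V_norm D (\<lambda>x. w x - w' x) = 0"
proof -
  let ?T = "{t. y(i := y i + t) \<in> param_U}"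
  have W: "w \<in> H10 D" "w' \<in> H10 D" using w w' unfolding has_param_deriv_def by blast+
  let ?q = "\<lambda>F t x. (1/t) *\<^sub>R (F (y(i := y i + t)) x - F y x)"
  have "V_norm D (\<lambda>x. w x - w' x) \<le> 0"
  proof (rule tendsto_lowerbound)
    have l: "((\<lambda>t. V_norm D (\<lambda>x. ?q F t x - w x)) \<longlongrightarrow> 0) (at 0 within ?T)"
      "((\<lambda>t. V_norm D (\<lambda>x. ?q F' t x - w' x)) \<longlongrightarrow> 0) (at 0 within ?T)"
      using w w' unfolding has_param_deriv_def by simp_all
    show "((\<lambda>t. V_norm D (\<lambda>x. ?q F t x - w x) + V_norm D (\<lambda>x. ?q F' t x - w' x)) \<longlongrightarrow> 0) (at 0 within ?T)"
      using tendsto_add[OF l] by simp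
    show "\<forall>\<^sub>F t in at 0 within ?T. V_norm D (\<lambda>x. w x - w' x) \<le>
        V_norm D (\<lambda>x. ?q F t x - w x) + V_norm D (\<lambda>x. ?q F' t x - w' x)"
      unfolding eventually_at_filter
    proof (intro eventuallyI impI)
      fix t assume "t \<in> ?T"
      then have y': "y(i := y i + t) \<in> param_U" by simp
      let ?y = "y(i := y i + t)"
      note m = mem[OF y] mem[OF y']
      have q: "?q F t \<in> H10 D" "?q F' t \<in> H10 D" 
        by (intro V.scale_mem V.diff_mem m[THEN conjunct1] m[THEN conjunct2, THEN conjunct1])+
      have z: "V_norm D (\<lambda>x. ?q F t x - ?q F' t x) = 0"
      proof -
        have d: "(\<lambda>x. F ?y x - F' ?y x) \<in> H10 D" "(\<lambda>x. F y x - F' y x) \<in> H10 D"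
          using m by (auto intro: V.diff_mem)
        have eq: "(\<lambda>x. ?q F t x - ?q F' t x) = (\<lambda>x. (1/t) *\<^sub>R ((F ?y x - F' ?y x) - (F y x - F' y x)))"
          by (auto simp: algebra_simps diff_divide_distrib)
        have "V_norm D (\<lambda>x. (F ?y x - F' ?y x) - (F y x - F' y x)) \<le> 0"
          using V.nrm_triangle_diff[OF d(1) V.zero_mem d(2)] V.nrm_minus_commute[OF V.zero_mem d(2)] m
          unfolding V_nrm_eq by simp
        then have "V_norm D (\<lambda>x. (F ?y x - F' ?y x) - (F y x - F' y x)) = 0"
          by (intro antisym) auto
        then show ?thesis
          unfolding eq using V.nrm_scale[OF V.diff_mem[OF d], of "1/t"] unfolding V_nrm_eq by simp
      qed
      have "V_norm D (\<lambda>x. w x - w' x) \<le> V_norm D (\<lambda>x. w x - ?q F t x) + V_norm D (\<lambda>x. ?q F t x - w' x)"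
        using V.nrm_triangle_diff[OF W(1) q(1) W(2)] unfolding V_nrm_eq .
      also have "V_norm D (\<lambda>x. w x - ?q F t x) = V_norm D (\<lambda>x. ?q F t x - w x)"
        using V.nrm_minus_commute[OF W(1) q(1)] unfolding V_nrm_eq .
      also have "V_norm D (\<lambda>x. ?q F t x - w' x) \<le> V_norm D (\<lambda>x. ?q F' t x - w' x)"
        using V.nrm_triangle_diff[OF q W(2)] z unfolding V_nrm_eq by simp
      finally show "V_norm D (\<lambda>x. w x - w' x) \<le> V_norm D (\<lambda>x. ?q F t x - w x) + V_norm D (\<lambda>x. ?q F' t x - w' x)"
        by (simp only: add_right_mono)
    qed
    show "at 0 within ?T \<noteq> bot" by (rule param_set_limit_point[OF y])
  qed
  then show ?thesis by (intro antisym) auto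
qed

lemma iterated_deriv_unique:
  assumes "has_iterated_deriv D F js H" "has_iterated_deriv D F js H'" "y \<in> param_U"
  shows "H y \<in> H10 D \<and> H' y \<in> H10 D \<and> V_norm D (\<lambda>x. H y x - H' y x) = 0"
  using assms
proof (induction js arbitrary: H H' y)
  case Nil
  then show ?case by (simp add: V_norm_zero)
next
  case (Cons j js)
  obtain K where K: "has_iterated_deriv D F js K" "\<And>y. y \<in> param_U \<Longrightarrow> has_param_deriv D K j y (H y)"
    using Cons.prems(1) by auto
  obtain K' where K': "has_iterated_deriv D F js K'" "\<And>y. y \<in> param_U \<Longrightarrow> has_param_deriv D K' j y (H' y)"
    using Cons.prems(2) by auto
  have "V_norm D (\<lambda>x. H y x - H' y x) = 0"
    by (rule param_deriv_unique[OF Cons.prems(3) Cons.IH[OF K(1) K'(1)] K(2)[OF Cons.prems(3)] K'(2)[OF Cons.prems(3)]])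
  then show ?case using K(2)[OF Cons.prems(3)] K'(2)[OF Cons.prems(3)] unfolding has_param_deriv_def by blast
qed

lemma V_norm_cong_0:
  assumes "v \<in> H10 D" "w \<in> H10 D" "V_norm D (\<lambda>x. v x - w x) = 0"
  shows "V_norm D v = V_norm D w"
  using V.nrm_diff_le[OF assms(1,2)] assms(3) unfolding V_nrm_eq by simp

end

context parametric_diffusion
begin

text \<open>The mixed derivative is some function that qualifies, so only its norm can be identified.\<close>

lemma mixed_deriv_G:
  assumes \<omega>: "\<omega> \<in> F1"
  shows "has_mixed_deriv D u \<omega> (mixed_deriv D \<omega> u)"
    "y \<in> param_U \<Longrightarrow> V_norm D (mixed_deriv D \<omega> u y) = V_norm D (du (supp \<omega>) y)"
proof -
  show md: "has_mixed_deriv D u \<omega> (mixed_deriv D \<omega> u)"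
    unfolding mixed_deriv_def by (rule someI[of "has_mixed_deriv D u \<omega>", OF du_mixed_deriv[OF \<omega>]])
  assume y: "y \<in> param_U"
  have fin: "finite (supp \<omega>)" and val: "\<And>j. \<omega> j \<in> {0, 1}" using \<omega> unfolding F1_def by blast+
  obtain js where js: "set js = supp \<omega>" "distinct js"
    using finite_distinct_list[OF fin] by blast
  have "count_list js j = \<omega> j" for j
    using val[of j] js(1) by (auto simp: count_list_distinct[OF js(2)] supp_def)
  then have "has_iterated_deriv D u js (mixed_deriv D \<omega> u)" "has_iterated_deriv D u js (du (supp \<omega>))"
    using md du_mixed_deriv[OF \<omega>] unfolding has_mixed_deriv_def by blast+
  from iterated_deriv_unique[OF this y] show "V_norm D (mixed_deriv D \<omega> u y) = V_norm D (du (supp \<omega>) y)"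
    by (auto intro: V_norm_cong_0)
qed

end

section \<open>The energy estimate for all derivatives of one order\<close>

text \<open>The choice \<open>s = 2 k / c\<close> absorbs half of the left-hand side. The case \<open>k = 0\<close>, where this is not
  positive, is immediate.\<close>

lemma recursion_to_contraction:
  fixes c k X X' :: real
  assumes c: "0 < c" and k: "0 \<le> k" and X: "0 \<le> X"
    and ineq: "\<And>s. s > 0 \<Longrightarrow> c * X' \<le> k * (s * X + X' / s)"
  shows "X' \<le> (2 * k / c)\<^sup>2 * X"
proof (cases "k = 0")
  case True
  then have "c * X' \<le> 0" using ineq[of 1] by simp
  then show ?thesis using c True by (simp add: mult_le_0_iff)
next
  case False
  define s where "s = 2 * k / c"
  have s: "s > 0" "k / s = c / 2" "k = c * s / 2" using c k False by (auto simp: s_def)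
  have "c * X' \<le> k * s * X + (k / s) * X'" using ineq[OF s(1)] by (simp add: algebra_simps)
  then have "c * X' \<le> c * (s\<^sup>2 * X)"
    unfolding s(2) by (subst (asm) s(3)) (simp add: power2_eq_square algebra_simps)
  then show ?thesis using c unfolding s_def by simp
qed

context parametric_diffusion
begin

lemma bounded_coeff_abs_psi: "bounded_coeff D (\<lambda>x. \<bar>\<psi> j x\<bar>)"
proof -
  have "(\<lambda>x. \<bar>\<psi> j x\<bar>) \<in> borel_measurable (lebesgue_on D)" using psi_meas[of j] by measurable
  then show ?thesis unfolding bounded_coeff_def using psi_bound[of j] by auto
qed

lemma Young:
  assumes r: "r > 0" and p: "p \<in> H10 D" and q: "q \<in> H10 D"
  shows "\<bar>B j p q\<bar> \<le> (r * energy D (\<lambda>x. \<bar>\<psi> j x\<bar>) p p + energy D (\<lambda>x. \<bar>\<psi> j x\<bar>) q q / r) / 2"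
proof -
  let ?p = "weak_grad D p" and ?q = "weak_grad D q"
  note int = energy_integrable[OF bounded_coeff_abs_psi p p, of j] energy_integrable[OF bounded_coeff_abs_psi q q, of j]
  have "\<bar>B j p q\<bar> \<le> (LINT x|lebesgue_on D. \<bar>\<psi> j x * (?p x \<bullet> ?q x)\<bar>)"
    unfolding energy_def L2_inner_def
    using integral_norm_bound[of "lebesgue_on D" "\<lambda>x. \<psi> j x * (?p x \<bullet> ?q x)"] by simp
  also have "\<dots> \<le> (LINT x|lebesgue_on D. r / 2 * (\<bar>\<psi> j x\<bar> * (?p x \<bullet> ?p x)) + 1 / (2 * r) * (\<bar>\<psi> j x\<bar> * (?q x \<bullet> ?q x)))"
  proof (rule integral_mono)
    show "integrable (lebesgue_on D) (\<lambda>x. \<bar>\<psi> j x * (?p x \<bullet> ?q x)\<bar>)"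
      by (intro integrable_abs energy_integrable bounded_coeff_psi p q)
    show "integrable (lebesgue_on D) (\<lambda>x. r / 2 * (\<bar>\<psi> j x\<bar> * (?p x \<bullet> ?p x)) + 1 / (2 * r) * (\<bar>\<psi> j x\<bar> * (?q x \<bullet> ?q x)))"
      by (intro Bochner_Integration.integrable_add integrable_mult_right int)
    fix x
    have sq: "0 \<le> (r * norm (?p x) - norm (?q x))\<^sup>2 / (2 * r)" using r by simp
    have "\<bar>?p x \<bullet> ?q x\<bar> \<le> norm (?p x) * norm (?q x)" by (rule Cauchy_Schwarz_ineq2)
    also have "\<dots> \<le> r / 2 * (norm (?p x))\<^sup>2 + 1 / (2 * r) * (norm (?q x))\<^sup>2"
      using sq r by (simp add: power2_diff power2_eq_square field_simps)
    finally have "\<bar>\<psi> j x\<bar> * \<bar>?p x \<bullet> ?q x\<bar> \<le> \<bar>\<psi> j x\<bar> * (r / 2 * (norm (?p x))\<^sup>2 + 1 / (2 * r) * (norm (?q x))\<^sup>2)"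
      by (rule mult_left_mono) simp
    then show "\<bar>\<psi> j x * (?p x \<bullet> ?q x)\<bar> \<le> r / 2 * (\<bar>\<psi> j x\<bar> * (?p x \<bullet> ?p x)) + 1 / (2 * r) * (\<bar>\<psi> j x\<bar> * (?q x \<bullet> ?q x))"
      by (simp add: abs_mult algebra_simps flip: power2_norm_eq_inner)
  qed
  also have "\<dots> = (r * energy D (\<lambda>x. \<bar>\<psi> j x\<bar>) p p + energy D (\<lambda>x. \<bar>\<psi> j x\<bar>) q q / r) / 2"
    unfolding energy_def L2_inner_def using int r by (simp add: field_simps)
  finally show ?thesis .
qed

text \<open>Writing \<open>X\<close> for the energy and \<open>N\<close> for the norm of \<open>u y\<close>, the equation gives
  \<open>(1 - \<kappa>bar) X \<le> \<parallel>f\<parallel> N\<close>, and \<open>a0min N\<^sup>2 \<le> X\<close>; eliminating \<open>N\<close> gives the bound.\<close>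

lemma energy_a0_u:
  assumes y: "y \<in> param_U"
  shows "energy D a0 (u y) (u y) \<le> (dual_norm D f / (1 - \<kappa>bar))\<^sup>2 / a0min"
proof -
  let ?X = "energy D a0 (u y) (u y)" and ?N = "V_norm D (u y)" and ?F = "dual_norm D f"
  note um = u_mem[OF y]
  have lower: "a0min * ?N\<^sup>2 \<le> ?X" by (rule energy_a0_ge[OF um])
  have X: "0 \<le> ?X" using lower a0min_pos by (smt (verit) mult_nonneg_nonneg zero_le_power2)
  have c: "1 - \<kappa>bar > 0" using kbar by simp
  have "(1 - \<kappa>bar) * ?X \<le> ?F * ?N"
    using A_ge_energy_a0[OF y um] u_eq[OF y um] dual_norm_bound[OF f um] by linarith
  then have "((1 - \<kappa>bar) * ?X)\<^sup>2 \<le> (?F * ?N)\<^sup>2"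
    using X c by (intro power_mono) auto
  then have "a0min * ((1 - \<kappa>bar) * ?X)\<^sup>2 \<le> a0min * (?F * ?N)\<^sup>2"
    using a0min_pos by simp
  also have "\<dots> = ?F\<^sup>2 * (a0min * ?N\<^sup>2)" by (simp add: power_mult_distrib)
  also have "\<dots> \<le> ?F\<^sup>2 * ?X" by (intro mult_left_mono lower) simp
  finally have "(a0min * (1 - \<kappa>bar)\<^sup>2 * ?X) * ?X \<le> ?F\<^sup>2 * ?X"
    by (simp add: power2_eq_square algebra_simps)
  then have "a0min * (1 - \<kappa>bar)\<^sup>2 * ?X \<le> ?F\<^sup>2"
    using X by (cases "?X = 0") (auto simp: mult_le_cancel_right)
  then show ?thesis using a0min_pos c by (simp add: power_divide pos_le_divide_eq mult.commute mult.left_commute)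
qed

text \<open>All sets with \<open>k\<close> elements are estimated together. In the proof, \<open>X k\<close> is the sum of their energies
  \<open>W T * \<integral> a\<^sub>0 \<bar>\<nabla>du T\<bar>\<^sup>2\<close>, and \<open>e j T\<close> is the same energy with \<open>\<bar>\<psi> j\<bar> / b j\<close> in place of \<open>a\<^sub>0\<close>. Over
  \<open>j \<in> J \<subseteq> S\<close> the latter sum up to at most \<open>2 * \<kappa>\<close> times the former, whatever the size of \<open>J\<close>; this is
  what keeps combinatorial factors out of the step from \<open>k\<close> to \<open>k + 1\<close>.\<close>

lemma weighted_level_estimate:
  fixes b :: "nat \<Rightarrow> real" and \<kappa> :: real
  assumes y: "y \<in> param_U" and fin: "finite S" and b: "\<And>j. b j > 0" and \<kappa>: "0 \<le> \<kappa>"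
    and psi_le: "AE x in lebesgue_on D. (\<Sum>j\<in>S. \<bar>\<psi> j x\<bar> / b j) \<le> 2 * \<kappa> * a0 x"
  shows "(\<Sum>T | T \<subseteq> S \<and> card T = k. (V_norm D (du T y))\<^sup>2 / (\<Prod>j\<in>T. b j)\<^sup>2)
    \<le> ((2 * \<kappa> / (1 - \<kappa>bar)) ^ k * (dual_norm D f / ((1 - \<kappa>bar) * a0min)))\<^sup>2"
proof -
  define L where "L k = {T. T \<subseteq> S \<and> card T = k}" for k
  have finL: "finite (L k)" for k using fin by (auto simp: L_def)
  have T: "T \<subseteq> S" "finite T" "du T y \<in> H10 D" if "T \<in> L k" for T k
    using that fin du_mem[OF _ y] by (auto simp: L_def dest: finite_subset)
  define W where "W T = 1 / (\<Prod>j\<in>T. b j)\<^sup>2" for T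
  have W: "W T \<ge> 0" for T by (simp add: W_def)
  \<comment> \<open>The weights of \<open>T\<close> and \<open>T - {j}\<close> differ by two factors \<open>b j\<close>: one cancels against the parameter in Young's inequality, the other becomes the weight of \<open>\<psi> j\<close>.\<close>
  have WT: "W T * b j = W (T - {j}) / b j" if "finite T" "j \<in> T" for T j
  proof -
    have "(\<Prod>j\<in>T. b j) = b j * (\<Prod>j\<in>T - {j}. b j)" using that by (rule prod.remove)
    then show ?thesis using b[of j] by (simp add: W_def power_mult_distrib power2_eq_square)
  qed
  define X where "X k = (\<Sum>T\<in>L k. W T * energy D a0 (du T y) (du T y))" for k
  define e where "e j T = W T * energy D (\<lambda>x. \<bar>\<psi> j x\<bar>) (du T y) (du T y) / b j" for j T
  have c: "1 - \<kappa>bar > 0" using kbar by simp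
  have a0_nonneg: "0 \<le> energy D a0 v v" if "v \<in> H10 D" for v
    using energy_a0_ge[OF that] a0min_pos by (smt (verit) mult_nonneg_nonneg zero_le_power2)
  have X: "0 \<le> X k" for k
    unfolding X_def using T(3) by (intro sum_nonneg mult_nonneg_nonneg W a0_nonneg) blast
  have e_sum: "(\<Sum>j\<in>J. e j T) \<le> 2 * \<kappa> * (W T * energy D a0 (du T y) (du T y))"
    if TL: "T \<in> L k" and J: "J \<subseteq> S" for T J k
  proof -
    note g = T(3)[OF TL]
    have fJ: "finite J" using J fin by (rule finite_subset)
    have bc: "bounded_coeff D (\<lambda>x. (1 / b j) * \<bar>\<psi> j x\<bar>)" for j
      by (intro bounded_coeff_cmult bounded_coeff_abs_psi)
    have "(\<Sum>j\<in>J. e j T) = W T * (\<Sum>j\<in>J. energy D (\<lambda>x. (1 / b j) * \<bar>\<psi> j x\<bar>) (du T y) (du T y))"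
      unfolding e_def energy_coeff_scale sum_distrib_left by (intro sum.cong) auto
    also have "\<dots> = W T * energy D (\<lambda>x. \<Sum>j\<in>J. (1 / b j) * \<bar>\<psi> j x\<bar>) (du T y) (du T y)"
      using energy_coeff_sum[OF fJ bc g g] by simp
    also have "\<dots> \<le> W T * energy D (\<lambda>x. (2 * \<kappa>) * a0 x) (du T y) (du T y)"
    proof (intro mult_left_mono W energy_coeff_mono bounded_coeff_sum fJ bc bounded_coeff_cmult bounded_coeff_a0 g)
      show "AE x in lebesgue_on D. (\<Sum>j\<in>J. (1 / b j) * \<bar>\<psi> j x\<bar>) \<le> 2 * \<kappa> * a0 x"
        using psi_le
      proof eventually_elim
        case (elim x)
        have "(\<Sum>j\<in>J. (1 / b j) * \<bar>\<psi> j x\<bar>) \<le> (\<Sum>j\<in>S. \<bar>\<psi> j x\<bar> / b j)"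
          using fin J b by (auto intro!: sum_mono2 divide_nonneg_pos)
        then show ?case using elim by linarith
      qed
    qed
    finally show ?thesis unfolding energy_coeff_scale by (simp add: algebra_simps)
  qed
  have reindex: "(\<Sum>T\<in>L (Suc k). \<Sum>j\<in>T. e j (T - {j})) = (\<Sum>T\<in>L k. \<Sum>j\<in>S - T. e j T)" for k
  proof -
    have "(\<Sum>T\<in>L (Suc k). \<Sum>j\<in>T. e j (T - {j})) = (\<Sum>(T, j)\<in>Sigma (L (Suc k)) (\<lambda>T. T). e j (T - {j}))"
      using finL T(2) by (intro sum.Sigma) auto
    also have "\<dots> = (\<Sum>(T, j)\<in>Sigma (L k) (\<lambda>T. S - T). e j T)"
      by (rule sum.reindex_bij_witness[where i = "\<lambda>(T, j). (insert j T, j)" and j = "\<lambda>(T, j). (T - {j}, j)"])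
        (auto simp: L_def insert_absorb intro: finite_subset[OF _ fin] card_insert_disjoint[OF finite_subset[OF _ fin]])
    also have "\<dots> = (\<Sum>T\<in>L k. \<Sum>j\<in>S - T. e j T)"
      using finL fin by (intro sum.Sigma[symmetric]) auto
    finally show ?thesis .
  qed
  have step: "X (Suc k) \<le> (2 * \<kappa> / (1 - \<kappa>bar))\<^sup>2 * X k" for k
  proof (rule recursion_to_contraction[OF c \<kappa> X])
    fix s :: real assume s: "s > 0"
    have one: "(1 - \<kappa>bar) * (W T * energy D a0 (du T y) (du T y)) \<le> (\<Sum>j\<in>T. (s * e j (T - {j}) + e j T / s) / 2)"
      if TL: "T \<in> L (Suc k)" for T
    proof -
      note Tp = T[OF TL]
      have ne: "T \<noteq> {}" using TL by (auto simp: L_def)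
      have gj: "du (T - {j}) y \<in> H10 D" for j using Tp(2) by (intro du_mem y) simp
      let ?E = "\<lambda>j T. energy D (\<lambda>x. \<bar>\<psi> j x\<bar>) (du T y) (du T y)"
      have "(1 - \<kappa>bar) * energy D a0 (du T y) (du T y) \<le> A y (du T y) (du T y)"
        by (rule A_ge_energy_a0[OF y Tp(3)])
      also have "\<dots> \<le> (\<Sum>j\<in>T. \<bar>B j (du (T - {j}) y) (du T y)\<bar>)"
        unfolding du_eq[OF Tp(2) y Tp(3)] using ne
        by (simp add: abs_ge_minus_self[THEN order_trans, OF sum_abs])
      \<comment> \<open>Young's inequality with parameter \<open>s * b j\<close>, so that both halves carry the weight \<open>1 / b j\<close>.\<close>
      also have "\<dots> \<le> (\<Sum>j\<in>T. ((s * b j) * ?E j (T - {j}) + ?E j T / (s * b j)) / 2)"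
        using s b by (intro sum_mono Young gj Tp(3)) simp
      finally have "W T * ((1 - \<kappa>bar) * energy D a0 (du T y) (du T y))
          \<le> W T * (\<Sum>j\<in>T. ((s * b j) * ?E j (T - {j}) + ?E j T / (s * b j)) / 2)"
        by (intro mult_left_mono W)
      also have "\<dots> = (\<Sum>j\<in>T. (s * e j (T - {j}) + e j T / s) / 2)"
        unfolding sum_distrib_left
      proof (rule sum.cong[OF refl])
        fix j assume j: "j \<in> T"
        have "W T * ((s * b j) * ?E j (T - {j})) = s * ((W T * b j) * ?E j (T - {j}))" by simp
        also have "\<dots> = s * e j (T - {j})" unfolding WT[OF Tp(2) j] by (simp add: e_def)
        finally show "W T * (((s * b j) * ?E j (T - {j}) + ?E j T / (s * b j)) / 2) = (s * e j (T - {j}) + e j T / s) / 2"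
          by (simp add: e_def distrib_left)
      qed
      finally show ?thesis by (simp add: algebra_simps)
    qed
    have "(1 - \<kappa>bar) * X (Suc k) \<le> (\<Sum>T\<in>L (Suc k). \<Sum>j\<in>T. (s * e j (T - {j}) + e j T / s) / 2)"
      unfolding X_def sum_distrib_left by (intro sum_mono one)
    also have "\<dots> = (s * (\<Sum>T\<in>L (Suc k). \<Sum>j\<in>T. e j (T - {j})) + (\<Sum>T\<in>L (Suc k). \<Sum>j\<in>T. e j T) / s) / 2"
      by (simp add: sum.distrib sum_distrib_left sum_divide_distrib add_divide_distrib)
    also have "\<dots> = (s * (\<Sum>T\<in>L k. \<Sum>j\<in>S - T. e j T) + (\<Sum>T\<in>L (Suc k). \<Sum>j\<in>T. e j T) / s) / 2"
      unfolding reindex ..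
    also have "\<dots> \<le> (s * (2 * \<kappa> * X k) + (2 * \<kappa> * X (Suc k)) / s) / 2"
      unfolding X_def sum_distrib_left[of "2 * \<kappa>"] using s T(1)
      by (intro divide_right_mono add_mono mult_left_mono sum_mono e_sum) auto
    also have "\<dots> = \<kappa> * (s * X k + X (Suc k) / s)" by (simp add: algebra_simps add_divide_distrib)
    finally show "(1 - \<kappa>bar) * X (Suc k) \<le> \<kappa> * (s * X k + X (Suc k) / s)" .
  qed
  let ?r = "2 * \<kappa> / (1 - \<kappa>bar)"
  have Xk: "X k \<le> (?r ^ k)\<^sup>2 * X 0" for k
  proof (induction k)
    case (Suc k)
    have "X (Suc k) \<le> ?r\<^sup>2 * X k" by (rule step)
    also have "\<dots> \<le> ?r\<^sup>2 * ((?r ^ k)\<^sup>2 * X 0)" by (intro mult_left_mono Suc) simp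
    also have "\<dots> = (?r ^ Suc k)\<^sup>2 * X 0" by (simp only: power_Suc power_mult_distrib mult.assoc)
    finally show ?case .
  qed simp
  have "L 0 = {{}}" using fin by (auto simp: L_def dest: finite_subset)
  then have X0: "X 0 \<le> (dual_norm D f / (1 - \<kappa>bar))\<^sup>2 / a0min"
    using energy_a0_u[OF y] by (simp add: X_def W_def)
  have "a0min * (\<Sum>T\<in>L k. (V_norm D (du T y))\<^sup>2 / (\<Prod>j\<in>T. b j)\<^sup>2) \<le> X k"
    unfolding X_def sum_distrib_left
  proof (rule sum_mono)
    fix T' assume TL: "T' \<in> L k"
    have "W T' * (a0min * (V_norm D (du T' y))\<^sup>2) \<le> W T' * energy D a0 (du T' y) (du T' y)"
      by (intro mult_left_mono W energy_a0_ge T(3)[OF TL])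
    then show "a0min * ((V_norm D (du T' y))\<^sup>2 / (\<Prod>j\<in>T'. b j)\<^sup>2) \<le> W T' * energy D a0 (du T' y) (du T' y)"
      by (simp add: W_def)
  qed
  also have "\<dots> \<le> (?r ^ k)\<^sup>2 * ((dual_norm D f / (1 - \<kappa>bar))\<^sup>2 / a0min)"
    using order_trans[OF Xk mult_left_mono[OF X0]] by simp
  finally have "(\<Sum>T\<in>L k. (V_norm D (du T y))\<^sup>2 / (\<Prod>j\<in>T. b j)\<^sup>2)
      \<le> (?r ^ k)\<^sup>2 * ((dual_norm D f / (1 - \<kappa>bar))\<^sup>2 / a0min) / a0min"
    using a0min_pos by (simp add: pos_le_divide_eq mult.commute)
  also have "\<dots> = (?r ^ k * (dual_norm D f / ((1 - \<kappa>bar) * a0min)))\<^sup>2"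
    by (simp add: power_mult_distrib power_divide power2_eq_square ac_simps)
  finally show ?thesis unfolding L_def .
qed

text \<open>The smallness of the full series makes the norm of its part finite, so that its conversion to a real
  number loses nothing.\<close>

lemma kappa_tilde_bound:
  assumes fin: "finite (supp \<nu>)" and b: "\<And>j. b j > 0"
    and small: "Linf_norm D (\<lambda>x. \<Sum>j. ennreal (\<bar>\<psi> j x\<bar> / b j / (2 * a0 x))) < 1"
  shows "AE x in lebesgue_on D. (\<Sum>j\<in>supp \<nu>. \<bar>\<psi> j x\<bar> / b j) \<le> 2 * kappa_tilde D a0 \<psi> b \<nu> * a0 x"
proof -
  let ?g = "\<lambda>x. \<Sum>j\<in>supp \<nu>. ennreal (\<bar>\<psi> j x\<bar> / b j / (2 * a0 x))"
  have gm: "?g \<in> borel_measurable (lebesgue_on D)"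
    using psi_meas a0_meas by measurable
  have "Linf_norm D ?g \<le> Linf_norm D (\<lambda>x. \<Sum>j. ennreal (\<bar>\<psi> j x\<bar> / b j / (2 * a0 x)))"
    unfolding Linf_norm_def by (intro esssup_mono gm sum_le_suminf fin) auto
  also have "\<dots> < 1" by (rule small)
  finally have "Linf_norm D ?g < top" by (rule order.strict_trans) simp
  then have eq: "Linf_norm D ?g = ennreal (kappa_tilde D a0 \<psi> b \<nu>)"
    unfolding kappa_tilde_def by simp
  have "AE x in lebesgue_on D. ?g x \<le> Linf_norm D ?g"
    unfolding Linf_norm_def by (rule esssup_AE)
  then show ?thesis
    using a0_bounds
  proof eventually_elim
    case (elim x)
    then have a0: "a0 x > 0" using a0min_pos by linarith
    have "?g x = ennreal (\<Sum>j\<in>supp \<nu>. \<bar>\<psi> j x\<bar> / b j / (2 * a0 x))"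
      using a0 b by (intro sum_ennreal) (simp add: less_imp_le)
    then have "(\<Sum>j\<in>supp \<nu>. \<bar>\<psi> j x\<bar> / b j / (2 * a0 x)) \<le> kappa_tilde D a0 \<psi> b \<nu>"
      using elim(1) unfolding eq by (simp add: ennreal_le_iff kappa_tilde_def)
    then have "(\<Sum>j\<in>supp \<nu>. \<bar>\<psi> j x\<bar> / b j) / (2 * a0 x) \<le> kappa_tilde D a0 \<psi> b \<nu>"
      unfolding sum_divide_distrib[symmetric] .
    then show ?case using a0 by (simp add: pos_divide_le_eq mult.commute mult.left_commute)
  qed
qed

end

section \<open>Multi-indices with entries zero and one\<close>

lemma F1_downward: "\<nu> \<in> F1 \<Longrightarrow> \<omega> \<le> \<nu> \<Longrightarrow> \<omega> \<in> F1"
proof -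
  assume \<nu>: "\<nu> \<in> F1" and le: "\<omega> \<le> \<nu>"
  have l: "\<omega> j \<le> \<nu> j" for j using le by (simp add: le_fun_def)
  have "\<nu> j \<in> {0, 1}" for j using \<nu> unfolding F1_def by blast
  then have "\<omega> j \<in> {0, 1}" for j using l[of j] by (metis insert_iff le_0_eq le_antisym less_one not_less singletonD)
  moreover have "supp \<omega> \<subseteq> supp \<nu>" unfolding supp_def using l by (auto intro: less_le_trans)
  ultimately show ?thesis using \<nu> unfolding F1_def by (auto intro: finite_subset)
qed

lemma F1_supp:
  assumes "\<nu> \<in> F1"
  shows "finite (supp \<nu>)" "mi_abs \<nu> = card (supp \<nu>)" "mi_pow b \<nu> = (\<Prod>j\<in>supp \<nu>. b j)"
    "\<nu> = (\<lambda>j. of_bool (j \<in> supp \<nu>))"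
proof -
  have one: "\<nu> j = 1" if "j \<in> supp \<nu>" for j
    using assms that unfolding F1_def supp_def by (metis (mono_tags, lifting) insertE less_numeral_extra(3) mem_Collect_eq singletonD)
  show "finite (supp \<nu>)" using assms unfolding F1_def by blast
  show "mi_abs \<nu> = card (supp \<nu>)" unfolding mi_abs_def using one by simp
  show "mi_pow b \<nu> = (\<Prod>j\<in>supp \<nu>. b j)" unfolding mi_pow_def using one by simp
  show "\<nu> = (\<lambda>j. of_bool (j \<in> supp \<nu>))"
    using one by (auto simp: fun_eq_iff supp_def)
qed

lemma supp_of_bool [simp]: "supp (\<lambda>j. of_bool (j \<in> T)) = T"
  by (auto simp: supp_def)

lemma of_bool_le_F1:
  assumes "\<nu> \<in> F1" "T \<subseteq> supp \<nu>"
  shows "(\<lambda>j. of_bool (j \<in> T)) \<le> \<nu>"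
  using assms(2) by (subst F1_supp(4)[OF assms(1)]) (auto simp: le_fun_def)

text \<open>Multi-indices below \<open>\<nu>\<close> are the indicators of the subsets of its support.\<close>

lemma sum_multi_indices_below:
  fixes h :: "(nat \<Rightarrow> nat) \<Rightarrow> real"
  assumes \<nu>: "\<nu> \<in> F1"
  shows "(\<Sum>\<omega> | \<omega> \<le> \<nu> \<and> mi_abs \<omega> = k. h \<omega>) = (\<Sum>T | T \<subseteq> supp \<nu> \<and> card T = k. h (\<lambda>j. of_bool (j \<in> T)))"
proof (rule sum.reindex_bij_witness[where i = "\<lambda>T j. of_bool (j \<in> T)" and j = supp])
  fix \<omega> assume "\<omega> \<in> {\<omega>. \<omega> \<le> \<nu> \<and> mi_abs \<omega> = k}"
  then have le: "\<omega> \<le> \<nu>" and abs: "mi_abs \<omega> = k" by auto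
  note F = F1_supp[OF F1_downward[OF \<nu> le]]
  show "(\<lambda>j. of_bool (j \<in> supp \<omega>)) = \<omega>" using F(4) by simp
  show "h (\<lambda>j. of_bool (j \<in> supp \<omega>)) = h \<omega>" using F(4) by simp
  have "supp \<omega> \<subseteq> supp \<nu>" using le by (auto simp: supp_def le_fun_def intro: less_le_trans)
  then show "supp \<omega> \<in> {T. T \<subseteq> supp \<nu> \<and> card T = k}" using F(2) abs by simp
next
  fix T assume T: "T \<in> {T. T \<subseteq> supp \<nu> \<and> card T = k}"
  then have le: "(\<lambda>j. of_bool (j \<in> T)) \<le> \<nu>" using of_bool_le_F1[OF \<nu>] by blast
  then show "(\<lambda>j. of_bool (j \<in> T)) \<in> {\<omega>. \<omega> \<le> \<nu> \<and> mi_abs \<omega> = k}"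
    using F1_supp(2)[OF F1_downward[OF \<nu> le]] T by simp
  show "supp (\<lambda>j. of_bool (j \<in> T)) = T" by simp
qed

section \<open>The bounds for the mixed derivatives\<close>

theorem theorem1:
  fixes D :: "(real^'d) set"
    and a0 :: "real^'d \<Rightarrow> real" and \<psi> :: "nat \<Rightarrow> real^'d \<Rightarrow> real"
    and a0min a0max \<kappa>bar :: real and b :: "nat \<Rightarrow> real"
    and f :: "(real^'d \<Rightarrow> real) \<Rightarrow> real"
    and u :: "(nat \<Rightarrow> real) \<Rightarrow> real^'d \<Rightarrow> real"
    and \<nu> :: "nat \<Rightarrow> nat" and \<kappa> :: ennreal
  assumes dim: "CARD('d) \<in> {1, 2, 3}"
    and dom: "bounded_convex_Lipschitz_polyhedral_domain D"
    and a0_meas: "a0 \<in> borel_measurable (lebesgue_on D)"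
    and a0_bounds: "0 < a0min" "AE x in lebesgue_on D. a0min \<le> a0 x \<and> a0 x \<le> a0max"
    and psi_meas: "\<And>j. \<psi> j \<in> borel_measurable (lebesgue_on D)"
    and kbar: "0 < \<kappa>bar" "\<kappa>bar < 1"
      "Linf_norm D (\<lambda>x. \<Sum>j. ennreal (\<bar>\<psi> j x\<bar> / (2 * a0 x))) \<le> ennreal \<kappa>bar"
    and b: "\<And>j. 0 < b j" "\<And>j. b j \<le> 1"
    and kappa: "\<kappa> = Linf_norm D (\<lambda>x. \<Sum>j. ennreal (\<bar>\<psi> j x\<bar> / b j / (2 * a0 x)))"
      "ennreal \<kappa>bar \<le> \<kappa>" "\<kappa> < 1"
    and nu: "\<nu> \<in> F1"
    and f: "f \<in> V_dual D"
    and u: "\<And>y. y \<in> param_U \<Longrightarrow> weak_solution D (diffusion a0 \<psi> y) f (u y)"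
  shows "(\<forall>\<omega>\<le>\<nu>. has_mixed_deriv D u \<omega> (mixed_deriv D \<omega> u)) \<and>
    (\<forall>k\<in>{0..mi_abs \<nu>}. \<forall>y\<in>param_U.
      (\<Sum>\<omega> | \<omega> \<le> \<nu> \<and> mi_abs \<omega> = k.
          mi_pow b \<omega> powi (- 2) * (V_norm D (mixed_deriv D \<omega> u y))\<^sup>2)
        \<le> ((2 * kappa_tilde D a0 \<psi> b \<nu> / (1 - \<kappa>bar)) ^ k
             * (dual_norm D f / ((1 - \<kappa>bar) * a0min)))\<^sup>2) \<and>
    (\<forall>y\<in>param_U.
      V_norm D (mixed_deriv D \<nu> u y)
        \<le> mi_pow b \<nu> * (2 * kappa_tilde D a0 \<psi> b \<nu> / (1 - \<kappa>bar)) ^ mi_abs \<nu>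
             * (dual_norm D f / ((1 - \<kappa>bar) * a0min)))"
proof -
  interpret parametric_diffusion D a0 \<psi> a0min a0max \<kappa>bar f u
  proof unfold_locales
    show "open D" "bounded D"
      using dom unfolding bounded_convex_Lipschitz_polyhedral_domain_def by blast+
  qed (fact a0_meas a0_bounds psi_meas kbar f u)+
  let ?R = "\<lambda>k. (2 * kappa_tilde D a0 \<psi> b \<nu> / (1 - \<kappa>bar)) ^ k * (dual_norm D f / ((1 - \<kappa>bar) * a0min))"
  note supp_nu = F1_supp[OF nu]
  have kt: "0 \<le> kappa_tilde D a0 \<psi> b \<nu>" by (simp add: kappa_tilde_def)
  have small: "Linf_norm D (\<lambda>x. \<Sum>j. ennreal (\<bar>\<psi> j x\<bar> / b j / (2 * a0 x))) < 1"
    using kappa(1,3) by simp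
  have level: "(\<Sum>\<omega> | \<omega> \<le> \<nu> \<and> mi_abs \<omega> = k. mi_pow b \<omega> powi (- 2) * (V_norm D (mixed_deriv D \<omega> u y))\<^sup>2) \<le> (?R k)\<^sup>2"
    if y: "y \<in> param_U" for k y
  proof -
    have "(\<Sum>\<omega> | \<omega> \<le> \<nu> \<and> mi_abs \<omega> = k. mi_pow b \<omega> powi (- 2) * (V_norm D (mixed_deriv D \<omega> u y))\<^sup>2)
        = (\<Sum>T | T \<subseteq> supp \<nu> \<and> card T = k. (V_norm D (du T y))\<^sup>2 / (\<Prod>j\<in>T. b j)\<^sup>2)"
      unfolding sum_multi_indices_below[OF nu]
    proof (rule sum.cong[OF refl])
      fix T assume "T \<in> {T. T \<subseteq> supp \<nu> \<and> card T = k}"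
      then have F: "(\<lambda>j. of_bool (j \<in> T)) \<in> F1"
        using F1_downward[OF nu of_bool_le_F1[OF nu]] by blast
      show "mi_pow b (\<lambda>j. of_bool (j \<in> T)) powi (- 2) * (V_norm D (mixed_deriv D (\<lambda>j. of_bool (j \<in> T)) u y))\<^sup>2
          = (V_norm D (du T y))\<^sup>2 / (\<Prod>j\<in>T. b j)\<^sup>2"
        unfolding F1_supp(3)[OF F] mixed_deriv_G(2)[OF F y]
        by (simp add: power_int_minus field_simps)
    qed
    also have "\<dots> \<le> (?R k)\<^sup>2"
      by (rule weighted_level_estimate[OF y supp_nu(1) b(1) kt kappa_tilde_bound[OF supp_nu(1) b(1) small]])
    finally show ?thesis .
  qed
  have top: "V_norm D (mixed_deriv D \<nu> u y) \<le> mi_pow b \<nu> * ?R (mi_abs \<nu>)" if y: "y \<in> param_U" for y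
  proof -
    have bp: "mi_pow b \<nu> > 0" unfolding supp_nu(3) using b(1) by (intro prod_pos) blast
    have R: "0 \<le> ?R (mi_abs \<nu>)"
      using kt kbar a0min_pos dual_norm_nonneg[OF f]
      by (intro mult_nonneg_nonneg zero_le_power divide_nonneg_nonneg) auto
    have "{\<omega>. \<omega> \<le> \<nu> \<and> mi_abs \<omega> = mi_abs \<nu>} = {\<nu>}"
    proof (intro equalityI subsetI)
      fix \<omega> assume "\<omega> \<in> {\<omega>. \<omega> \<le> \<nu> \<and> mi_abs \<omega> = mi_abs \<nu>}"
      then have le: "\<omega> \<le> \<nu>" and abs: "mi_abs \<omega> = mi_abs \<nu>" by auto
      note F = F1_supp[OF F1_downward[OF nu le]]
      have "supp \<omega> \<subseteq> supp \<nu>" using le by (auto simp: supp_def le_fun_def intro: less_le_trans)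
      then have "supp \<omega> = supp \<nu>"
        using abs card_subset_eq[OF supp_nu(1)] unfolding F(2) supp_nu(2) by blast
      then show "\<omega> \<in> {\<nu>}" using F(4) supp_nu(4) by simp
    qed auto
    then have "mi_pow b \<nu> powi (- 2) * (V_norm D (mixed_deriv D \<nu> u y))\<^sup>2 \<le> (?R (mi_abs \<nu>))\<^sup>2"
      using level[OF y, of "mi_abs \<nu>"] by simp
    then have "(V_norm D (mixed_deriv D \<nu> u y))\<^sup>2 \<le> (mi_pow b \<nu> * ?R (mi_abs \<nu>))\<^sup>2"
      using bp by (simp add: power_int_minus power_mult_distrib field_simps)
    then show ?thesis
      by (rule power2_le_imp_le[OF _ mult_nonneg_nonneg[OF less_imp_le[OF bp] R]])
  qed
  show ?thesis
  proof (intro conjI allI impI ballI)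
    show "has_mixed_deriv D u \<omega> (mixed_deriv D \<omega> u)" if "\<omega> \<le> \<nu>" for \<omega>
      by (rule mixed_deriv_G(1)[OF F1_downward[OF nu that]])
  qed (use level top in \<open>auto simp: mult.assoc\<close>)
qed

end
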